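(* Let $N\ge2$ and let $\Omega\subset\mathbb{R}^N$ be a bounded convex open set. Then for every $\beta\ge0$, \[ \frac1N\binom{N+\beta}{N}^{-1}\ \le\ \frac{\int_\Omega d_\Omega^\beta\,dx}{r_\Omega^{\beta+1}P(\Omega)}\ <\ \frac1{\beta+1}. \] The lower bound is an equality if and only if $|\Omega|=\frac{P(\Omega)\,r_\Omega}{N}$. The upper bound is asymptotically attained as $L\to\infty$ by the slab-type domains $\Omega_L=(-\frac L2,\frac L2)^{N-1}\times(0,1)$, i.e. $\frac{\int_{\Omega_L}d_{\Omega_L}^\beta\,dx}{r_{\Omega_L}^{\beta+1}P(\Omega_L)}\to\frac1{\beta+1}$.
   Context: $d_\Omega(x)=\inf\{|x-y|:y\in\partial\Omega\}$ is the distance from the boundary; $r_\Omega=\sup\{r>0:\ B_r(x_0)\subset\Omega\text{ for some }x_0\in\Omega\}$ is the inradius; $P(\Omega)$ is the De Giorgi perimeter and $|\Omega|$ the Lebesgue measure. For real $\beta\ge0$, $\binom{N+\beta}{N}:=\frac{\Gamma(N+\beta+1)}{\Gamma(\beta+1)\Gamma(N+1)}$. *)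

theory Defs
  imports "HOL-Analysis.Analysis"
begin

definition dist_bdry :: "'a::euclidean_space set \<Rightarrow> 'a \<Rightarrow> real" where
  "dist_bdry \<Omega> x = infdist x (frontier \<Omega>)"

definition inradius :: "'a::euclidean_space set \<Rightarrow> real" where
  "inradius \<Omega> = Sup {r. r > 0 \<and> (\<exists>x0\<in>\<Omega>. ball x0 r \<subseteq> \<Omega>)}"

definition divergence :: "('a::euclidean_space \<Rightarrow> 'a) \<Rightarrow> 'a \<Rightarrow> real" where
  "divergence \<phi> x = (\<Sum>b\<in>Basis. frechet_derivative \<phi> (at x) b \<bullet> b)"

definition test_fields :: "('a::euclidean_space \<Rightarrow> 'a) set" where
  "test_fields = {\<phi>. (\<forall>x. \<phi> differentiable (at x))
      \<and> (\<forall>b\<in>Basis. continuous_on UNIV (\<lambda>x. frechet_derivative \<phi> (at x) b))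
      \<and> compact (closure {x. \<phi> x \<noteq> 0})
      \<and> (\<forall>x. norm (\<phi> x) \<le> 1)}"

text \<open>De Giorgi perimeter (real-valued; meaningful when the supremum is finite).\<close>
definition perimeter :: "'a::euclidean_space set \<Rightarrow> real" where
  "perimeter E = Sup {integral E (divergence \<phi>) | \<phi>. \<phi> \<in> test_fields}"

definition binom_real :: "nat \<Rightarrow> real \<Rightarrow> real" where
  "binom_real N \<beta> = Gamma (real N + \<beta> + 1) / (Gamma (\<beta> + 1) * Gamma (real N + 1))"

definition slab :: "'a::euclidean_space \<Rightarrow> real \<Rightarrow> 'a set" where
  "slab e L = {x. 0 < x \<bullet> e \<and> x \<bullet> e < 1 \<and>
                  (\<forall>b\<in>Basis - {e}. - L / 2 < x \<bullet> b \<and> x \<bullet> b < L / 2)}"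

definition ratio :: "real \<Rightarrow> 'a::euclidean_space set \<Rightarrow> real" where
  "ratio \<beta> \<Omega> = integral \<Omega> (\<lambda>x. dist_bdry \<Omega> x powr \<beta>)
                   / (inradius \<Omega> powr (\<beta> + 1) * perimeter \<Omega>)"

end

theory Submission
  imports Defs
begin

text \<open>
  Let d be the distance from the boundary, r the inradius, P the perimeter, N the dimension and
  f(t) the volume of the set d > t. Since the weighted integral of d is an integral of
  f against a positive kernel, everything reduces to bounds for f.

  Contracting the domain by the factor 1 - t/r towards an incentre maps it into the set d > t,
  so f(t) is at least (1 - t/r)^N times the volume, and the collar of width t has volume at most
  (N |\<Omega>| / r) t + o(t); as the perimeter is bounded by the collar volume per unit width,
  P r / N \<le> |\<Omega>|. This gives the lower bound.

  For the other estimates d is replaced by a smooth concave function D, the soft minimum of finitely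
  many affine functions that measure the distance from supporting hyperplanes. Its negative gradient m
  satisfies |m| \<le> 1 and div m = l (1 - |m|^2) with l as large as we like. The fields (1 - W(D)) m are
  admissible for the perimeter and have divergence at least W'(D), which yields f(t) \<le> (r - t) P.
  The inequality is strict at t = 0 because d is not affine near a suitable point with d < r, which
  forces div m to have positive mass there.
  Integrating W(D) div \<phi> by parts bounds the flux of an admissible field through the set d > t by the
  volume of a shell per unit width. Applied to a rescaled m, with the contracted domain inside the set d > t, this gives
  f(s) - f(t) \<ge> (t - s) (1 - t/r)^(N-1) P, hence f(t) \<le> (1 - t/r)^N |\<Omega>| if |\<Omega>| = P r / N.
\<close>

subsection \<open>Smooth ramps and steps\<close>

text \<open>The perimeter is a supremum over C^1 fields, so statements about it are turned into
  statements about volumes of collars by integrating a function of the distance by parts. The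
  distance itself is not differentiable, and at its ridges the eikonal identity breaks down. For a
  soft minimum this defect reappears as 1 - |m|^2; since div m is l times the same quantity, it can
  be absorbed when l is large, or kept as a positive gain when strictness is wanted. Perimeters of
  inner parallel sets never occur: the factor (1 - t/r)^(N-1) comes from rescaling a single field.
  That field has to nearly attain P and to have nonnegative divergence, so that passing from the
  contracted copy of \<Omega> to the larger set d > t can only increase the flux. The exponent
  \<beta> = 0 is treated apart, because the layer-cake kernel \<beta> s^(\<beta> - 1) serves \<beta>
  > 0 only; at 0 the moment is the volume.\<close>

definition ramp :: "real \<Rightarrow> real \<Rightarrow> real" where
  "ramp \<eta> v = ((max 0 v)\<^sup>2 - (max 0 (v - \<eta>))\<^sup>2) / (2 * \<eta>)"

text \<open>Climbs linearly from 0 to 1 across [0, \<eta>]. Its antiderivative \<open>ramp\<close>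
  is thus a C^1 substitute for the positive part, and the slope never exceeds 1.\<close>

definition ramp_slope :: "real \<Rightarrow> real \<Rightarrow> real" where
  "ramp_slope \<eta> v = (max 0 v - max 0 (v - \<eta>)) / \<eta>"

text \<open>A C^1 transition from 0 to 1. Smoothing stretches it to [s, t + \<eta>], but the slope
  stays at most 1 / (t - s), which is the constant that matters for shells.\<close>

definition step :: "real \<Rightarrow> real \<Rightarrow> real \<Rightarrow> real \<Rightarrow> real" where
  "step \<eta> s t u = (ramp \<eta> (u - s) - ramp \<eta> (u - t)) / (t - s)"

definition step_slope :: "real \<Rightarrow> real \<Rightarrow> real \<Rightarrow> real \<Rightarrow> real" where
  "step_slope \<eta> s t u = (ramp_slope \<eta> (u - s) - ramp_slope \<eta> (u - t)) / (t - s)"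

lemma DERIV_max_0_square:
  "((\<lambda>v::real. (max 0 v)\<^sup>2) has_real_derivative 2 * max 0 v) (at v)"
proof -
  have d: "((\<lambda>v::real. (max 0 v)\<^sup>2) has_real_derivative 2 * max 0 v) (at v)" if "v \<noteq> 0" for v
  proof (cases "v > 0")
    case True
    have "((\<lambda>v::real. v\<^sup>2) has_real_derivative 2 * max 0 v) (at v)"
      using True by (auto intro!: derivative_eq_intros)
    then show ?thesis
      by (rule DERIV_cong_ev[THEN iffD1, rotated -1])
        (use True in \<open>auto intro!: eventually_mono[OF order_tendstoD(1)[OF tendsto_ident_at, of 0]]
           simp: eventually_nhds_conv_at\<close>)
  next
    case False
    then have "v < 0" using that by simp
    have "((\<lambda>v::real. 0) has_real_derivative 2 * max 0 v) (at v)"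
      using \<open>v < 0\<close> by (auto intro!: derivative_eq_intros)
    then show ?thesis
      by (rule DERIV_cong_ev[THEN iffD1, rotated -1])
        (use \<open>v < 0\<close> in \<open>auto intro!: eventually_mono[OF order_tendstoD(2)[OF tendsto_ident_at, of _ 0]]
           simp: eventually_nhds_conv_at\<close>)
  qed
  have "((\<lambda>v::real. (max 0 v)\<^sup>2) has_real_derivative 0) (at 0)"
  proof -
    have "((\<lambda>h::real. (max 0 h)\<^sup>2 / h) \<longlongrightarrow> 0) (at 0)"
    proof (rule Lim_null_comparison)
      show "\<forall>\<^sub>F h in at (0::real). norm ((max 0 h)\<^sup>2 / h) \<le> \<bar>h\<bar>"
        by (rule always_eventually) (auto simp: max_def power2_eq_square)
      show "((\<lambda>h::real. \<bar>h\<bar>) \<longlongrightarrow> 0) (at 0)" by (rule tendsto_eq_intros | simp)+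
    qed
    then show ?thesis by (simp add: DERIV_def)
  qed
  then show ?thesis using d by (cases "v = 0") auto
qed

lemma DERIV_ramp:
  assumes "\<eta> > 0" shows "(ramp \<eta> has_real_derivative ramp_slope \<eta> v) (at v)"
proof -
  have "((\<lambda>v. (max 0 (v - \<eta>))\<^sup>2) has_real_derivative 2 * max 0 (v - \<eta>) * 1) (at v)"
    by (rule DERIV_chain2[OF DERIV_max_0_square]) (auto intro!: derivative_eq_intros)
  from DERIV_cdivide[OF DERIV_diff[OF DERIV_max_0_square this], of "2*\<eta>"] show ?thesis
    unfolding ramp_def ramp_slope_def
    by (rule DERIV_cong) (use assms in \<open>simp add: field_simps\<close>)
qed

lemma continuous_ramp_slope: "continuous_on A (ramp_slope \<eta>)"
  unfolding ramp_slope_def divide_inverse by (intro continuous_intros)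

lemma ramp_slope_bounds:
  assumes "\<eta> > 0" shows "0 \<le> ramp_slope \<eta> v" "ramp_slope \<eta> v \<le> 1"
  using assms by (auto simp: ramp_slope_def max_def field_simps)

lemma ramp_slope_mono:
  assumes "\<eta> > 0" "v \<le> w" shows "ramp_slope \<eta> v \<le> ramp_slope \<eta> w"
  using assms by (auto simp: ramp_slope_def max_def intro!: divide_right_mono)

lemma ramp_slope_eq:
  assumes "\<eta> > 0" shows "v \<le> 0 \<Longrightarrow> ramp_slope \<eta> v = 0" "\<eta> \<le> v \<Longrightarrow> ramp_slope \<eta> v = 1"
  using assms by (auto simp: ramp_slope_def max_def)

lemma ramp_eq:
  assumes "\<eta> > 0" shows "v \<le> 0 \<Longrightarrow> ramp \<eta> v = 0" "\<eta> \<le> v \<Longrightarrow> ramp \<eta> v = v - \<eta> / 2"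
  using assms by (auto simp: ramp_def max_def field_simps power2_eq_square)

lemma ramp_mono:
  assumes "\<eta> > 0" "v \<le> w" shows "ramp \<eta> v \<le> ramp \<eta> w"
  by (rule DERIV_nonneg_imp_nondecreasing[OF assms(2)])
    (use assms DERIV_ramp ramp_slope_bounds in blast)

lemma ramp_lipschitz:
  assumes "\<eta> > 0" "v \<le> w" shows "ramp \<eta> w - ramp \<eta> v \<le> w - v"
proof -
  have "v - ramp \<eta> v \<le> w - ramp \<eta> w"
  proof (rule DERIV_nonneg_imp_nondecreasing[OF assms(2)])
    fix x
    have "((\<lambda>v. v - ramp \<eta> v) has_real_derivative 1 - ramp_slope \<eta> x) (at x)"
      by (intro DERIV_diff DERIV_ident DERIV_ramp assms)
    then show "\<exists>y. ((\<lambda>v. v - ramp \<eta> v) has_real_derivative y) (at x) \<and> 0 \<le> y"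
      using ramp_slope_bounds[OF assms(1), of x] by force
  qed
  then show ?thesis by simp
qed

lemma ramp_le:
  assumes "\<eta> > 0" shows "0 \<le> ramp \<eta> v" "ramp \<eta> v \<le> max 0 v"
proof -
  have "0 \<le> ramp \<eta> v \<and> ramp \<eta> v \<le> max 0 v"
    using ramp_eq(1)[OF assms, of v] ramp_mono[OF assms, of 0 v] ramp_lipschitz[OF assms, of 0 v]
      ramp_eq(1)[OF assms, of 0] by (cases "v \<le> 0") auto
  then show "0 \<le> ramp \<eta> v" "ramp \<eta> v \<le> max 0 v" by auto
qed

lemma DERIV_step:
  assumes "\<eta> > 0" shows "(step \<eta> s t has_real_derivative step_slope \<eta> s t u) (at u)"
proof -
  have "((\<lambda>u. ramp \<eta> (u - a)) has_real_derivative ramp_slope \<eta> (u - a) * 1) (at u)" for a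
    by (rule DERIV_chain2[OF DERIV_ramp]) (use assms in \<open>auto intro!: derivative_eq_intros\<close>)
  from DERIV_cdivide[OF DERIV_diff[OF this[of s] this[of t]], of "t - s"] show ?thesis
    unfolding step_def step_slope_def by simp
qed

lemma continuous_step_slope: "continuous_on A (step_slope \<eta> s t)"
  unfolding step_slope_def divide_inverse
  by (intro continuous_intros continuous_on_compose2[OF continuous_ramp_slope]) auto

lemma step_eq:
  assumes "\<eta> > 0" "s < t"
  shows "u \<le> s \<Longrightarrow> step \<eta> s t u = 0" "t + \<eta> \<le> u \<Longrightarrow> step \<eta> s t u = 1"
  using assms by (auto simp: step_def ramp_eq)

lemma step_bounds:
  assumes "\<eta> > 0" "s < t" shows "0 \<le> step \<eta> s t u" "step \<eta> s t u \<le> 1"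
  using assms ramp_mono[OF assms(1), of "u - t" "u - s"] ramp_lipschitz[OF assms(1), of "u - t" "u - s"]
  by (auto simp: step_def)

lemma step_slope_bounds:
  assumes "\<eta> > 0" "s < t" shows "0 \<le> step_slope \<eta> s t u" "step_slope \<eta> s t u \<le> 1 / (t - s)"
proof -
  have "ramp_slope \<eta> (u - s) - ramp_slope \<eta> (u - t) \<le> 1"
    using ramp_slope_bounds[OF assms(1), of "u - s"] ramp_slope_bounds[OF assms(1), of "u - t"] by linarith
  then show "step_slope \<eta> s t u \<le> 1 / (t - s)"
    unfolding step_slope_def using assms by (intro divide_right_mono) auto
  show "0 \<le> step_slope \<eta> s t u"
    using assms ramp_slope_mono[OF assms(1), of "u - t" "u - s"] by (auto simp: step_slope_def)
qed

lemma step_slope_eq: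
  assumes "\<eta> > 0" "s < t"
  shows "u \<le> s \<Longrightarrow> step_slope \<eta> s t u = 0" "t + \<eta> \<le> u \<Longrightarrow> step_slope \<eta> s t u = 0"
  using assms by (auto simp: step_slope_def ramp_slope_eq)

subsection \<open>Integration by parts\<close>

text \<open>The derivative is carried along explicitly, so that divergences are computed without
  \<open>frechet_derivative\<close>. In finite dimension, continuity in each direction amounts to
  continuity of the derivative.\<close>

definition C1_field :: "('a::euclidean_space \<Rightarrow> 'a) \<Rightarrow> ('a \<Rightarrow> 'a \<Rightarrow> 'a) \<Rightarrow> bool" where
  "C1_field \<phi> \<phi>' \<longleftrightarrow> (\<forall>x. (\<phi> has_derivative \<phi>' x) (at x)) \<and> (\<forall>h. continuous_on UNIV (\<lambda>x. \<phi>' x h))"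

text \<open>The divergence of a field with derivative \<open>\<phi>'\<close>.\<close>

definition tr :: "('a::euclidean_space \<Rightarrow> 'a \<Rightarrow> 'a) \<Rightarrow> 'a \<Rightarrow> real" where
  "tr \<phi>' x = (\<Sum>b\<in>Basis. \<phi>' x b \<bullet> b)"

lemma C1_fieldD:
  assumes "C1_field \<phi> \<phi>'"
  shows "(\<phi> has_derivative \<phi>' x) (at x)" "continuous_on A (\<lambda>x. \<phi>' x h)" "continuous_on A \<phi>"
    "continuous_on A (tr \<phi>')"
proof -
  show d: "(\<phi> has_derivative \<phi>' x) (at x)" for x using assms by (simp add: C1_field_def)
  have c: "continuous_on UNIV (\<lambda>x. \<phi>' x h)" for h using assms by (simp add: C1_field_def)
  show c': "continuous_on A (\<lambda>x. \<phi>' x h)" for h using continuous_on_subset[OF c] by simp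
  show "continuous_on A \<phi>"
    using d by (meson continuous_at_imp_continuous_on has_derivative_continuous)
  show "continuous_on A (tr \<phi>')"
    unfolding tr_def by (intro continuous_intros c')
qed

lemma test_field_C1:
  assumes "\<phi> \<in> test_fields" shows "C1_field \<phi> (\<lambda>x. frechet_derivative \<phi> (at x))"
  unfolding C1_field_def
proof (intro conjI allI)
  have d: "(\<phi> has_derivative frechet_derivative \<phi> (at x)) (at x)" for x
    using assms frechet_derivative_works by (auto simp: test_fields_def)
  then show "(\<phi> has_derivative frechet_derivative \<phi> (at x)) (at x)" for x .
  fix h :: 'a
  have "frechet_derivative \<phi> (at x) h = (\<Sum>b\<in>Basis. (h \<bullet> b) *\<^sub>R frechet_derivative \<phi> (at x) b)" for x
  proof -
    interpret linear "frechet_derivative \<phi> (at x)" using d has_derivative_linear by blast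
    show ?thesis
      by (subst euclidean_representation[of h, symmetric]) (simp only: sum scale)
  qed
  moreover have "continuous_on UNIV (\<lambda>x. \<Sum>b\<in>Basis. (h \<bullet> b) *\<^sub>R frechet_derivative \<phi> (at x) b)"
    using assms by (intro continuous_intros) (auto simp: test_fields_def)
  ultimately show "continuous_on UNIV (\<lambda>x. frechet_derivative \<phi> (at x) h)" by simp
qed

lemma set_integrable_continuous_bounded:
  fixes f :: "'a::euclidean_space \<Rightarrow> real"
  assumes "continuous_on UNIV f" "bounded S" "S \<in> sets borel"
  shows "set_integrable lborel S f"
proof -
  have "compact (closure S)" using assms by (simp add: compact_closure)
  then have "set_integrable lborel (closure S) f"
    unfolding set_integrable_def
    by (rule borel_integrable_compact) (rule continuous_on_subset[OF assms(1)], simp)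
  then show ?thesis
    by (rule set_integrable_subset) (use assms closure_subset in auto)
qed

lemma integrable_continuous_bounded_support:
  fixes f :: "'a::euclidean_space \<Rightarrow> real"
  assumes "continuous_on UNIV f" "bounded S" "\<And>x. x \<notin> S \<Longrightarrow> f x = 0"
  shows "integrable lborel f"
proof -
  have "set_integrable lborel (closure S) f"
    using assms by (intro set_integrable_continuous_bounded) auto
  moreover have "(\<lambda>x. indicator (closure S) x *\<^sub>R f x) = f"
    using assms(3) closure_subset[of S] by (force simp: indicator_def)
  ultimately show ?thesis by (simp add: set_integrable_def)
qed

lemma integral_translate:
  fixes g :: "'a::euclidean_space \<Rightarrow> real"
  assumes "g \<in> borel_measurable borel"
  shows "(\<integral>x. g (c + x) \<partial>lborel) = (\<integral>x. g x \<partial>lborel)"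
  using integral_distr[of "(+) c" lborel borel g] assms
  by (simp add: lborel_distr_plus)

lemma integrable_translate:
  fixes g :: "'a::euclidean_space \<Rightarrow> real"
  assumes "integrable lborel g"
  shows "integrable lborel (\<lambda>x. g (c + x))"
  using integrable_distr_eq[of "(+) c" lborel borel g] assms
  by (simp add: lborel_distr_plus borel_measurable_integrable)

text \<open>Translation invariance gives every difference quotient integral 0. The mean value
  theorem bounds the quotients by the supremum of the derivative, and dominated convergence passes
  to the limit. All integration by parts below rests on this.\<close>

lemma integral_directional_derivative:
  fixes g :: "'a::euclidean_space \<Rightarrow> real"
  assumes der: "\<And>x. (g has_derivative G x) (at x)"
    and cont: "continuous_on UNIV (\<lambda>x. G x b)"
    and S: "bounded S" "\<And>x. x \<notin> S \<Longrightarrow> g x = 0"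
  shows "integrable lborel (\<lambda>x. G x b)" "(\<integral>x. G x b \<partial>lborel) = 0"
proof -
  have G0: "G x b = 0" if "x \<notin> closure S" for x
  proof -
    have "(g has_derivative (\<lambda>h. 0)) (at x)"
    proof (rule has_derivative_transform_within_open[where f="\<lambda>_. 0" and s="- closure S"])
      show "\<And>y. y \<in> - closure S \<Longrightarrow> 0 = g y" using S(2) closure_subset by (metis ComplD subsetD)
    qed (use that in \<open>auto intro: open_Compl\<close>)
    with der[of x] have "G x = (\<lambda>h. 0)" using has_derivative_unique by blast
    then show ?thesis by simp
  qed
  have bS: "bounded (closure S)" using S(1) by (rule bounded_closure)
  show int: "integrable lborel (\<lambda>x. G x b)"
    by (rule integrable_continuous_bounded_support[OF cont bS G0])
  have contg: "continuous_on UNIV g"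
    using der by (meson continuous_at_imp_continuous_on has_derivative_continuous)
  have intg: "integrable lborel g" by (rule integrable_continuous_bounded_support[OF contg S])
  have mg: "g \<in> borel_measurable borel" using contg by (rule borel_measurable_continuous_onI)
  obtain M where M: "\<And>x. \<bar>G x b\<bar> \<le> M"
  proof -
    have "bounded ((\<lambda>x. G x b) ` closure S)"
      using S cont by (intro compact_imp_bounded compact_continuous_image) (auto intro: continuous_on_subset)
    then obtain M where "\<And>x. x \<in> closure S \<Longrightarrow> \<bar>G x b\<bar> \<le> M" by (auto simp: bounded_iff)
    then have "\<bar>G x b\<bar> \<le> max M 0" for x using G0[of x] by (cases "x \<in> closure S") (force simp: max_def)+
    then show ?thesis using that by blast
  qed
  obtain R where R: "S \<subseteq> cball 0 R" using S(1) unfolding bounded_iff by (metis mem_cball_0 subsetI)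
  \<comment> \<open>Contains the supports of all difference quotients with step at most 1, so it
    carries the dominating function.\<close>
  define K where "K = cball (0::'a) (R + norm b)"
  have K: "x \<in> K" if "g (c *\<^sub>R b + x) \<noteq> 0" "0 \<le> c" "c \<le> 1" for x c
  proof -
    have "c *\<^sub>R b + x \<in> S" using S that by auto
    then have "norm (c *\<^sub>R b + x) \<le> R" using R by auto
    moreover have "norm x \<le> norm (c *\<^sub>R b + x) + norm (c *\<^sub>R b)"
      using norm_triangle_ineq4[of "c *\<^sub>R b + x" "c *\<^sub>R b"] by simp
    moreover have "norm (c *\<^sub>R b) \<le> norm b" using that by (simp add: mult_left_le_one_le)
    ultimately show ?thesis by (simp add: K_def)
  qed
  define u where "u n x = (g ((1 / real (Suc n)) *\<^sub>R b + x) - g x) * real (Suc n)" for n x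
  have zero: "(\<integral>x. u n x \<partial>lborel) = 0" for n
  proof -
    have "(\<integral>x. u n x \<partial>lborel) = ((\<integral>x. g ((1 / real (Suc n)) *\<^sub>R b + x) \<partial>lborel) - (\<integral>x. g x \<partial>lborel)) * real (Suc n)"
      unfolding u_def using intg integrable_translate[OF intg] by (simp del: of_nat_Suc)
    then show ?thesis by (simp add: integral_translate[OF mg])
  qed
  have line: "((\<lambda>t. g (x + t *\<^sub>R b)) has_real_derivative G (x + t *\<^sub>R b) b) (at t)" for x t
  proof -
    have "((\<lambda>t. x + t *\<^sub>R b) has_derivative (\<lambda>t. t *\<^sub>R b)) (at t)"
      by (auto intro!: derivative_eq_intros)
    from has_derivative_compose[OF this der]
    have "((\<lambda>t. g (x + t *\<^sub>R b)) has_derivative (\<lambda>s. G (x + t *\<^sub>R b) (s *\<^sub>R b))) (at t)" .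
    moreover have "G y (s *\<^sub>R b) = G y b * s" for y s
      using has_derivative_linear[OF der[of y]] by (simp add: linear_cmul)
    ultimately show ?thesis by (simp add: has_field_derivative_def)
  qed
  have "(\<lambda>n. \<integral>x. u n x \<partial>lborel) \<longlonglongrightarrow> (\<integral>x. G x b \<partial>lborel)"
  proof (rule integral_dominated_convergence[where w="\<lambda>x. indicator K x *\<^sub>R M"])
    show "(\<lambda>x. G x b) \<in> borel_measurable lborel" using int by auto
    show "u n \<in> borel_measurable lborel" for n
      unfolding u_def using mg by measurable
    show "integrable lborel (\<lambda>x. indicator K x *\<^sub>R M)"
      by (rule borel_integrable_compact) (auto simp: K_def)
    show "AE x in lborel. (\<lambda>n. u n x) \<longlonglongrightarrow> G x b"
    proof (rule AE_I2)
      fix x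
      have "((\<lambda>h. (g (x + h *\<^sub>R b) - g x) / h) \<longlongrightarrow> G x b) (at 0)"
        using line[of x 0] by (simp add: DERIV_def)
      moreover have "filterlim (\<lambda>n. 1 / real (Suc n)) (at 0) sequentially"
        using LIMSEQ_Suc[OF lim_1_over_n] by (auto simp: filterlim_at)
      ultimately have "(\<lambda>n. (g (x + (1 / real (Suc n)) *\<^sub>R b) - g x) / (1 / real (Suc n))) \<longlonglongrightarrow> G x b"
        by (rule filterlim_compose)
      then show "(\<lambda>n. u n x) \<longlonglongrightarrow> G x b"
        by (simp add: u_def add.commute del: of_nat_Suc)
    qed
    show "AE x in lborel. norm (u n x) \<le> indicator K x *\<^sub>R M" for n
    proof (rule AE_I2)
      fix x
      define c where "c = 1 / real (Suc n)"
      have c: "0 < c" "c \<le> 1" by (auto simp: c_def)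
      show "norm (u n x) \<le> indicator K x *\<^sub>R M"
      proof (cases "x \<in> K")
        case True
        have "\<exists>z>0. z < c \<and> g (x + c *\<^sub>R b) - g (x + 0 *\<^sub>R b) = (c - 0) * G (x + z *\<^sub>R b) b"
          by (rule MVT2[where f="\<lambda>t. g (x + t *\<^sub>R b)"]) (use c line in auto)
        then obtain z where "g (x + c *\<^sub>R b) - g x = c * G (x + z *\<^sub>R b) b" by auto
        then have "u n x = G (x + z *\<^sub>R b) b"
          using c by (simp add: u_def c_def add.commute)
        then show ?thesis using True M by simp
      next
        case False
        then have "g x = 0" "g (c *\<^sub>R b + x) = 0" using K[of 0 x] K[of c x] c by auto
        then show ?thesis using False by (simp add: u_def c_def)
      qed
    qed
  qed
  then show "(\<integral>x. G x b \<partial>lborel) = 0"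
    unfolding zero using LIMSEQ_unique tendsto_const by metis
qed

text \<open>The components of W(D) \<phi> have directional derivatives with integral 0; they are
  summed over the basis. Bounded support comes from W(D) alone, so \<phi> may be any C^1 field. The
  sign is positive because m is the negative gradient of D.\<close>

lemma integral_compose_divergence:
  fixes \<phi> :: "'a::euclidean_space \<Rightarrow> 'a"
  assumes \<phi>: "C1_field \<phi> \<phi>'"
    and D: "\<And>x. (D has_derivative (\<lambda>h. - (m x \<bullet> h))) (at x)" and m: "continuous_on UNIV m"
    and W: "\<And>u. (W has_real_derivative w u) (at u)" and w: "continuous_on UNIV w"
    and S: "bounded S" "\<And>x. x \<notin> S \<Longrightarrow> W (D x) = 0"
  shows "(\<integral>x. W (D x) * tr \<phi>' x \<partial>lborel) = (\<integral>x. w (D x) * (m x \<bullet> \<phi> x) \<partial>lborel)"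
    "integrable lborel (\<lambda>x. W (D x) * tr \<phi>' x)" "integrable lborel (\<lambda>x. w (D x) * (m x \<bullet> \<phi> x))"
proof -
  note C = C1_fieldD[OF \<phi>]
  have contD: "continuous_on UNIV D"
    using D by (meson continuous_at_imp_continuous_on has_derivative_continuous)
  have contW: "continuous_on UNIV W"
    using W by (meson DERIV_isCont continuous_at_imp_continuous_on)
  have cWD: "continuous_on UNIV (\<lambda>x. W (D x))"
    by (rule continuous_on_compose2[OF contW contD]) auto
  have cwD: "continuous_on UNIV (\<lambda>x. w (D x))"
    by (rule continuous_on_compose2[OF w contD]) auto
  define G where "G b x h = W (D x) * (\<phi>' x h \<bullet> b) - w (D x) * (m x \<bullet> h) * (\<phi> x \<bullet> b)" for b x h :: 'a
  have der: "((\<lambda>x. W (D x) * (\<phi> x \<bullet> b)) has_derivative G b x) (at x)" for b x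
  proof -
    have "((\<lambda>x. W (D x)) has_derivative (\<lambda>h. - (m x \<bullet> h) * w (D x))) (at x)"
      using has_derivative_compose[OF D, of W "(*) (w (D x))" x] W[of "D x"]
      by (simp add: has_field_derivative_def mult.commute[of _ "w (D x)"])
    moreover have "((\<lambda>x. \<phi> x \<bullet> b) has_derivative (\<lambda>h. \<phi>' x h \<bullet> b)) (at x)"
      by (rule has_derivative_inner_left[OF C(1)])
    ultimately show ?thesis
      by (rule has_derivative_eq_rhs[OF has_derivative_mult]) (auto simp: G_def algebra_simps)
  qed
  have cont: "continuous_on UNIV (\<lambda>x. G b x b)" for b
    unfolding G_def by (intro continuous_intros cWD cwD C m)
  have z: "integrable lborel (\<lambda>x. G b x b)" "(\<integral>x. G b x b \<partial>lborel) = 0" for b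
    using integral_directional_derivative[OF der cont S(1)] S(2) by auto
  show i1: "integrable lborel (\<lambda>x. W (D x) * tr \<phi>' x)"
    by (rule integrable_continuous_bounded_support[OF _ S(1)]) (auto intro!: continuous_intros cWD C simp: S)
  have sumG: "(\<Sum>b\<in>Basis. G b x b) = W (D x) * tr \<phi>' x - w (D x) * (m x \<bullet> \<phi> x)" for x
    by (simp add: G_def tr_def sum_subtractf sum_distrib_left euclidean_inner[of "m x" "\<phi> x"] mult.assoc)
  have i2: "integrable lborel (\<lambda>x. \<Sum>b\<in>Basis. G b x b)" using z by auto
  have "integrable lborel (\<lambda>x. W (D x) * tr \<phi>' x - (\<Sum>b\<in>Basis. G b x b))"
    by (rule Bochner_Integration.integrable_diff[OF i1 i2])
  then show i3: "integrable lborel (\<lambda>x. w (D x) * (m x \<bullet> \<phi> x))" unfolding sumG by simp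
  have "(\<integral>x. (\<Sum>b\<in>Basis. G b x b) \<partial>lborel) = 0" using z by simp
  then show "(\<integral>x. W (D x) * tr \<phi>' x \<partial>lborel) = (\<integral>x. w (D x) * (m x \<bullet> \<phi> x) \<partial>lborel)"
    unfolding sumG using i1 i3 by simp
qed

subsection \<open>Distance from the boundary of a convex domain\<close>

lemma measure_affine_image:
  fixes S :: "'a::euclidean_space set"
  assumes "S \<in> sets borel" "(\<lambda>x. c *\<^sub>R x + a) ` S \<in> sets borel"
  shows "measure lborel ((\<lambda>x. c *\<^sub>R x + a) ` S) = \<bar>c\<bar> ^ DIM('a) * measure lborel S"
  using measure_lebesgue_affine[of c a S] assms by (simp add: measure_completion)

locale convex_domain =
  fixes \<Omega> :: "'a::euclidean_space set"
  assumes bounded: "bounded \<Omega>" and convex: "convex \<Omega>" and "open": "open \<Omega>" and nonempty: "\<Omega> \<noteq> {}"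
begin

abbreviation d :: "'a \<Rightarrow> real" where "d \<equiv> dist_bdry \<Omega>"

text \<open>The support function of \<Omega>. On \<Omega>, the distance d x is the minimum of
  \<open>supp \<nu> - \<nu> \<bullet> x\<close> over unit vectors \<nu>; see
  \<open>d_le_supp\<close> and \<open>d_attained\<close>.\<close>

definition supp :: "'a \<Rightarrow> real" where "supp \<nu> = (SUP y\<in>\<Omega>. \<nu> \<bullet> y)"

definition vol_above :: "real \<Rightarrow> real" where
  "vol_above t = measure lborel {x\<in>\<Omega>. t < d x}"

lemma frontier_nonempty: "frontier \<Omega> \<noteq> {}"
  using bounded nonempty not_bounded_UNIV by (auto simp: frontier_eq_empty)

lemma continuous_d: "continuous_on A d"
  unfolding dist_bdry_def by (intro continuous_intros)

lemma d_nonneg: "0 \<le> d x"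
  by (simp add: dist_bdry_def infdist_nonneg)

lemma frontier_notin: "x \<in> frontier \<Omega> \<Longrightarrow> x \<notin> \<Omega>"
  using "open" frontier_disjoint_eq by blast

lemma d_pos: "x \<in> \<Omega> \<Longrightarrow> 0 < d x"
  unfolding dist_bdry_def
  using frontier_notin frontier_nonempty by (intro infdist_pos_not_in_closed) auto

text \<open>A ball is connected, so if it met both \<Omega> and its complement it would contain a
  boundary point closer than d x.\<close>

lemma ball_d_subset:
  assumes "x \<in> \<Omega>" shows "ball x (d x) \<subseteq> \<Omega>"
proof (rule ccontr)
  assume "\<not> ?thesis"
  then have "ball x (d x) - \<Omega> \<noteq> {}" by auto
  moreover have "ball x (d x) \<inter> \<Omega> \<noteq> {}" using assms d_pos[OF assms] centre_in_ball by blast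
  ultimately obtain y where "y \<in> ball x (d x)" "y \<in> frontier \<Omega>"
    using connected_Int_frontier[of "ball x (d x)" \<Omega>] by auto
  then show False
    using infdist_le[of y "frontier \<Omega>" x] by (simp add: dist_bdry_def)
qed

lemma d_ge:
  assumes "ball x \<rho> \<subseteq> \<Omega>" shows "\<rho> \<le> d x"
  unfolding dist_bdry_def infdist_notempty[OF frontier_nonempty]
  by (rule cINF_greatest[OF frontier_nonempty]) (use assms frontier_notin in \<open>force simp: subset_iff\<close>)

text \<open>A convex combination of two inscribed balls is an inscribed ball whose radius is the
  same combination of radii.\<close>

lemma d_concave:
  assumes "x \<in> \<Omega>" "y \<in> \<Omega>" "0 \<le> u" "u \<le> 1"
  shows "(1 - u) * d x + u * d y \<le> d ((1 - u) *\<^sub>R x + u *\<^sub>R y)"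
proof (rule d_ge, rule subsetI)
  fix z assume z: "z \<in> ball ((1 - u) *\<^sub>R x + u *\<^sub>R y) ((1 - u) * d x + u * d y)"
  define \<rho> where "\<rho> = (1 - u) * d x + u * d y"
  define v where "v = z - ((1 - u) *\<^sub>R x + u *\<^sub>R y)"
  have v: "norm v < \<rho>" using z by (simp add: \<rho>_def v_def dist_norm norm_minus_commute)
  then have \<rho>: "\<rho> > 0" using norm_ge_zero[of v] by linarith
  \<comment> \<open>The displacement v from the new centre is shared out in proportion to the two
    radii; the shares recombine to v.\<close>
  have "p + (d p / \<rho>) *\<^sub>R v \<in> \<Omega>" if "p \<in> \<Omega>" for p
  proof -
    have "d p * norm v < d p * \<rho>" using v d_pos[OF that] by simp
    then have "p + (d p / \<rho>) *\<^sub>R v \<in> ball p (d p)"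
      using \<rho> d_pos[OF that] by (simp add: dist_norm field_simps)
    then show ?thesis using ball_d_subset[OF that] by blast
  qed
  then have "(1 - u) *\<^sub>R (x + (d x / \<rho>) *\<^sub>R v) + u *\<^sub>R (y + (d y / \<rho>) *\<^sub>R v) \<in> \<Omega>"
    using convex assms by (simp add: convex_alt)
  also have "(1 - u) *\<^sub>R (x + (d x / \<rho>) *\<^sub>R v) + u *\<^sub>R (y + (d y / \<rho>) *\<^sub>R v)
      = ((1 - u) *\<^sub>R x + u *\<^sub>R y) + (((1 - u) * d x + u * d y) / \<rho>) *\<^sub>R v"
    by (simp add: algebra_simps add_divide_distrib diff_divide_distrib)
  also have "\<dots> = z" using \<rho> by (simp add: \<rho>_def[symmetric] v_def)
  finally show "z \<in> \<Omega>" .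
qed

lemma bdd_above_inner: "bdd_above ((\<lambda>y. \<nu> \<bullet> y) ` \<Omega>)"
proof -
  obtain R where "\<And>y. y \<in> \<Omega> \<Longrightarrow> norm y \<le> R" using bounded by (auto simp: bounded_iff)
  then have "\<nu> \<bullet> y \<le> norm \<nu> * R" if "y \<in> \<Omega>" for y
    using norm_cauchy_schwarz[of \<nu> y] mult_left_mono[of "norm y" R "norm \<nu>"] that by force
  then show ?thesis by (auto intro!: bdd_aboveI2)
qed

lemma supp_ge: "y \<in> \<Omega> \<Longrightarrow> \<nu> \<bullet> y \<le> supp \<nu>"
  unfolding supp_def by (rule cSUP_upper[OF _ bdd_above_inner])

lemma supp_le: "(\<And>y. y \<in> \<Omega> \<Longrightarrow> \<nu> \<bullet> y \<le> a) \<Longrightarrow> supp \<nu> \<le> a"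
  unfolding supp_def using nonempty by (intro cSUP_least) auto

text \<open>Lets a finite net of directions stand in for the whole sphere.\<close>

lemma supp_lipschitz:
  assumes "\<And>y. y \<in> \<Omega> \<Longrightarrow> norm y \<le> R"
  shows "supp \<mu> \<le> supp \<nu> + R * norm (\<mu> - \<nu>)"
proof (rule supp_le)
  fix y assume y: "y \<in> \<Omega>"
  have "\<mu> \<bullet> y = \<nu> \<bullet> y + (\<mu> - \<nu>) \<bullet> y" by (simp add: inner_diff_left)
  also have "(\<mu> - \<nu>) \<bullet> y \<le> norm (\<mu> - \<nu>) * norm y" by (rule norm_cauchy_schwarz)
  also have "\<dots> \<le> norm (\<mu> - \<nu>) * R" using assms[OF y] by (rule mult_left_mono) simp
  finally show "\<mu> \<bullet> y \<le> supp \<nu> + R * norm (\<mu> - \<nu>)"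
    using supp_ge[OF y, of \<nu>] by (simp add: mult.commute)
qed

text \<open>Moving from x by \<rho> < d x in direction \<nu> stays inside \<Omega>, hence below the
  supporting hyperplane.\<close>

lemma d_le_supp:
  assumes "norm \<nu> = 1" "x \<in> \<Omega>" shows "d x \<le> supp \<nu> - \<nu> \<bullet> x"
proof (rule dense_le)
  fix \<rho> assume "\<rho> < d x"
  show "\<rho> \<le> supp \<nu> - \<nu> \<bullet> x"
  proof (cases "\<rho> \<ge> 0")
    case True
    then have "x + \<rho> *\<^sub>R \<nu> \<in> \<Omega>"
      using ball_d_subset[OF assms(2)] \<open>\<rho> < d x\<close> assms(1) by (auto simp: subset_iff dist_norm)
    from supp_ge[OF this, of \<nu>] show ?thesis
      using assms(1) by (simp add: inner_add_right dot_square_norm)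
  next
    case False
    then show ?thesis using supp_ge[OF assms(2), of \<nu>] by linarith
  qed
qed

lemma supporting_direction:
  assumes "y \<notin> \<Omega>" shows "\<exists>\<nu>. norm \<nu> = 1 \<and> supp \<nu> \<le> \<nu> \<bullet> y"
proof -
  obtain a b where a: "a \<noteq> 0" "\<forall>x\<in>\<Omega>. a \<bullet> x \<le> b" "b \<le> a \<bullet> y"
    using separating_hyperplane_sets[of \<Omega> "{y}"] convex nonempty assms by auto
  define \<nu> where "\<nu> = a /\<^sub>R norm a"
  have "norm \<nu> = 1" using a by (simp add: \<nu>_def)
  moreover have "supp \<nu> \<le> \<nu> \<bullet> y"
  proof (rule supp_le)
    fix x assume "x \<in> \<Omega>"
    then have "a \<bullet> x \<le> a \<bullet> y" using a by force
    then show "\<nu> \<bullet> x \<le> \<nu> \<bullet> y" by (simp add: \<nu>_def divide_right_mono divide_inverse_commute[symmetric])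
  qed
  ultimately show ?thesis by blast
qed

text \<open>Take the supporting hyperplane at a boundary point nearest to x and apply
  Cauchy-Schwarz.\<close>

lemma d_attained:
  assumes "x \<in> \<Omega>" shows "\<exists>\<nu>. norm \<nu> = 1 \<and> supp \<nu> - \<nu> \<bullet> x \<le> d x"
proof -
  obtain y where y: "y \<in> frontier \<Omega>" "d x = dist x y"
    unfolding dist_bdry_def using infdist_attains_inf[OF frontier_closed frontier_nonempty] by blast
  obtain \<nu> where \<nu>: "norm \<nu> = 1" "supp \<nu> \<le> \<nu> \<bullet> y"
    using supporting_direction frontier_notin[OF y(1)] by blast
  have "\<nu> \<bullet> (y - x) \<le> norm \<nu> * norm (y - x)" by (rule norm_cauchy_schwarz)
  then have "supp \<nu> - \<nu> \<bullet> x \<le> d x"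
    using \<nu> y(2) by (simp add: inner_diff_right dist_norm norm_minus_commute)
  then show ?thesis using \<nu> by blast
qed

text \<open>The maximum of d over the compact closure is positive, so it is attained off the
  boundary; by \<open>d_ge\<close> no inscribed ball has a larger radius.\<close>

lemma inradius_attained: "\<exists>x0\<in>\<Omega>. d x0 = inradius \<Omega> \<and> (\<forall>x\<in>\<Omega>. d x \<le> d x0)"
proof -
  have "compact (closure \<Omega>)" "closure \<Omega> \<noteq> {}" using bounded nonempty by auto
  then obtain x0 where x0: "x0 \<in> closure \<Omega>" "\<And>x. x \<in> closure \<Omega> \<Longrightarrow> d x \<le> d x0"
    using continuous_attains_sup[OF _ _ continuous_d] by blast
  obtain p where "p \<in> \<Omega>" using nonempty by blast
  then have "0 < d x0" using x0(2)[of p] d_pos closure_subset by force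
  then have "x0 \<notin> frontier \<Omega>" by (auto simp: dist_bdry_def)
  then have x0in: "x0 \<in> \<Omega>" using x0 "open" by (simp add: frontier_def interior_open)
  have max: "d x \<le> d x0" if "x \<in> \<Omega>" for x using x0(2) that closure_subset by blast
  have "inradius \<Omega> = d x0"
    unfolding inradius_def
  proof (rule cSup_eq_maximum)
    show "d x0 \<in> {r. r > 0 \<and> (\<exists>x0\<in>\<Omega>. ball x0 r \<subseteq> \<Omega>)}"
      using ball_d_subset[OF x0in] x0in \<open>0 < d x0\<close> by blast
    fix r assume "r \<in> {r. r > 0 \<and> (\<exists>x0\<in>\<Omega>. ball x0 r \<subseteq> \<Omega>)}"
    then obtain x where "x \<in> \<Omega>" "ball x r \<subseteq> \<Omega>" by auto
    then show "r \<le> d x0" using max[of x] d_ge[of x r] by linarith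
  qed
  then show ?thesis using x0in max by auto
qed

lemma inradius_pos: "0 < inradius \<Omega>"
  using inradius_attained d_pos by force

lemma d_le_inradius: "x \<in> \<Omega> \<Longrightarrow> d x \<le> inradius \<Omega>"
  using inradius_attained by force

lemma sets_\<Omega>: "\<Omega> \<in> sets borel" using "open" by auto

lemma open_above: "open {x\<in>\<Omega>. t < d x}"
proof -
  have "open {x. t < d x}" by (intro open_Collect_less continuous_d continuous_intros)
  moreover have "{x\<in>\<Omega>. t < d x} = \<Omega> \<inter> {x. t < d x}" by auto
  ultimately show ?thesis using "open" by auto
qed

lemma d_measurable: "d \<in> borel_measurable borel"
  by (rule borel_measurable_continuous_onI[OF continuous_d])

lemma sets_level: "Measurable.pred borel P \<Longrightarrow> {x\<in>\<Omega>. P (d x)} \<in> sets borel"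
proof -
  assume "Measurable.pred borel P"
  then have "Measurable.pred borel (\<lambda>x. P (d x))" by (rule measurable_compose[OF d_measurable])
  then have "{x. P (d x)} \<in> sets borel" by (simp add: pred_def)
  moreover have "{x\<in>\<Omega>. P (d x)} = \<Omega> \<inter> {x. P (d x)}" by auto
  ultimately show ?thesis using sets_\<Omega> by auto
qed

lemma emeasure_finite:
  assumes "S \<subseteq> \<Omega>" "S \<in> sets borel" shows "emeasure lborel S < \<infinity>"
proof -
  have "bounded S" using bounded bounded_subset assms by blast
  then show ?thesis by (rule emeasure_bounded_finite)
qed

lemma fmeasurable_subset:
  assumes "S \<subseteq> \<Omega>" "S \<in> sets borel" shows "S \<in> fmeasurable lborel"
  using emeasure_finite[OF assms] assms by (simp add: fmeasurable_def)

lemma vol_above_0: "vol_above 0 = measure lborel \<Omega>"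
  unfolding vol_above_def using d_pos by (intro arg_cong[where f="measure lborel"]) auto

lemma vol_pos: "0 < measure lborel \<Omega>"
proof -
  have "\<Omega> \<notin> null_sets lborel"
    using open_not_negligible[OF "open" nonempty] sets_\<Omega>
    by (metis negligible_iff_null_sets null_sets_completionI)
  then have "emeasure lborel \<Omega> \<noteq> 0" using sets_\<Omega> by auto
  moreover have "emeasure lborel \<Omega> = ennreal (measure lborel \<Omega>)"
    using emeasure_finite[OF order_refl sets_\<Omega>] by (simp add: emeasure_eq_ennreal_measure less_top)
  ultimately show ?thesis by (simp add: order_less_le)
qed

lemma vol_above_mono: "s \<le> t \<Longrightarrow> vol_above t \<le> vol_above s"
  unfolding vol_above_def
  by (rule measure_mono_fmeasurable) (auto intro!: fmeasurable_subset sets_level)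

lemma vol_above_eq_0: "inradius \<Omega> \<le> t \<Longrightarrow> vol_above t = 0"
proof -
  assume "inradius \<Omega> \<le> t"
  then have "{x\<in>\<Omega>. t < d x} = {}" using d_le_inradius by force
  then show ?thesis by (simp only: vol_above_def measure_empty)
qed

text \<open>Concavity of d on the segment from x to an incentre. The inequality is strict because d
  x > 0 still has the positive weight 1 - t/r.\<close>

lemma homothety_above:
  assumes "x0 \<in> \<Omega>" "d x0 = inradius \<Omega>" "0 \<le> t" "t < inradius \<Omega>" "x \<in> \<Omega>"
  shows "(1 - t / inradius \<Omega>) *\<^sub>R x + (t / inradius \<Omega>) *\<^sub>R x0 \<in> {y\<in>\<Omega>. t < d y}"
proof -
  define u where "u = t / inradius \<Omega>"
  have u: "0 \<le> u" "u < 1" using assms inradius_pos by (auto simp: u_def)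
  have "(1 - u) *\<^sub>R x + u *\<^sub>R x0 \<in> \<Omega>" using convex assms u by (simp add: convex_alt)
  moreover have "t < d ((1 - u) *\<^sub>R x + u *\<^sub>R x0)"
  proof -
    have "t = u * d x0" unfolding assms(2) u_def using inradius_pos by simp
    also have "\<dots> < (1 - u) * d x + u * d x0" using u d_pos[OF assms(5)] by simp
    also have "\<dots> \<le> d ((1 - u) *\<^sub>R x + u *\<^sub>R x0)" using d_concave[OF assms(5,1)] u by simp
    finally show ?thesis .
  qed
  ultimately show ?thesis unfolding u_def by blast
qed

lemma vol_above_homothety:
  assumes "0 \<le> t" "t < inradius \<Omega>"
  shows "(1 - t / inradius \<Omega>) ^ DIM('a) * measure lborel \<Omega> \<le> vol_above t"
proof -
  obtain x0 where x0: "x0 \<in> \<Omega>" "d x0 = inradius \<Omega>" using inradius_attained by blast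
  define u where "u = t / inradius \<Omega>"
  have u: "0 \<le> u" "u < 1" using assms inradius_pos by (auto simp: u_def)
  let ?T = "\<lambda>x. (1 - u) *\<^sub>R x + u *\<^sub>R x0"
  have op: "open (?T ` \<Omega>)"
    using open_affinity[OF "open", of "1 - u" "u *\<^sub>R x0"] u by (simp add: add.commute)
  have "(1 - u) ^ DIM('a) * measure lborel \<Omega> = measure lborel (?T ` \<Omega>)"
    using measure_affine_image[OF sets_\<Omega>, of "1 - u" "u *\<^sub>R x0"] op u by simp
  also have "\<dots> \<le> vol_above t"
    unfolding vol_above_def
  proof (rule measure_mono_fmeasurable)
    show "?T ` \<Omega> \<subseteq> {x\<in>\<Omega>. t < d x}"
      using homothety_above[OF x0 assms] unfolding u_def by blast
  qed (use op in \<open>auto intro!: fmeasurable_subset sets_level\<close>)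
  finally show ?thesis by (simp add: u_def)
qed

end

subsection \<open>Soft minima of affine functions\<close>

locale softmin =
  fixes J :: "'a::euclidean_space set" and c :: "'a \<Rightarrow> real" and l :: real
  assumes J: "finite J" "J \<noteq> {}" "\<And>\<nu>. \<nu> \<in> J \<Longrightarrow> norm \<nu> = 1" and l_pos: "l > 0"
begin

definition e where "e \<nu> x = exp (- l * (c \<nu> - \<nu> \<bullet> x))"
definition Z where "Z x = (\<Sum>\<nu>\<in>J. e \<nu> x)"
definition D where "D x = - ln (Z x) / l"
text \<open>Gibbs weights: a probability vector on J that concentrates on the nearest hyperplanes as
  l grows. Then \<open>m\<close> is the mean direction, and the derivative \<open>m'\<close> is l
  times the covariance matrix.\<close>

definition p where "p \<nu> x = e \<nu> x / Z x"
definition m where "m x = (\<Sum>\<nu>\<in>J. p \<nu> x *\<^sub>R \<nu>)"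
definition m' where "m' x h = l *\<^sub>R ((\<Sum>\<nu>\<in>J. (p \<nu> x * (\<nu> \<bullet> h)) *\<^sub>R \<nu>) - (m x \<bullet> h) *\<^sub>R m x)"

lemma e_pos: "0 < e \<nu> x" by (simp add: e_def)

lemma Z_pos: "0 < Z x" unfolding Z_def using J by (intro sum_pos e_pos) auto

lemma p_pos: "0 < p \<nu> x" by (simp add: p_def e_pos Z_pos)

lemma sum_p: "(\<Sum>\<nu>\<in>J. p \<nu> x) = 1"
  using Z_pos[of x] by (simp add: p_def sum_divide_distrib[symmetric] Z_def[symmetric])

lemma e_deriv: "(e \<nu> has_derivative (\<lambda>h. l * (\<nu> \<bullet> h) * e \<nu> x)) (at x)"
  unfolding e_def[abs_def] by (auto intro!: derivative_eq_intros simp: algebra_simps)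

lemma m_inner: "m x \<bullet> h = (\<Sum>\<nu>\<in>J. p \<nu> x * (\<nu> \<bullet> h))"
  by (simp add: m_def inner_sum_left)

lemma Z_deriv: "(Z has_derivative (\<lambda>h. l * (m x \<bullet> h) * Z x)) (at x)"
proof -
  have "(Z has_derivative (\<lambda>h. \<Sum>\<nu>\<in>J. l * (\<nu> \<bullet> h) * e \<nu> x)) (at x)"
    unfolding Z_def[abs_def] by (intro has_derivative_sum e_deriv)
  also have "(\<lambda>h. \<Sum>\<nu>\<in>J. l * (\<nu> \<bullet> h) * e \<nu> x) = (\<lambda>h. l * (m x \<bullet> h) * Z x)"
    using Z_pos[of x] by (auto simp: m_inner p_def sum_distrib_left sum_distrib_right field_simps intro!: sum.cong)
  finally show ?thesis .
qed

lemma D_deriv: "(D has_derivative (\<lambda>h. - (m x \<bullet> h))) (at x)"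
proof -
  have "((\<lambda>x. - ln (Z x) / l) has_derivative (\<lambda>h. - (m x \<bullet> h))) (at x)"
    using Z_pos[of x] l_pos by (auto intro!: derivative_eq_intros Z_deriv simp: field_simps)
  then show ?thesis by (simp add: D_def[abs_def])
qed

lemma p_deriv: "(p \<nu> has_derivative (\<lambda>h. l * p \<nu> x * (\<nu> \<bullet> h - m x \<bullet> h))) (at x)"
proof -
  have "((\<lambda>x. e \<nu> x / Z x) has_derivative (\<lambda>h. l * p \<nu> x * (\<nu> \<bullet> h - m x \<bullet> h))) (at x)"
    using Z_pos[of x]
    by (auto intro!: derivative_eq_intros Z_deriv e_deriv simp: p_def field_simps)
  then show ?thesis by (simp add: p_def[abs_def])
qed

lemma m_deriv: "(m has_derivative m' x) (at x)"
proof -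
  have "(m has_derivative (\<lambda>h. \<Sum>\<nu>\<in>J. (l * p \<nu> x * (\<nu> \<bullet> h - m x \<bullet> h)) *\<^sub>R \<nu>)) (at x)"
    unfolding m_def[abs_def]
    by (intro has_derivative_sum has_derivative_scaleR_left p_deriv[unfolded m_def])
  also have "(\<lambda>h. \<Sum>\<nu>\<in>J. (l * p \<nu> x * (\<nu> \<bullet> h - m x \<bullet> h)) *\<^sub>R \<nu>) = m' x"
  proof
    fix h
    have "(\<Sum>\<nu>\<in>J. (l * p \<nu> x * (\<nu> \<bullet> h - m x \<bullet> h)) *\<^sub>R \<nu>)
      = l *\<^sub>R ((\<Sum>\<nu>\<in>J. (p \<nu> x * (\<nu> \<bullet> h)) *\<^sub>R \<nu>) - (m x \<bullet> h) *\<^sub>R (\<Sum>\<nu>\<in>J. p \<nu> x *\<^sub>R \<nu>))"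
      by (simp add: scaleR_sum_right sum_subtractf[symmetric] algebra_simps)
    then show "(\<Sum>\<nu>\<in>J. (l * p \<nu> x * (\<nu> \<bullet> h - m x \<bullet> h)) *\<^sub>R \<nu>) = m' x h"
      by (simp add: m'_def m_def[symmetric])
  qed
  finally show ?thesis .
qed

lemma C1: "C1_field m m'"
  unfolding C1_field_def
proof (intro conjI allI)
  fix h
  have "continuous_on UNIV m" "continuous_on UNIV (p \<nu>)" for \<nu>
    using m_deriv p_deriv by (meson continuous_at_imp_continuous_on has_derivative_continuous)+
  then show "continuous_on UNIV (\<lambda>x. m' x h)"
    unfolding m'_def by (intro continuous_intros) auto
qed (rule m_deriv)

text \<open>The mean of |\<nu>|^2 is 1 because all directions are unit vectors, so the total
  variance is 1 minus the squared norm of the mean.\<close>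

lemma variance: "(\<Sum>\<nu>\<in>J. p \<nu> x * (norm (\<nu> - m x))\<^sup>2) = 1 - (norm (m x))\<^sup>2"
proof -
  have "(\<Sum>\<nu>\<in>J. p \<nu> x * (norm (\<nu> - m x))\<^sup>2)
      = (\<Sum>\<nu>\<in>J. p \<nu> x - 2 * (p \<nu> x * (\<nu> \<bullet> m x)) + p \<nu> x * (norm (m x))\<^sup>2)"
  proof (rule sum.cong)
    fix \<nu> assume "\<nu> \<in> J"
    then have "\<nu> \<bullet> \<nu> = 1" using J(3) by (simp add: dot_square_norm)
    then show "p \<nu> x * (norm (\<nu> - m x))\<^sup>2 = p \<nu> x - 2 * (p \<nu> x * (\<nu> \<bullet> m x)) + p \<nu> x * (norm (m x))\<^sup>2"
      by (simp add: power2_norm_eq_inner inner_diff_left inner_diff_right inner_commute algebra_simps)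
  qed simp
  also have "\<dots> = 1 - 2 * (m x \<bullet> m x) + (norm (m x))\<^sup>2"
    by (simp add: sum.distrib sum_subtractf sum_p m_inner[symmetric] sum_distrib_left[symmetric] sum_distrib_right[symmetric])
  finally show ?thesis by (simp add: power2_norm_eq_inner)
qed

lemma norm_m: "norm (m x) \<le> 1"
proof -
  have "0 \<le> (\<Sum>\<nu>\<in>J. p \<nu> x * (norm (\<nu> - m x))\<^sup>2)" using p_pos by (intro sum_nonneg) (simp add: less_imp_le)
  then have "(norm (m x))\<^sup>2 \<le> 1\<^sup>2" using variance by simp
  then show ?thesis by (rule power2_le_imp_le) simp
qed

text \<open>Wherever m fails to have unit length its divergence is large: this replaces the eikonal equation for D.\<close>
lemma tr_m': "tr m' x = l * (1 - (norm (m x))\<^sup>2)"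
proof -
  have "tr m' x = l * ((\<Sum>\<nu>\<in>J. p \<nu> x * (\<Sum>b\<in>Basis. (\<nu> \<bullet> b) * (\<nu> \<bullet> b))) - (\<Sum>b\<in>Basis. (m x \<bullet> b) * (m x \<bullet> b)))"
    unfolding tr_def m'_def
    by (simp add: inner_diff_left inner_sum_left sum_subtractf sum_distrib_left[symmetric] right_diff_distrib)
      (simp add: sum_distrib_left mult.assoc sum.swap[of _ Basis J])
  also have "(\<Sum>\<nu>\<in>J. p \<nu> x * (\<Sum>b\<in>Basis. (\<nu> \<bullet> b) * (\<nu> \<bullet> b))) = (\<Sum>\<nu>\<in>J. p \<nu> x)"
    using J(3) by (intro sum.cong) (auto simp: euclidean_inner[symmetric] dot_square_norm)
  also have "(\<Sum>b\<in>Basis. (m x \<bullet> b) * (m x \<bullet> b)) = (norm (m x))\<^sup>2"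
    by (simp add: euclidean_inner[symmetric] dot_square_norm)
  finally show ?thesis by (simp add: sum_p)
qed

lemma m'_inner: "m' x h \<bullet> h = l * (\<Sum>\<nu>\<in>J. p \<nu> x * ((\<nu> - m x) \<bullet> h)\<^sup>2)"
proof -
  have "(\<Sum>\<nu>\<in>J. p \<nu> x * ((\<nu> - m x) \<bullet> h)\<^sup>2)
     = (\<Sum>\<nu>\<in>J. p \<nu> x * (\<nu> \<bullet> h)\<^sup>2 - 2 * (p \<nu> x * (\<nu> \<bullet> h)) * (m x \<bullet> h) + p \<nu> x * (m x \<bullet> h)\<^sup>2)"
    by (rule sum.cong) (auto simp: inner_diff_left power2_eq_square algebra_simps)
  also have "\<dots> = (\<Sum>\<nu>\<in>J. p \<nu> x * (\<nu> \<bullet> h)\<^sup>2) - (m x \<bullet> h)\<^sup>2"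
    by (simp add: sum.distrib sum_subtractf sum_p m_inner[symmetric] sum_distrib_left[symmetric]
       sum_distrib_right[symmetric] power2_eq_square)
  finally show ?thesis
    by (simp add: m'_def inner_diff_left inner_sum_left power2_eq_square mult.assoc)
qed

lemma m'_nonneg: "0 \<le> m' x h \<bullet> h"
  unfolding m'_inner using l_pos p_pos by (intro mult_nonneg_nonneg sum_nonneg) (auto simp: less_imp_le)

text \<open>The variance in one direction is at most the total variance, by Cauchy-Schwarz in each
  term. This turns curvature of D along a segment into divergence of m.\<close>

lemma m'_le: "m' x h \<bullet> h \<le> (norm h)\<^sup>2 * tr m' x"
proof -
  have "(\<Sum>\<nu>\<in>J. p \<nu> x * ((\<nu> - m x) \<bullet> h)\<^sup>2) \<le> (\<Sum>\<nu>\<in>J. (norm h)\<^sup>2 * (p \<nu> x * (norm (\<nu> - m x))\<^sup>2))"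
  proof (rule sum_mono)
    fix \<nu>
    have "((\<nu> - m x) \<bullet> h)\<^sup>2 \<le> (norm (\<nu> - m x) * norm h)\<^sup>2"
      using Cauchy_Schwarz_ineq[of "\<nu> - m x" h] by (simp add: power_mult_distrib power2_norm_eq_inner)
    from mult_left_mono[OF this less_imp_le[OF p_pos[of \<nu> x]]]
    show "p \<nu> x * ((\<nu> - m x) \<bullet> h)\<^sup>2 \<le> (norm h)\<^sup>2 * (p \<nu> x * (norm (\<nu> - m x))\<^sup>2)"
      by (simp add: power_mult_distrib algebra_simps)
  qed
  also have "\<dots> = (norm h)\<^sup>2 * (1 - (norm (m x))\<^sup>2)" by (simp add: sum_distrib_left[symmetric] variance)
  finally show ?thesis
    unfolding m'_inner tr_m' using mult_left_mono[of _ _ l] l_pos by (fastforce simp: mult.left_commute)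
qed

lemma D_le:
  assumes "\<nu> \<in> J" shows "D x \<le> c \<nu> - \<nu> \<bullet> x"
proof -
  have "e \<nu> x \<le> Z x" unfolding Z_def using assms J e_pos by (intro member_le_sum) (auto simp: less_imp_le)
  then have "ln (e \<nu> x) \<le> ln (Z x)" using e_pos Z_pos by simp
  then show ?thesis using l_pos by (simp add: e_def D_def field_simps)
qed

text \<open>Z is at most \<open>card J\<close> times a bound for its terms. The resulting loss ln
  (card J) / l is made small by increasing l.\<close>

lemma D_ge:
  assumes "\<And>\<nu>. \<nu> \<in> J \<Longrightarrow> y \<le> c \<nu> - \<nu> \<bullet> x" shows "y - ln (card J) / l \<le> D x"
proof -
  have "Z x \<le> (\<Sum>\<nu>\<in>J. exp (- l * y))"
    unfolding Z_def e_def using assms l_pos by (intro sum_mono) simp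
  then have "Z x \<le> card J * exp (- l * y)" by simp
  then have "ln (Z x) \<le> ln (card J * exp (- l * y))" using Z_pos[of x] by (subst ln_le_cancel_iff) linarith+
  also have "\<dots> = ln (card J) - l * y" using J by (simp add: ln_mult card_gt_0_iff)
  finally have "(l * y - ln (card J)) / l \<le> (- ln (Z x)) / l" using l_pos by (intro divide_right_mono) auto
  then show ?thesis using l_pos by (simp add: D_def diff_divide_distrib)
qed

end

text \<open>The parameters are the error \<eta> and the stiffness K; m is the negative gradient of D and m' its derivative.\<close>
definition soft_distance ::
  "'a::euclidean_space set \<Rightarrow> real \<Rightarrow> real \<Rightarrow> ('a \<Rightarrow> real) \<Rightarrow> ('a \<Rightarrow> 'a) \<Rightarrow> ('a \<Rightarrow> 'a \<Rightarrow> 'a) \<Rightarrow> bool" where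
  "soft_distance \<Omega> \<eta> K D m m' \<longleftrightarrow>
     (\<forall>x. (D has_derivative (\<lambda>h. - (m x \<bullet> h))) (at x)) \<and> C1_field m m' \<and>
     (\<forall>x. norm (m x) \<le> 1) \<and> (\<forall>x h. 0 \<le> m' x h \<bullet> h) \<and> (\<forall>x h. m' x h \<bullet> h \<le> (norm h)\<^sup>2 * tr m' x) \<and>
     (\<forall>x. K * (1 - (norm (m x))\<^sup>2) \<le> tr m' x) \<and>
     (\<forall>x\<in>\<Omega>. \<bar>D x - dist_bdry \<Omega> x\<bar> \<le> \<eta>) \<and> (\<forall>x. x \<notin> \<Omega> \<longrightarrow> D x \<le> \<eta>)"

lemma finite_net_sphere:
  assumes "\<delta> > 0"
  shows "\<exists>J. finite J \<and> J \<noteq> {} \<and> J \<subseteq> sphere (0::'a::euclidean_space) 1 \<and>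
    (\<forall>\<nu>. norm \<nu> = 1 \<longrightarrow> (\<exists>\<mu>\<in>J. norm (\<mu> - \<nu>) < \<delta>))"
proof -
  obtain J where J: "J \<subseteq> sphere (0::'a) 1" "finite J" "sphere 0 1 \<subseteq> (\<Union>\<nu>\<in>J. ball \<nu> \<delta>)"
    by (rule compactE_image[of "sphere (0::'a) 1" "sphere 0 1" "\<lambda>\<nu>. ball \<nu> \<delta>"])
      (use assms in auto)
  have "J \<noteq> {}" using J(3) by (auto simp: sphere_empty)
  moreover have "\<exists>\<mu>\<in>J. norm (\<mu> - \<nu>) < \<delta>" if "norm \<nu> = 1" for \<nu>
    using J(3) that by (auto simp: subset_iff dist_norm)
  ultimately show ?thesis using J by blast
qed

section \<open>Approximating the distance of a convex domain by soft minima\<close>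

context convex_domain begin

text \<open>The net of directions is chosen from \<eta> and the size of \<Omega>; l comes last, so
  it may depend on the size of the net. The error of the net grows with |x|, so points far outside
  \<Omega> need their own argument.\<close>

lemma soft_distance_exists:
  assumes "\<eta> > 0" shows "\<exists>D m m'. soft_distance \<Omega> \<eta> K D m m'"
proof -
  obtain R where R: "\<And>y. y \<in> \<Omega> \<Longrightarrow> norm y \<le> R" "R > 0"
    using bounded by (auto simp: bounded_pos)
  \<comment> \<open>The net costs R \<delta> + |x| \<delta>, which is at most 3 R \<delta> while |x|
    \<le> 2 R. The cap 1/2 is for larger |x|.\<close>
  define \<delta> where "\<delta> = min (1/2) (\<eta> / (3 * R))"
  have \<delta>: "\<delta> > 0" "\<delta> \<le> 1/2" "3 * R * \<delta> \<le> \<eta>"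
    using assms R by (auto simp: \<delta>_def min_def field_simps)
  obtain J where J: "finite J" "J \<noteq> {}" "J \<subseteq> sphere (0::'a) 1"
    and net: "\<And>\<nu>. norm \<nu> = 1 \<Longrightarrow> \<exists>\<mu>\<in>J. norm (\<mu> - \<nu>) < \<delta>"
    using finite_net_sphere[OF \<delta>(1), where 'a='a] by blast
  \<comment> \<open>The first bound gives the stiffness K, the second makes the softening error at
    most \<eta>.\<close>
  define l where "l = max (max 1 K) (ln (card J) / \<eta>)"
  have l: "l > 0" "l \<ge> K" "ln (card J) / l \<le> \<eta>"
  proof -
    show "l > 0" "l \<ge> K" by (auto simp: l_def)
    have "ln (card J) / \<eta> \<le> l" by (simp add: l_def)
    then show "ln (card J) / l \<le> \<eta>" using assms \<open>l > 0\<close> by (simp add: field_simps)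
  qed
  interpret softmin J supp l by unfold_locales (use J l in auto)
  have near: "D x \<le> supp \<nu> - \<nu> \<bullet> x + R * \<delta> + norm x * \<delta>" if \<nu>: "norm \<nu> = 1" for \<nu> x
  proof -
    obtain \<mu> where \<mu>: "\<mu> \<in> J" "norm (\<mu> - \<nu>) < \<delta>" using net[OF \<nu>] by blast
    have "D x \<le> supp \<mu> - \<mu> \<bullet> x" by (rule D_le[OF \<mu>(1)])
    moreover have "supp \<mu> \<le> supp \<nu> + R * norm (\<mu> - \<nu>)" by (rule supp_lipschitz[OF R(1)])
    moreover have "R * norm (\<mu> - \<nu>) \<le> R * \<delta>" using \<mu> R by simp
    moreover have "\<nu> \<bullet> x - \<mu> \<bullet> x \<le> norm x * \<delta>"
    proof -
      have "\<nu> \<bullet> x - \<mu> \<bullet> x = (\<nu> - \<mu>) \<bullet> x" by (simp add: inner_diff_left)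
      also have "\<dots> \<le> norm (\<nu> - \<mu>) * norm x" by (rule norm_cauchy_schwarz)
      also have "\<dots> \<le> \<delta> * norm x" using \<mu> by (intro mult_right_mono) (auto simp: norm_minus_commute)
      finally show ?thesis by (simp add: mult.commute)
    qed
    ultimately show ?thesis by linarith
  qed
  have inside: "\<bar>D x - d x\<bar> \<le> \<eta>" if x: "x \<in> \<Omega>" for x
  proof -
    have "d x - ln (card J) / l \<le> D x" by (rule D_ge) (use J d_le_supp x in auto)
    moreover obtain \<nu> where \<nu>: "norm \<nu> = 1" "supp \<nu> - \<nu> \<bullet> x \<le> d x" using d_attained[OF x] by blast
    have "norm x * \<delta> \<le> R * \<delta>" using R(1)[OF x] \<delta> by simp
    then have "D x \<le> d x + \<eta>" using near[OF \<nu>(1), of x] \<nu>(2) \<delta> R(2) mult_pos_pos[OF R(2) \<delta>(1)] by linarith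
    ultimately show ?thesis using l by linarith
  qed
  have outside: "D x \<le> \<eta>" if x: "x \<notin> \<Omega>" for x
  proof (cases "norm x \<le> 2 * R")
    case True
    obtain \<nu> where \<nu>: "norm \<nu> = 1" "supp \<nu> \<le> \<nu> \<bullet> x" using supporting_direction[OF x] by blast
    have "norm x * \<delta> \<le> 2 * R * \<delta>" using True \<delta> by simp
    then show ?thesis using near[OF \<nu>(1), of x] \<nu>(2) \<delta> by linarith
  next
    case False
    \<comment> \<open>In the radial direction D x is at most R - |x| + R \<delta> + |x| / 2, and R -
      |x| / 2 < 0 here.\<close>
    define \<nu> where "\<nu> = x /\<^sub>R norm x"
    have x0: "norm x > 0" using False R by auto
    then have \<nu>: "norm \<nu> = 1" "\<nu> \<bullet> x = norm x"
      by (auto simp: \<nu>_def power2_norm_eq_inner[symmetric] power2_eq_square)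
    have "supp \<nu> \<le> R"
    proof (rule supp_le)
      fix y assume "y \<in> \<Omega>"
      then show "\<nu> \<bullet> y \<le> R" using norm_cauchy_schwarz[of \<nu> y] R(1)[of y] \<nu> by simp
    qed
    moreover have "norm x * \<delta> \<le> norm x * (1/2)" using \<delta> by (intro mult_left_mono) auto
    moreover have "3 * R * \<delta> \<le> \<eta>" using \<delta> by simp
    ultimately show ?thesis
      using near[OF \<nu>(1), of x] \<nu>(2) False R(2) mult_pos_pos[OF R(2) \<delta>(1)] by linarith
  qed
  have "K * (1 - (norm (m x))\<^sup>2) \<le> tr m' x" for x
    unfolding tr_m' using l norm_m[of x] by (intro mult_right_mono) (auto simp: abs_square_le_1)
  then have "soft_distance \<Omega> \<eta> K D m m'"
    unfolding soft_distance_def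
    using D_deriv C1 norm_m m'_nonneg m'_le inside outside by blast
  then show ?thesis by blast
qed

end

subsection \<open>Flux and perimeter\<close>

lemma (in convex_domain) flux_integrable:
  assumes "C1_field \<phi> \<phi>'"
  shows "set_integrable lborel \<Omega> (tr \<phi>')" "(LINT x:\<Omega>|lborel. tr \<phi>' x) = integral \<Omega> (tr \<phi>')"
proof -
  show i: "set_integrable lborel \<Omega> (tr \<phi>')"
    by (rule set_integrable_continuous_bounded[OF C1_fieldD(4)[OF assms] bounded sets_\<Omega>])
  show "(LINT x:\<Omega>|lborel. tr \<phi>' x) = integral \<Omega> (tr \<phi>')"
    by (rule set_borel_integral_eq_integral(2)[OF i])
qed

lemma soft_distanceD:
  assumes "soft_distance \<Omega> \<eta> K D m m'"
  shows "(D has_derivative (\<lambda>h. - (m x \<bullet> h))) (at x)" "C1_field m m'" "norm (m x) \<le> 1"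
    "0 \<le> m' x h \<bullet> h" "m' x h \<bullet> h \<le> (norm h)\<^sup>2 * tr m' x" "K * (1 - (norm (m x))\<^sup>2) \<le> tr m' x"
    "x \<in> \<Omega> \<Longrightarrow> \<bar>D x - dist_bdry \<Omega> x\<bar> \<le> \<eta>" "x \<notin> \<Omega> \<Longrightarrow> D x \<le> \<eta>" "0 \<le> tr m' x"
    "continuous_on A D"
proof -
  show d: "(D has_derivative (\<lambda>h. - (m x \<bullet> h))) (at x)" for x using assms by (simp add: soft_distance_def)
  show "continuous_on A D"
    using d by (meson continuous_at_imp_continuous_on has_derivative_continuous)
  have "0 \<le> m' x h \<bullet> h" for h using assms by (auto simp: soft_distance_def)
  then show "0 \<le> tr m' x" unfolding tr_def by (intro sum_nonneg)
qed (use assms in \<open>auto simp: soft_distance_def\<close>)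

lemma set_integral_indicator_mult:
  fixes c :: real
  assumes "A \<in> fmeasurable lborel"
  shows "(\<integral>x. indicator A x * c \<partial>lborel) = measure lborel A * c" "integrable lborel (\<lambda>x. indicator A x * c)"
  using assms by (auto simp: fmeasurable_def)

context convex_domain begin

lemma fmeasurable_level: "Measurable.pred borel P \<Longrightarrow> {x\<in>\<Omega>. P (d x)} \<in> fmeasurable lborel"
  by (rule fmeasurable_subset) (auto intro: sets_level)

lemma vol_above_diff:
  assumes "s \<le> t" shows "vol_above s - vol_above t = measure lborel {x\<in>\<Omega>. s < d x \<and> d x \<le> t}"
proof -
  have "{x\<in>\<Omega>. s < d x \<and> d x \<le> t} = {x\<in>\<Omega>. s < d x} - {x\<in>\<Omega>. t < d x}" by auto
  then show ?thesis unfolding vol_above_def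
    using assms by (simp add: measurable_measure_Diff fmeasurable_level sets_level subset_eq)
qed

text \<open>After integration by parts the integrand is the slope of the step times m \<bullet>
  \<phi>, so it is at most 1 / (t - s) and lives on a shell. The hypothesis \<epsilon> \<le> s makes
  the step vanish outside \<Omega>.\<close>

lemma integral_step_le:
  assumes soft: "soft_distance \<Omega> \<epsilon> K D m m'" and e: "0 < \<epsilon>" "\<epsilon> \<le> s" "s < t"
    and \<phi>: "C1_field \<phi> \<phi>'" "\<And>x. norm (\<phi> x) \<le> 1"
  shows "(\<integral>x. step \<epsilon> s t (D x) * tr \<phi>' x \<partial>lborel) \<le> measure lborel {x\<in>\<Omega>. s - \<epsilon> < d x \<and> d x < t + 2 * \<epsilon>} / (t - s)"
    "integrable lborel (\<lambda>x. step \<epsilon> s t (D x) * tr \<phi>' x)"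
proof -
  note sd = soft_distanceD[OF soft]
  let ?A = "{x\<in>\<Omega>. s - \<epsilon> < d x \<and> d x < t + 2 * \<epsilon>}"
  have z: "step \<epsilon> s t (D x) = 0" if "x \<notin> \<Omega>" for x
    using sd(8)[OF that] e by (intro step_eq) auto
  note I = integral_compose_divergence[OF \<phi>(1) sd(1) C1_fieldD(3)[OF sd(2)] DERIV_step[OF e(1), of s t] continuous_step_slope bounded z]
  show "integrable lborel (\<lambda>x. step \<epsilon> s t (D x) * tr \<phi>' x)" by (rule I(2))
  have A: "?A \<in> fmeasurable lborel" by (rule fmeasurable_level) measurable
  note iA = set_integral_indicator_mult[OF A, of "1 / (t - s)"]
  have "(\<integral>x. step \<epsilon> s t (D x) * tr \<phi>' x \<partial>lborel) = (\<integral>x. step_slope \<epsilon> s t (D x) * (m x \<bullet> \<phi> x) \<partial>lborel)"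
    by (rule I(1))
  also have "\<dots> \<le> (\<integral>x. indicator ?A x * (1 / (t - s)) \<partial>lborel)"
  proof (rule integral_mono[OF I(3) iA(2)])
    fix x
    have "m x \<bullet> \<phi> x \<le> norm (m x) * norm (\<phi> x)" by (rule norm_cauchy_schwarz)
    also have "\<dots> \<le> 1" using sd(3) \<phi>(2) mult_le_one norm_ge_zero by blast
    finally have "step_slope \<epsilon> s t (D x) * (m x \<bullet> \<phi> x) \<le> step_slope \<epsilon> s t (D x) * 1"
      using step_slope_bounds[OF e(1,3)] by (intro mult_left_mono)
    also have "\<dots> \<le> indicator ?A x * (1 / (t - s))"
    proof (cases "x \<in> ?A")
      case True then show ?thesis using step_slope_bounds[OF e(1,3)] by simp
    next
      case False
      \<comment> \<open>Since D is within \<epsilon> of d, the shell is widened by \<epsilon> below;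
        above it is widened by 2 \<epsilon>, the error plus the smoothing width.\<close>
      have "D x \<le> s \<or> t + \<epsilon> \<le> D x"
        using False sd(7)[of x] sd(8)[of x] e by (cases "x \<in> \<Omega>") auto
      then show ?thesis using step_slope_eq[OF e(1,3), of "D x"] e by auto
    qed
    finally show "step_slope \<epsilon> s t (D x) * (m x \<bullet> \<phi> x) \<le> indicator ?A x * (1 / (t - s))" .
  qed
  finally show "(\<integral>x. step \<epsilon> s t (D x) * tr \<phi>' x \<partial>lborel) \<le> measure lborel ?A / (t - s)"
    unfolding iA(1) by simp
qed

text \<open>Cut \<phi> off by a step of a soft distance. The cut-off integral is at most the collar
  volume per unit width, and the part cut away is at most M times the collar volume, where M bounds
  the divergence on \<Omega>. Both estimates are sharp enough as the width tends to 0.\<close>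

lemma flux_le_of_collar:
  assumes \<phi>: "C1_field \<phi> \<phi>'" "\<And>x. norm (\<phi> x) \<le> 1"
    and t0: "t0 > 0" and F: "\<And>t. 0 < t \<Longrightarrow> t < t0 \<Longrightarrow> measure lborel \<Omega> - vol_above t \<le> c * t"
  shows "(LINT x:\<Omega>|lborel. tr \<phi>' x) \<le> c"
proof -
  obtain M where M: "\<And>x. x \<in> \<Omega> \<Longrightarrow> \<bar>tr \<phi>' x\<bar> \<le> M" "0 \<le> M"
  proof -
    have "bounded (tr \<phi>' ` closure \<Omega>)"
      using bounded by (intro compact_imp_bounded compact_continuous_image C1_fieldD[OF \<phi>(1)]) (auto simp: compact_closure)
    then obtain M where "\<And>x. x \<in> \<Omega> \<Longrightarrow> \<bar>tr \<phi>' x\<bar> \<le> M" using closure_subset by (fastforce simp: bounded_iff)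
    moreover from this have "0 \<le> M" using nonempty by force
    ultimately show ?thesis using that by blast
  qed
  have key: "(LINT x:\<Omega>|lborel. tr \<phi>' x) \<le> (1 + 2 * t) * c * (1 / (1 - t) + M * t)"
    if t: "0 < t" "t < 1" "t + 2 * t * t < t0" for t
  proof -
    \<comment> \<open>Of smaller order than t, so that (t + 2 \<epsilon>) / (t - \<epsilon>) tends
      to 1.\<close>
    define \<epsilon> where "\<epsilon> = t * t"
    have e: "0 < \<epsilon>" "\<epsilon> < t" using t by (auto simp: \<epsilon>_def)
    obtain D m m' where soft: "soft_distance \<Omega> \<epsilon> 0 D m m'" using soft_distance_exists[OF e(1)] by blast
    note sd = soft_distanceD[OF soft]
    note I = integral_step_le[OF soft e(1) order_refl e(2) \<phi>]
    define F where "F = measure lborel \<Omega> - vol_above (t + 2 * \<epsilon>)"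
    have Feq: "F = measure lborel {x\<in>\<Omega>. d x \<le> t + 2 * \<epsilon>}"
      unfolding F_def using vol_above_diff[of 0 "t + 2*\<epsilon>"] t e d_pos
      by (simp add: vol_above_0) (auto intro!: arg_cong[where f="measure lborel"])
    let ?B = "{x\<in>\<Omega>. d x \<le> t + 2 * \<epsilon>}"
    have B: "?B \<in> fmeasurable lborel" by (rule fmeasurable_level) measurable
    note iB = set_integral_indicator_mult[OF B, of M]
    have i\<Omega>: "integrable lborel (\<lambda>x. indicator \<Omega> x * tr \<phi>' x)"
      using flux_integrable(1)[OF \<phi>(1)] by (simp add: set_integrable_def)
    have "(LINT x:\<Omega>|lborel. tr \<phi>' x) = (\<integral>x. indicator \<Omega> x * tr \<phi>' x \<partial>lborel)"
      by (simp add: set_lebesgue_integral_def)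
    also have "\<dots> \<le> (\<integral>x. step \<epsilon> \<epsilon> t (D x) * tr \<phi>' x + indicator ?B x * M \<partial>lborel)"
    proof (rule integral_mono[OF i\<Omega>])
      show "integrable lborel (\<lambda>x. step \<epsilon> \<epsilon> t (D x) * tr \<phi>' x + indicator ?B x * M)"
        by (intro Bochner_Integration.integrable_add I iB)
      fix x
      have st: "0 \<le> step \<epsilon> \<epsilon> t (D x)" "step \<epsilon> \<epsilon> t (D x) \<le> 1" using step_bounds[OF e] by auto
      show "indicator \<Omega> x * tr \<phi>' x \<le> step \<epsilon> \<epsilon> t (D x) * tr \<phi>' x + indicator ?B x * M"
      proof (cases "x \<in> \<Omega>")
        case False
        then show ?thesis using step_eq(1)[OF e, of "D x"] sd(8)[OF False] by simp
      next
        case True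
        show ?thesis
        proof (cases "d x \<le> t + 2 * \<epsilon>")
          case True
          have "(1 - step \<epsilon> \<epsilon> t (D x)) * tr \<phi>' x \<le> 1 * M"
          proof -
            have "(1 - step \<epsilon> \<epsilon> t (D x)) * tr \<phi>' x \<le> (1 - step \<epsilon> \<epsilon> t (D x)) * M"
              using st M(1)[OF \<open>x \<in> \<Omega>\<close>] by (intro mult_left_mono) auto
            also have "\<dots> \<le> 1 * M" using st M(2) by (intro mult_right_mono) auto
            finally show ?thesis .
          qed
          then show ?thesis using \<open>x \<in> \<Omega>\<close> True by (simp add: algebra_simps)
        next
          case False
          then have "t + \<epsilon> \<le> D x" using sd(7)[OF \<open>x \<in> \<Omega>\<close>] by linarith
          then show ?thesis using step_eq(2)[OF e] \<open>x \<in> \<Omega>\<close> False by simp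
        qed
      qed
    qed
    also have "\<dots> = (\<integral>x. step \<epsilon> \<epsilon> t (D x) * tr \<phi>' x \<partial>lborel) + F * M"
      using I iB by (simp add: Feq)
    also have "(\<integral>x. step \<epsilon> \<epsilon> t (D x) * tr \<phi>' x \<partial>lborel) \<le> F / (t - \<epsilon>)"
    proof -
      have "measure lborel {x\<in>\<Omega>. \<epsilon> - \<epsilon> < d x \<and> d x < t + 2 * \<epsilon>} \<le> F"
        unfolding Feq by (rule measure_mono_fmeasurable) (use B in \<open>auto intro!: sets_level\<close>)
      then have "measure lborel {x\<in>\<Omega>. \<epsilon> - \<epsilon> < d x \<and> d x < t + 2 * \<epsilon>} / (t - \<epsilon>) \<le> F / (t - \<epsilon>)"
        using e by (intro divide_right_mono) auto
      then show ?thesis using I(1) by linarith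
    qed
    also have "F / (t - \<epsilon>) + F * M = F * (1 / (t - \<epsilon>) + M)" by (simp add: algebra_simps)
    also have "\<dots> \<le> (c * (t + 2 * \<epsilon>)) * (1 / (t - \<epsilon>) + M)"
    proof (rule mult_right_mono)
      have "0 < t + 2 * \<epsilon>" "t + 2 * \<epsilon> < t0" using t e by (auto simp: \<epsilon>_def mult.assoc)
      then show "F \<le> c * (t + 2 * \<epsilon>)" unfolding F_def by (rule F)
    qed (use e M in auto)
    also have "\<dots> = (1 + 2 * t) * c * (1 / (1 - t) + M * t)"
    proof -
      have "t - \<epsilon> = t * (1 - t)" by (simp add: \<epsilon>_def algebra_simps)
      then show ?thesis using t by (simp add: \<epsilon>_def field_simps)
    qed
    finally show ?thesis by simp
  qed
  have lim: "((\<lambda>t. (1 + 2 * t) * c * (1 / (1 - t) + M * t)) \<longlongrightarrow> (1 + 2 * 0) * c * (1 / (1 - 0) + M * 0)) (at_right 0)"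
    by (intro tendsto_intros) auto
  have "eventually (\<lambda>t::real. 0 < t \<and> t < 1 \<and> t + 2 * t * t < t0) (at_right 0)"
  proof -
    have "((\<lambda>t::real. t + 2 * t * t) \<longlongrightarrow> 0 + 2 * 0 * 0) (at_right 0)" by (intro tendsto_intros)
    then have "eventually (\<lambda>t::real. t + 2 * t * t < t0) (at_right 0)" using t0 by (auto dest: order_tendstoD)
    moreover have "eventually (\<lambda>t::real. t < 1) (at_right 0)"
      by (rule order_tendstoD(2)[OF tendsto_ident_at]) simp
    moreover have "eventually (\<lambda>t::real. 0 < t) (at_right 0)" by (rule eventually_at_right_less)
    ultimately show ?thesis by eventually_elim simp
  qed
  then have "eventually (\<lambda>t. (LINT x:\<Omega>|lborel. tr \<phi>' x) \<le> (1 + 2 * t) * c * (1 / (1 - t) + M * t)) (at_right 0)"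
    by eventually_elim (use key in blast)
  from tendsto_lowerbound[OF lim this] show ?thesis by simp
qed

text \<open>Bernoulli's inequality linearises the volume (1 - t/r)^N |\<Omega>| of the contracted
  copy.\<close>

lemma collar_le:
  assumes "0 < t" "t < inradius \<Omega>"
  shows "measure lborel \<Omega> - vol_above t \<le> (DIM('a) * measure lborel \<Omega> / inradius \<Omega>) * t"
proof -
  have "1 + real DIM('a) * (- (t / inradius \<Omega>)) \<le> (1 + - (t / inradius \<Omega>)) ^ DIM('a)"
    using assms inradius_pos by (intro Bernoulli_inequality) (auto simp: field_simps)
  then have "(1 + real DIM('a) * (- (t / inradius \<Omega>))) * measure lborel \<Omega> \<le> (1 - t / inradius \<Omega>) ^ DIM('a) * measure lborel \<Omega>"
    by (intro mult_right_mono) auto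
  also have "\<dots> \<le> vol_above t" using assms by (intro vol_above_homothety) auto
  finally show ?thesis by (simp add: algebra_simps)
qed

lemma test_flux:
  assumes "\<phi> \<in> test_fields"
  shows "integral \<Omega> (divergence \<phi>) = (LINT x:\<Omega>|lborel. tr (\<lambda>x. frechet_derivative \<phi> (at x)) x)"
  using flux_integrable(2)[OF test_field_C1[OF assms]]
  by (simp add: divergence_def[abs_def] tr_def[abs_def])

lemma test_flux_le_of_collar:
  assumes "\<phi> \<in> test_fields" "t0 > 0" "\<And>t. 0 < t \<Longrightarrow> t < t0 \<Longrightarrow> measure lborel \<Omega> - vol_above t \<le> c * t"
  shows "integral \<Omega> (divergence \<phi>) \<le> c"
  unfolding test_flux[OF assms(1)]
  by (rule flux_le_of_collar[OF test_field_C1[OF assms(1)] _ assms(2,3)])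
    (use assms(1) in \<open>auto simp: test_fields_def\<close>)

lemma perimeter_set_nonempty: "{integral \<Omega> (divergence \<phi>) | \<phi>. \<phi> \<in> test_fields} \<noteq> {}"
proof -
  have "(\<lambda>x::'a. 0::'a) \<in> test_fields" by (auto simp: test_fields_def)
  then show ?thesis by blast
qed

lemma perimeter_le_of_collar:
  assumes "t0 > 0" "\<And>t. 0 < t \<Longrightarrow> t < t0 \<Longrightarrow> measure lborel \<Omega> - vol_above t \<le> c * t"
  shows "perimeter \<Omega> \<le> c"
  unfolding perimeter_def
  by (rule cSup_least[OF perimeter_set_nonempty]) (use test_flux_le_of_collar[OF _ assms] in auto)

lemma perimeter_le_volume: "perimeter \<Omega> \<le> DIM('a) * measure lborel \<Omega> / inradius \<Omega>"
  by (rule perimeter_le_of_collar[OF inradius_pos collar_le])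

text \<open>The real \<open>Sup\<close> is an upper bound only for a set bounded above; the collar
  estimate supplies a bound common to all test fields.\<close>

lemma test_flux_le_perimeter:
  assumes "\<phi> \<in> test_fields" shows "integral \<Omega> (divergence \<phi>) \<le> perimeter \<Omega>"
  unfolding perimeter_def
proof (rule cSup_upper)
  show "bdd_above {integral \<Omega> (divergence \<phi>) |\<phi>. \<phi> \<in> test_fields}"
    using test_flux_le_of_collar[OF _ inradius_pos collar_le] by (auto intro!: bdd_aboveI)
qed (use assms in auto)

text \<open>Multiplying by a cut-off that equals 1 on a ball containing \<Omega> makes the support
  compact and leaves the divergence on \<Omega> unchanged.\<close>

lemma flux_le_perimeter:
  assumes \<phi>: "C1_field \<phi> \<phi>'" "\<And>x. norm (\<phi> x) \<le> 1"
  shows "(LINT x:\<Omega>|lborel. tr \<phi>' x) \<le> perimeter \<Omega>"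
proof -
  obtain R where R: "\<And>y. y \<in> \<Omega> \<Longrightarrow> norm y \<le> R" "R > 0" using bounded by (auto simp: bounded_pos)
  \<comment> \<open>A function of |x|^2, hence differentiable at the origin as well. It is 1 up to
    R^2 and 0 from R^2 + 2 on, where the second unit is the smoothing width.\<close>
  define \<zeta> where "\<zeta> x = 1 - step 1 (R\<^sup>2) (R\<^sup>2 + 1) (x \<bullet> x)" for x :: 'a
  define \<zeta>' where "\<zeta>' x h = - (step_slope 1 (R\<^sup>2) (R\<^sup>2 + 1) (x \<bullet> x) * (2 * (x \<bullet> h)))" for x h :: 'a
  have d\<zeta>: "(\<zeta> has_derivative \<zeta>' x) (at x)" for x
  proof -
    have "((\<lambda>x. x \<bullet> x) has_derivative (\<lambda>h. 2 * (x \<bullet> h))) (at x)"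
      by (auto intro!: derivative_eq_intros simp: inner_commute)
    from has_derivative_compose[OF this DERIV_step[of 1 "R\<^sup>2" "R\<^sup>2+1" "x \<bullet> x", unfolded has_field_derivative_def]]
    have "((\<lambda>x. step 1 (R\<^sup>2) (R\<^sup>2+1) (x \<bullet> x)) has_derivative (\<lambda>h. step_slope 1 (R\<^sup>2) (R\<^sup>2 + 1) (x \<bullet> x) * (2 * (x \<bullet> h)))) (at x)"
      by simp
    from has_derivative_diff[OF has_derivative_const this] show ?thesis
      by (simp add: \<zeta>_def[abs_def] \<zeta>'_def[abs_def])
  qed
  have c\<zeta>: "continuous_on UNIV \<zeta>"
    using d\<zeta> by (meson continuous_at_imp_continuous_on has_derivative_continuous)
  have c\<zeta>': "continuous_on UNIV (\<lambda>x. \<zeta>' x h)" for h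
    unfolding \<zeta>'_def by (intro continuous_intros continuous_on_compose2[OF continuous_step_slope]) auto
  note C = C1_fieldD[OF \<phi>(1)]
  define \<psi>' where "\<psi>' x h = \<zeta> x *\<^sub>R \<phi>' x h + \<zeta>' x h *\<^sub>R \<phi> x" for x h
  have d\<psi>: "((\<lambda>x. \<zeta> x *\<^sub>R \<phi> x) has_derivative \<psi>' x) (at x)" for x
    unfolding \<psi>'_def[abs_def] by (rule has_derivative_scaleR[OF d\<zeta> C(1)])
  have \<psi>: "C1_field (\<lambda>x. \<zeta> x *\<^sub>R \<phi> x) \<psi>'"
    unfolding C1_field_def
  proof (intro conjI allI d\<psi>)
    show "continuous_on UNIV (\<lambda>x. \<psi>' x h)" for h
      unfolding \<psi>'_def by (intro continuous_intros c\<zeta> c\<zeta>' C)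
  qed
  have fd: "frechet_derivative (\<lambda>x. \<zeta> x *\<^sub>R \<phi> x) (at x) = \<psi>' x" for x
    using frechet_derivative_at[OF d\<psi>] by simp
  have \<zeta>b: "0 \<le> \<zeta> x" "\<zeta> x \<le> 1" for x
    using step_bounds[of 1 "R\<^sup>2" "R\<^sup>2+1" "x \<bullet> x"] by (auto simp: \<zeta>_def)
  have test: "(\<lambda>x. \<zeta> x *\<^sub>R \<phi> x) \<in> test_fields"
    unfolding test_fields_def mem_Collect_eq
  proof (intro conjI allI ballI)
    show "(\<lambda>x. \<zeta> x *\<^sub>R \<phi> x) differentiable at x" for x using d\<psi> by (auto simp: differentiable_def)
    show "continuous_on UNIV (\<lambda>x. frechet_derivative (\<lambda>x. \<zeta> x *\<^sub>R \<phi> x) (at x) b)" for b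
      unfolding fd by (rule C1_fieldD(2)[OF \<psi>])
    show "norm (\<zeta> x *\<^sub>R \<phi> x) \<le> 1" for x using \<zeta>b \<phi>(2) by (simp add: mult_le_one)
    have "{x. \<zeta> x *\<^sub>R \<phi> x \<noteq> 0} \<subseteq> cball 0 (R + 2)"
    proof (rule subsetI, rule ccontr)
      fix x assume x: "x \<in> {x. \<zeta> x *\<^sub>R \<phi> x \<noteq> 0}" "x \<notin> cball 0 (R + 2)"
      then have "R + 2 \<le> norm x" by simp
      then have "(R + 2)\<^sup>2 \<le> (norm x)\<^sup>2" using R by (intro power_mono) auto
      then have "R\<^sup>2 + 1 + 1 \<le> x \<bullet> x" using R by (simp add: power2_norm_eq_inner power2_sum)
      then have "\<zeta> x = 0" unfolding \<zeta>_def by (subst step_eq(2)) auto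
      then show False using x by simp
    qed
    then show "compact (closure {x. \<zeta> x *\<^sub>R \<phi> x \<noteq> 0})"
      using bounded_subset[OF bounded_cball] by (auto simp: compact_closure)
  qed
  have "tr \<psi>' x = tr \<phi>' x" if "x \<in> \<Omega>" for x
  proof -
    have "(norm x)\<^sup>2 \<le> R\<^sup>2" using R(1)[OF that] by (intro power_mono) auto
    then have "x \<bullet> x \<le> R\<^sup>2" by (simp add: power2_norm_eq_inner)
    then show ?thesis
      by (simp add: tr_def \<psi>'_def \<zeta>'_def \<zeta>_def step_eq step_slope_eq)
  qed
  then have "(LINT x:\<Omega>|lborel. tr \<phi>' x) = (LINT x:\<Omega>|lborel. tr \<psi>' x)"
    using sets_\<Omega> by (intro set_lebesgue_integral_cong) auto
  also have "\<dots> = integral \<Omega> (divergence (\<lambda>x. \<zeta> x *\<^sub>R \<phi> x))"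
    using test_flux[OF test] by (simp add: fd)
  also have "\<dots> \<le> perimeter \<Omega>" by (rule test_flux_le_perimeter[OF test])
  finally show ?thesis .
qed

end

subsection \<open>Calibration by soft distances\<close>

lemma eventually_at_right_0_interval: "0 < (c::real) \<Longrightarrow> eventually (\<lambda>\<epsilon>. 0 < \<epsilon> \<and> \<epsilon> < c) (at_right 0)"
  by (auto simp: eventually_at_right_field intro: exI[of _ c])

context convex_domain begin

text \<open>One half of (1 - W) div m pays for the defect w (1 - |m|^2), which works because 1 - W
  \<ge> \<epsilon> and \<epsilon> K \<ge> 2 a. The other half is kept in the conclusion: it is
  discarded for the weak bound and exploited for the strict one.\<close>

lemma calibration:
  assumes soft: "soft_distance \<Omega> \<epsilon> K D m m'" and e: "0 < \<epsilon>" "\<epsilon> < 1" and t: "t < inradius \<Omega>"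
    and a: "a = (1 - \<epsilon>) / (inradius \<Omega> + 3 * \<epsilon> - t)" and K: "2 * a \<le> \<epsilon> * K"
  shows "a * vol_above t + (LINT x:\<Omega>|lborel. (1 - a * ramp \<epsilon> (D x - (t - 2 * \<epsilon>))) / 2 * tr m' x) \<le> perimeter \<Omega>"
    "0 \<le> 1 - a * ramp \<epsilon> (D x - (t - 2 * \<epsilon>))"
proof -
  note sd = soft_distanceD[OF soft]
  note C = C1_fieldD[OF sd(2)]
  define r where "r = inradius \<Omega>"
  have r: "0 < r" "t < r" using inradius_pos t by (auto simp: r_def)
  have a_pos: "0 < a" using e r by (simp add: a r_def[symmetric])
  \<comment> \<open>As D \<le> r + \<epsilon> everywhere, the argument of the ramp is at most r + 3
    \<epsilon> - t; this normalisation of a therefore keeps W \<le> 1 - \<epsilon>.\<close>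
  have aeq: "a * (r + 3 * \<epsilon> - t) = 1 - \<epsilon>" using e r by (simp add: a r_def[symmetric])
  have "0 < \<epsilon> * K" using K a_pos by linarith
  then have K_pos: "0 < K" using e by (simp add: zero_less_mult_iff)
  define W where "W x = a * ramp \<epsilon> (D x - (t - 2 * \<epsilon>))" for x
  define w where "w x = a * ramp_slope \<epsilon> (D x - (t - 2 * \<epsilon>))" for x
  have D_le: "D x \<le> r + \<epsilon>" for x
    using sd(7)[of x] sd(8)[of x] d_le_inradius[of x] r by (cases "x \<in> \<Omega>") (auto simp: r_def)
  have W: "0 \<le> W x" "W x \<le> 1 - \<epsilon>" for x
  proof -
    show "0 \<le> W x" using a_pos ramp_le(1)[OF e(1)] by (simp add: W_def)
    have "ramp \<epsilon> (D x - (t - 2 * \<epsilon>)) \<le> r + 3 * \<epsilon> - t"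
      using ramp_le(2)[OF e(1), of "D x - (t - 2 * \<epsilon>)"] D_le[of x] r e by linarith
    from mult_left_mono[OF this less_imp_le[OF a_pos]] show "W x \<le> 1 - \<epsilon>" by (simp add: W_def aeq)
  qed
  have w: "0 \<le> w x" "w x \<le> a" for x
    using a_pos ramp_slope_bounds[OF e(1)] by (auto simp: w_def)
  have dW: "(W has_derivative (\<lambda>h. - (w x * (m x \<bullet> h)))) (at x)" for x
  proof -
    have "((\<lambda>x. D x - (t - 2 * \<epsilon>)) has_derivative (\<lambda>h. - (m x \<bullet> h))) (at x)"
      using has_derivative_diff[OF sd(1) has_derivative_const] by simp
    from has_derivative_compose[OF this DERIV_ramp[OF e(1), unfolded has_field_derivative_def]]
    have "((\<lambda>x. a * ramp \<epsilon> (D x - (t - 2 * \<epsilon>))) has_derivative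
       (\<lambda>h. a * (ramp_slope \<epsilon> (D x - (t - 2 * \<epsilon>)) * - (m x \<bullet> h)))) (at x)"
      by (rule has_derivative_mult_right)
    then show ?thesis by (simp add: W_def[abs_def] w_def mult.assoc)
  qed
  have cW: "continuous_on UNIV W"
    using dW by (meson continuous_at_imp_continuous_on has_derivative_continuous)
  have cw: "continuous_on UNIV w"
    unfolding w_def by (intro continuous_intros continuous_on_compose2[OF continuous_ramp_slope] sd) auto
  define \<phi> where "\<phi> x = (1 - W x) *\<^sub>R m x" for x
  define \<phi>' where "\<phi>' x h = (1 - W x) *\<^sub>R m' x h + (w x * (m x \<bullet> h)) *\<^sub>R m x" for x h
  have \<phi>: "C1_field \<phi> \<phi>'"
    unfolding C1_field_def
  proof (intro conjI allI)
    fix x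
    have "((\<lambda>x. 1 - W x) has_derivative (\<lambda>h. w x * (m x \<bullet> h))) (at x)"
      using has_derivative_diff[OF has_derivative_const dW, of 1 x] by simp
    from has_derivative_scaleR[OF this C(1)] show "(\<phi> has_derivative \<phi>' x) (at x)"
      by (simp add: \<phi>_def[abs_def] \<phi>'_def[abs_def])
  next
    show "continuous_on UNIV (\<lambda>x. \<phi>' x h)" for h
      unfolding \<phi>'_def by (intro continuous_intros cW cw C)
  qed
  have n\<phi>: "norm (\<phi> x) \<le> 1" for x
  proof -
    have "norm (\<phi> x) = \<bar>1 - W x\<bar> * norm (m x)" by (simp add: \<phi>_def)
    also have "\<dots> \<le> 1 * 1" using W[of x] e sd(3)[of x] by (intro mult_mono) auto
    finally show ?thesis by simp
  qed
  have tr: "w x + (1 - W x) / 2 * tr m' x \<le> tr \<phi>' x" for x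
  proof -
    have "tr \<phi>' x = (\<Sum>b\<in>Basis. (1 - W x) * (m' x b \<bullet> b) + w x * ((m x \<bullet> b) * (m x \<bullet> b)))"
      by (simp add: tr_def \<phi>'_def inner_add_left mult.assoc)
    also have "\<dots> = (1 - W x) * tr m' x + w x * (m x \<bullet> m x)"
      by (simp add: tr_def sum.distrib sum_distrib_left euclidean_inner[of "m x" "m x"])
    also have "m x \<bullet> m x = (norm (m x))\<^sup>2" by (simp add: power2_norm_eq_inner)
    finally have 1: "tr \<phi>' x = (1 - W x) * tr m' x + w x * (norm (m x))\<^sup>2" .
    define q where "q = 1 - (norm (m x))\<^sup>2"
    have q: "0 \<le> q" using sd(3)[of x] by (simp add: q_def abs_square_le_1)
    have "w x * q \<le> a * q" using w q by (intro mult_right_mono) auto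
    also have "\<dots> \<le> (\<epsilon> * K / 2) * q" using K q by (intro mult_right_mono) auto
    also have "\<dots> = \<epsilon> / 2 * (K * q)" by simp
    also have "\<dots> \<le> (1 - W x) / 2 * tr m' x"
      using W[of x] e K_pos q sd(6)[of x] by (intro mult_mono) (auto simp: q_def)
    finally have "w x - w x * (norm (m x))\<^sup>2 \<le> (1 - W x) / 2 * tr m' x" by (simp add: q_def algebra_simps)
    moreover have "(1 - W x) * tr m' x = (1 - W x) / 2 * tr m' x + (1 - W x) / 2 * tr m' x" by simp
    ultimately show ?thesis using 1 by linarith
  qed
  have iw: "set_integrable lborel \<Omega> w"
    by (rule set_integrable_continuous_bounded[OF cw bounded sets_\<Omega>])
  have ig: "set_integrable lborel \<Omega> (\<lambda>x. (1 - W x) / 2 * tr m' x)"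
    by (rule set_integrable_continuous_bounded[OF _ bounded sets_\<Omega>]) (intro continuous_intros cW C, simp)
  have "a * vol_above t = (\<integral>x. indicator {x\<in>\<Omega>. t < d x} x * a \<partial>lborel)"
    using set_integral_indicator_mult(1)[OF fmeasurable_level[of "\<lambda>y. t < y"], of a] by (simp add: vol_above_def)
  also have "\<dots> \<le> (LINT x:\<Omega>|lborel. w x)"
    unfolding set_lebesgue_integral_def
  proof (rule integral_mono)
    show "integrable lborel (\<lambda>x. indicator {x\<in>\<Omega>. t < d x} x * a)"
      using set_integral_indicator_mult(2)[OF fmeasurable_level[of "\<lambda>y. t < y"], of a] by simp
    show "integrable lborel (\<lambda>x. indicator \<Omega> x *\<^sub>R w x)" using iw by (simp add: set_integrable_def)
    fix x
    show "indicator {x\<in>\<Omega>. t < d x} x * a \<le> indicator \<Omega> x *\<^sub>R w x"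
    proof (cases "x \<in> \<Omega> \<and> t < d x")
      case True
      \<comment> \<open>The shift by 2 \<epsilon> covers the error of D and the smoothing width, so
        the ramp has full slope wherever d > t.\<close>
      then have "\<epsilon> \<le> D x - (t - 2 * \<epsilon>)" using sd(7)[of x] by auto
      then show ?thesis using True ramp_slope_eq(2)[OF e(1)] by (simp add: w_def)
    next
      case False
      then show ?thesis using w[of x] by (auto simp: indicator_def)
    qed
  qed
  finally have "a * vol_above t + (LINT x:\<Omega>|lborel. (1 - W x) / 2 * tr m' x) \<le>
     (LINT x:\<Omega>|lborel. w x) + (LINT x:\<Omega>|lborel. (1 - W x) / 2 * tr m' x)" by simp
  also have "\<dots> = (LINT x:\<Omega>|lborel. w x + (1 - W x) / 2 * tr m' x)"
    by (rule set_integral_add(2)[OF iw ig, symmetric])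
  also have "\<dots> \<le> (LINT x:\<Omega>|lborel. tr \<phi>' x)"
    by (rule set_integral_mono[OF set_integral_add(1)[OF iw ig] flux_integrable(1)[OF \<phi>] tr])
  also have "\<dots> \<le> perimeter \<Omega>" by (rule flux_le_perimeter[OF \<phi> n\<phi>])
  finally show "a * vol_above t + (LINT x:\<Omega>|lborel. (1 - a * ramp \<epsilon> (D x - (t - 2 * \<epsilon>))) / 2 * tr m' x) \<le> perimeter \<Omega>"
    by (simp add: W_def)
  show "0 \<le> 1 - a * ramp \<epsilon> (D x - (t - 2 * \<epsilon>))" using W[of x] e by (simp add: W_def)
qed

text \<open>The retained divergence term is nonnegative and is dropped. The stiffness 2 a /
  \<epsilon> depends on \<epsilon>, which then tends to 0.\<close>

lemma vol_above_le:
  assumes "t < inradius \<Omega>" shows "vol_above t \<le> (inradius \<Omega> - t) * perimeter \<Omega>"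
proof -
  define r where "r = inradius \<Omega>"
  have "(1 - \<epsilon>) * vol_above t \<le> (r + 3 * \<epsilon> - t) * perimeter \<Omega>" if e: "0 < \<epsilon> \<and> \<epsilon> < 1" for \<epsilon>
  proof -
    have pos: "0 < r + 3 * \<epsilon> - t" using e assms by (simp add: r_def)
    define a where "a = (1 - \<epsilon>) / (r + 3 * \<epsilon> - t)"
    obtain D m m' where soft: "soft_distance \<Omega> \<epsilon> (2 * a / \<epsilon>) D m m'" using soft_distance_exists e by blast
    note cal = calibration[OF soft, of t a]
    have nn: "0 \<le> 1 - a * ramp \<epsilon> (D x - (t - 2 * \<epsilon>))" for x
      using cal(2) e assms by (simp add: a_def r_def)
    have "0 \<le> (LINT x:\<Omega>|lborel. (1 - a * ramp \<epsilon> (D x - (t - 2 * \<epsilon>))) / 2 * tr m' x)"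
      unfolding set_lebesgue_integral_def
      using nn soft_distanceD(9)[OF soft]
      by (intro Bochner_Integration.integral_nonneg scaleR_nonneg_nonneg mult_nonneg_nonneg) auto
    then have "a * vol_above t \<le> perimeter \<Omega>" using cal(1) e assms by (simp add: a_def r_def)
    then show ?thesis using pos by (simp add: a_def field_simps)
  qed
  then have ev: "eventually (\<lambda>\<epsilon>. (1 - \<epsilon>) * vol_above t \<le> (r + 3 * \<epsilon> - t) * perimeter \<Omega>) (at_right 0)"
    using eventually_at_right_0_interval[of 1] by (auto elim: eventually_mono)
  have "((\<lambda>\<epsilon>. (1 - \<epsilon>) * vol_above t) \<longlongrightarrow> (1 - 0) * vol_above t) (at_right 0)"
    "((\<lambda>\<epsilon>. (r + 3 * \<epsilon> - t) * perimeter \<Omega>) \<longlongrightarrow> (r + 3 * 0 - t) * perimeter \<Omega>) (at_right 0)"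
    by (intro tendsto_intros)+
  from tendsto_le[OF _ this(2,1) ev] show ?thesis by (simp add: r_def)
qed

lemma perimeter_pos: "0 < perimeter \<Omega>"
proof -
  have "0 < (inradius \<Omega> - 0) * perimeter \<Omega>"
    using vol_above_le[OF inradius_pos] vol_pos by (simp add: vol_above_0)
  then show ?thesis using inradius_pos by (simp add: zero_less_mult_iff)
qed

section \<open>Strictness of the volume bound\<close>

lemma d_lipschitz: "\<bar>d x - d y\<bar> \<le> dist x y"
  unfolding dist_bdry_def by (rule infdist_triangle_abs)

text \<open>The segment is a slight outward shift of one orthogonal to k - p, where k is a point of maximal distance
  from the boundary that is farthest from a fixed boundary point p.\<close>
lemma strictly_concave_segment:
  assumes dim: "DIM('a) \<ge> 2"
  obtains z h \<rho> \<theta> \<gamma> where "0 < \<rho>" "0 < \<theta>" "0 < \<gamma>" "h \<noteq> 0"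
    "\<And>x s. x \<in> ball z \<rho> \<Longrightarrow> \<bar>s\<bar> \<le> 1 \<Longrightarrow> x + s *\<^sub>R h \<in> \<Omega> \<and> d (x + s *\<^sub>R h) \<le> inradius \<Omega> - \<theta>"
    "\<And>x. x \<in> ball z \<rho> \<Longrightarrow> \<gamma> \<le> 2 * d x - d (x + h) - d (x - h)"
proof -
  define r where "r = inradius \<Omega>"
  define M where "M = {x\<in>closure \<Omega>. d x = r}"
  have M\<Omega>: "M = {x\<in>\<Omega>. d x = r}"
  proof -
    have "d x = 0" if "x \<in> closure \<Omega>" "x \<notin> \<Omega>" for x
      using that "open" by (simp add: dist_bdry_def frontier_def interior_open)
    then show ?thesis using inradius_pos closure_subset[of \<Omega>] unfolding M_def r_def by fastforce
  qed
  have "compact M"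
  proof -
    have "closed {x. d x = r}" by (intro closed_Collect_eq continuous_d continuous_intros)
    moreover have "M = closure \<Omega> \<inter> {x. d x = r}" by (auto simp: M_def)
    ultimately show ?thesis using bounded by (simp add: compact_Int_closed compact_closure)
  qed
  moreover have "M \<noteq> {}" using inradius_attained unfolding M\<Omega> r_def by blast
  moreover obtain p where p: "p \<in> frontier \<Omega>" using frontier_nonempty by blast
  ultimately obtain k where k: "k \<in> M" "\<And>x. x \<in> M \<Longrightarrow> dist p x \<le> dist p k"
    using distance_attains_sup[of M p] by blast
  define n where "n = k - p"
  have "p \<notin> \<Omega>" using frontier_notin[OF p] .
  then have n0: "n \<noteq> 0" using k(1) M\<Omega> by (auto simp: n_def)
  obtain h0 where h0: "h0 \<noteq> 0" "orthogonal n h0" using orthogonal_to_vector_exists[OF dim] by blast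
  have k\<Omega>: "k \<in> \<Omega>" using k(1) M\<Omega> by blast
  obtain \<rho>0 where \<rho>0: "0 < \<rho>0" "ball k \<rho>0 \<subseteq> \<Omega>" using "open" k\<Omega> open_contains_ball by blast
  define h where "h = (\<rho>0 / (4 * norm h0)) *\<^sub>R h0"
  have h: "norm h = \<rho>0 / 4" "h \<noteq> 0" "n \<bullet> h = 0"
    using h0 \<rho>0 by (auto simp: h_def orthogonal_def)
  \<comment> \<open>By Pythagoras such a point is farther from p than k is, contrary to the choice
    of k.\<close>
  have notM: "k + \<tau> *\<^sub>R n + s *\<^sub>R h \<notin> M" if "0 \<le> \<tau>" "0 < \<tau> \<or> s \<noteq> 0" for \<tau> s
  proof
    assume "k + \<tau> *\<^sub>R n + s *\<^sub>R h \<in> M"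
    then have "dist p (k + \<tau> *\<^sub>R n + s *\<^sub>R h) \<le> dist p k" by (rule k(2))
    then have "norm ((1 + \<tau>) *\<^sub>R n + s *\<^sub>R h) \<le> norm n"
      by (simp add: dist_norm n_def norm_minus_commute algebra_simps)
    then have "(norm ((1 + \<tau>) *\<^sub>R n + s *\<^sub>R h))\<^sup>2 \<le> (norm n)\<^sup>2" by (intro power_mono) auto
    also have "(norm ((1 + \<tau>) *\<^sub>R n + s *\<^sub>R h))\<^sup>2 = (1 + \<tau>)\<^sup>2 * (norm n)\<^sup>2 + s\<^sup>2 * (norm h)\<^sup>2"
      using h(3) unfolding power2_norm_eq_inner
      by (simp add: inner_add_left inner_add_right inner_commute[of h n] power2_eq_square)
    finally have le: "(2 * \<tau> + \<tau>\<^sup>2) * (norm n)\<^sup>2 + s\<^sup>2 * (norm h)\<^sup>2 \<le> 0" by (simp add: power2_sum algebra_simps)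
    have nn: "0 < (norm n)\<^sup>2" "0 < (norm h)\<^sup>2" using n0 h by auto
    have "0 \<le> (2 * \<tau> + \<tau>\<^sup>2) * (norm n)\<^sup>2" "0 \<le> s\<^sup>2 * (norm h)\<^sup>2" using that by auto
    moreover have "0 < (2 * \<tau> + \<tau>\<^sup>2) * (norm n)\<^sup>2 \<or> 0 < s\<^sup>2 * (norm h)\<^sup>2"
      using that nn by (auto intro!: mult_pos_pos add_pos_nonneg)
    ultimately show False using le by linarith
  qed
  have less: "d x < r" if "x \<in> \<Omega>" "x \<notin> M" for x
    using that d_le_inradius[OF that(1)] unfolding M\<Omega> r_def by auto
  \<comment> \<open>At k the second difference is positive because both ends k + h and k - h lie off
    M. But d k = r, so the segment must still be moved off M; continuity of g permits a small shift
    by \<open>\<tau> *\<^sub>R n\<close>.\<close>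
  define g where "g x = 2 * d x - d (x + h) - d (x - h)" for x
  have cg: "continuous_on UNIV g"
    unfolding g_def by (intro continuous_intros continuous_on_compose2[OF continuous_d]) auto
  have "0 < g k"
  proof -
    have "k + h \<in> \<Omega>" "k - h \<in> \<Omega>" using \<rho>0 h(1) by (auto intro!: subsetD[OF \<rho>0(2)] simp: dist_norm)
    then have "d (k + h) < r" "d (k - h) < r" using notM[of 0 1] notM[of 0 "-1"] less by auto
    moreover have "d k = r" using k(1) M\<Omega> by simp
    ultimately show ?thesis by (simp add: g_def)
  qed
  have "((\<lambda>\<tau>. g (k + \<tau> *\<^sub>R n)) \<longlongrightarrow> g (k + 0 *\<^sub>R n)) (at_right 0)"
  proof (rule isCont_tendsto_compose[of _ g])
    show "isCont g (k + 0 *\<^sub>R n)" using cg by (simp add: continuous_on_eq_continuous_at)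
    show "((\<lambda>\<tau>. k + \<tau> *\<^sub>R n) \<longlongrightarrow> k + 0 *\<^sub>R n) (at_right 0)" by (intro tendsto_intros)
  qed
  then have "eventually (\<lambda>\<tau>. 0 < g (k + \<tau> *\<^sub>R n)) (at_right 0)"
    using order_tendstoD(1)[of _ "g (k + 0 *\<^sub>R n)" _ 0] \<open>0 < g k\<close> by simp
  moreover have "eventually (\<lambda>\<tau>. 0 < \<tau> \<and> \<tau> < \<rho>0 / (4 * norm n)) (at_right 0)"
    using \<rho>0 n0 by (intro eventually_at_right_0_interval) auto
  ultimately have "eventually (\<lambda>\<tau>. 0 < g (k + \<tau> *\<^sub>R n) \<and> 0 < \<tau> \<and> \<tau> < \<rho>0 / (4 * norm n)) (at_right 0)"
    by eventually_elim simp
  then obtain \<tau> where \<tau>: "0 < g (k + \<tau> *\<^sub>R n)" "0 < \<tau>" "\<tau> < \<rho>0 / (4 * norm n)"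
    using eventually_happens[of _ "at_right (0::real)"] by (auto simp: trivial_limit_at_right_real)
  define z where "z = k + \<tau> *\<^sub>R n"
  have zk: "norm (\<tau> *\<^sub>R n) < \<rho>0 / 4" using \<tau> n0 by (simp add: field_simps)
  have seg: "x + s *\<^sub>R h \<in> \<Omega>" if "x \<in> ball z (\<rho>0 / 4)" "\<bar>s\<bar> \<le> 1" for x s
  proof -
    have "norm (s *\<^sub>R h) \<le> \<rho>0 / 4" using that mult_right_mono[of "\<bar>s\<bar>" 1 "norm h"] by (simp flip: h(1))
    moreover have "norm (x - z) < \<rho>0 / 4" using that by (simp add: dist_norm norm_minus_commute)
    ultimately have "norm ((x - z) + \<tau> *\<^sub>R n + s *\<^sub>R h) < \<rho>0"
      using zk norm_triangle_ineq[of "x - z + \<tau> *\<^sub>R n" "s *\<^sub>R h"] norm_triangle_ineq[of "x - z" "\<tau> *\<^sub>R n"] \<rho>0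
      by linarith
    also have "(x - z) + \<tau> *\<^sub>R n + s *\<^sub>R h = x + s *\<^sub>R h - k" by (simp add: z_def)
    finally have "norm (x + s *\<^sub>R h - k) < \<rho>0" .
    then show ?thesis using \<rho>0(2) by (auto simp: dist_norm norm_minus_commute subset_iff)
  qed
  have "\<exists>s0\<in>{-1..1}. \<forall>s\<in>{-1..1}. d (z + s *\<^sub>R h) \<le> d (z + s0 *\<^sub>R h)"
    by (rule continuous_attains_sup)
      (auto intro!: continuous_intros continuous_on_compose2[OF continuous_d])
  then obtain s0 where s0: "\<bar>s0\<bar> \<le> 1" "\<And>s. \<bar>s\<bar> \<le> 1 \<Longrightarrow> d (z + s *\<^sub>R h) \<le> d (z + s0 *\<^sub>R h)"
    by (auto simp: abs_le_iff)
  have "z \<in> ball z (\<rho>0 / 4)" using \<rho>0 by simp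
  then have "d (z + s0 *\<^sub>R h) < r"
    using less[OF seg[OF _ s0(1)]] notM[of \<tau> s0] \<tau> by (simp add: z_def)
  define \<theta> where "\<theta> = (r - d (z + s0 *\<^sub>R h)) / 2"
  have \<theta>: "0 < \<theta>" using \<open>d (z + s0 *\<^sub>R h) < r\<close> by (simp add: \<theta>_def)
  \<comment> \<open>Moving the centre by less than \<rho> changes d by at most \<rho>. The second
    difference then loses at most 4 \<rho>, half of g z, and half of the gap 2 \<theta> below r
    survives.\<close>
  define \<rho> where "\<rho> = min (\<rho>0 / 4) (min \<theta> (g z / 8))"
  have \<rho>: "0 < \<rho>" "\<rho> \<le> \<rho>0 / 4" "\<rho> \<le> \<theta>" "\<rho> \<le> g z / 8" using \<rho>0 \<theta> \<tau> by (auto simp: \<rho>_def z_def)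
  show ?thesis
  proof (rule that[of \<rho> \<theta> "g z / 2" h z])
    show "0 < \<rho>" "0 < \<theta>" "h \<noteq> 0" "0 < g z / 2" using \<rho> \<theta> h \<tau> by (auto simp: z_def)
    fix x assume x: "x \<in> ball z \<rho>"
    then have "x \<in> ball z (\<rho>0 / 4)" using \<rho> by auto
    have lip: "\<bar>d (x + v) - d (z + v)\<bar> \<le> \<rho>" for v
      using d_lipschitz[of "x + v" "z + v"] x by (simp add: dist_commute)
    show "g z / 2 \<le> 2 * d x - d (x + h) - d (x - h)"
      using lip[of 0] lip[of h] lip[of "- h"] \<rho> by (simp add: g_def)
    fix s :: real assume s: "\<bar>s\<bar> \<le> 1"
    have "d (x + s *\<^sub>R h) \<le> r - \<theta>"
      using lip[of "s *\<^sub>R h"] s0(2)[OF s] \<rho> unfolding \<theta>_def by (simp add: field_simps)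
    then show "x + s *\<^sub>R h \<in> \<Omega> \<and> d (x + s *\<^sub>R h) \<le> inradius \<Omega> - \<theta>"
      using seg[OF \<open>x \<in> ball z (\<rho>0 / 4)\<close> s] by (simp add: r_def)
  qed
qed

end

context convex_domain begin

text \<open>Two mean value steps express the left side as the increase of
  \<open>m \<bullet> h\<close> between two points of the segment. Its derivative is nonnegative, so
  integrating over the whole segment only adds to it.\<close>

lemma second_difference_le:
  assumes soft: "soft_distance \<Omega> \<epsilon> K D m m'"
  shows "2 * D x - D (x + h) - D (x - h) \<le> integral {-1..1} (\<lambda>s. m' (x + s *\<^sub>R h) h \<bullet> h)"
proof -
  note sd = soft_distanceD[OF soft]
  define g where "g s = D (x + s *\<^sub>R h)" for s
  define k where "k s = m (x + s *\<^sub>R h) \<bullet> h" for s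
  define q where "q s = m' (x + s *\<^sub>R h) h \<bullet> h" for s
  have line: "((\<lambda>s. x + s *\<^sub>R h) has_derivative (\<lambda>s. s *\<^sub>R h)) (at s)" for s
    by (auto intro!: derivative_eq_intros)
  have dg: "(g has_real_derivative - k s) (at s)" for s
    unfolding has_field_derivative_def g_def[abs_def]
    by (rule has_derivative_eq_rhs[OF has_derivative_compose[OF line sd(1)]]) (auto simp: k_def)
  have dk: "(k has_real_derivative q s) (at s)" for s
  proof -
    have "((\<lambda>s. m (x + s *\<^sub>R h) \<bullet> h) has_derivative (\<lambda>u. m' (x + s *\<^sub>R h) (u *\<^sub>R h) \<bullet> h)) (at s)"
      by (rule has_derivative_inner_left[OF has_derivative_compose[OF line C1_fieldD(1)[OF sd(2)]]])
    moreover have "m' y (u *\<^sub>R h) = u *\<^sub>R m' y h" for y u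
      using has_derivative_linear[OF C1_fieldD(1)[OF sd(2)], of y] by (simp add: linear_cmul)
    ultimately show ?thesis
      unfolding has_field_derivative_def k_def[abs_def]
      by (elim has_derivative_eq_rhs) (auto simp: q_def)
  qed
  have cq: "continuous_on A q" for A
    unfolding q_def by (intro continuous_intros continuous_on_compose2[OF C1_fieldD(2)[OF sd(2), of UNIV]]) auto
  have iq: "q integrable_on {u..v}" for u v
    by (rule integrable_continuous_interval[OF cq])
  have ftc: "integral {u..v} q = k v - k u" if "u \<le> v" for u v
    using fundamental_theorem_of_calculus[OF that, of k q] dk
    by (intro integral_unique) (auto simp: has_real_derivative_iff_has_vector_derivative[symmetric] intro: DERIV_subset)
  have "\<exists>z>0. z < 1 \<and> g 1 - g 0 = (1 - 0) * - k z" by (rule MVT2) (use dg in auto)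
  then obtain z1 where z1: "0 < z1" "z1 < 1" "g 1 - g 0 = - k z1" by auto
  have "\<exists>z>-1. z < 0 \<and> g 0 - g (-1) = (0 - (-1)) * - k z" by (rule MVT2) (use dg in auto)
  then obtain z2 where z2: "-1 < z2" "z2 < 0" "g 0 - g (-1) = - k z2" by auto
  have "2 * D x - D (x + h) - D (x - h) = k z1 - k z2"
    using z1 z2 by (simp add: g_def)
  also have "\<dots> = integral {z2..z1} q" using ftc[of z2 z1] z1 z2 by simp
  also have "\<dots> \<le> integral {-1..1} q"
    by (rule integral_subset_le[OF _ iq iq]) (use z1 z2 sd(4) in \<open>auto simp: q_def\<close>)
  finally show ?thesis by (simp add: q_def[abs_def])
qed

text \<open>On the segment through each x in the ball, div m has integral at least \<gamma> / (2
  |h|^2). Integrate over x and swap: by translation invariance each s in [-1, 1] contributes at most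
  the integral over the set d \<le> \<kappa>, and the length 2 of that interval gives the constant
  4. The bound depends neither on \<epsilon> nor on K.\<close>

lemma curvature_gain:
  assumes soft: "soft_distance \<Omega> \<epsilon> K D m m'" and e: "\<epsilon> \<le> \<gamma> / 8" and pos: "0 < \<rho>" "0 < \<gamma>" "h \<noteq> 0"
    and seg: "\<And>x s. x \<in> ball z \<rho> \<Longrightarrow> \<bar>s\<bar> \<le> 1 \<Longrightarrow> x + s *\<^sub>R h \<in> \<Omega> \<and> d (x + s *\<^sub>R h) \<le> \<kappa>"
    and dd: "\<And>x. x \<in> ball z \<rho> \<Longrightarrow> \<gamma> \<le> 2 * d x - d (x + h) - d (x - h)"
  shows "\<gamma> * measure lborel (ball z \<rho>) / (4 * (norm h)\<^sup>2) \<le> (LINT x:{x\<in>\<Omega>. d x \<le> \<kappa>}|lborel. tr m' x)"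
proof -
  note sd = soft_distanceD[OF soft]
  define U where "U = {x\<in>\<Omega>. d x \<le> \<kappa>}"
  have U: "U \<in> sets borel" "U \<subseteq> \<Omega>" unfolding U_def by (auto intro: sets_level)
  define q where "q y = indicator U y * tr m' y" for y
  have q0: "0 \<le> q y" for y using sd(9) by (simp add: q_def)
  have trm: "tr m' \<in> borel_measurable borel"
    by (rule borel_measurable_continuous_onI[OF C1_fieldD(4)[OF sd(2)]])
  have qm [measurable]: "q \<in> borel_measurable borel"
    unfolding q_def using U(1) trm by measurable
  have iq: "integrable lborel q"
    using set_integrable_subset[OF flux_integrable(1)[OF sd(2)], of U] U
    by (simp add: set_integrable_def q_def[abs_def])
  have pt: "ennreal (\<gamma> / (2 * (norm h)\<^sup>2)) \<le> (\<integral>\<^sup>+s. ennreal (q (x + s *\<^sub>R h)) * indicator {-1..1} s \<partial>lborel)"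
    if x: "x \<in> ball z \<rho>" for x
  proof -
    \<comment> \<open>Replacing d by D in the second difference costs at most 4 \<epsilon>, which is
      at most \<gamma> / 2.\<close>
    have "\<gamma> / 2 \<le> 2 * D x - D (x + h) - D (x - h)"
      using dd[OF x] sd(7)[of x] sd(7)[of "x + h"] sd(7)[of "x - h"] seg[OF x, of 0] seg[OF x, of 1] seg[OF x, of "-1"] e
      by (simp add: abs_le_iff)
    also have "\<dots> \<le> integral {-1..1} (\<lambda>s. m' (x + s *\<^sub>R h) h \<bullet> h)" by (rule second_difference_le[OF soft])
    also have "\<dots> \<le> integral {-1..1} (\<lambda>s. (norm h)\<^sup>2 * tr m' (x + s *\<^sub>R h))"
      by (rule integral_le)
        (auto intro!: integrable_continuous_interval continuous_intros sd(5)
          continuous_on_compose2[OF C1_fieldD(2)[OF sd(2), of UNIV]]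
          continuous_on_compose2[OF C1_fieldD(4)[OF sd(2), of UNIV]])
    also have "\<dots> = (norm h)\<^sup>2 * integral {-1..1} (\<lambda>s. tr m' (x + s *\<^sub>R h))" by simp
    finally have le: "\<gamma> / (2 * (norm h)\<^sup>2) \<le> integral {-1..1} (\<lambda>s. tr m' (x + s *\<^sub>R h))"
      using pos by (simp add: field_simps)
    have "(\<integral>\<^sup>+s. ennreal (tr m' (x + s *\<^sub>R h)) * indicator {-1..1} s \<partial>lborel) = ennreal (integral {-1..1} (\<lambda>s. tr m' (x + s *\<^sub>R h)))"
    proof (rule nn_integral_has_integral_lebesgue')
      show "((\<lambda>s. tr m' (x + s *\<^sub>R h)) has_integral integral {-1..1} (\<lambda>s. tr m' (x + s *\<^sub>R h))) {-1..1}"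
        by (auto intro!: integrable_integral integrable_continuous_interval continuous_intros
          continuous_on_compose2[OF C1_fieldD(4)[OF sd(2), of UNIV]])
    qed (use sd(9) in auto)
    moreover have "ennreal (tr m' (x + s *\<^sub>R h)) * indicator {-1..1} s = ennreal (q (x + s *\<^sub>R h)) * indicator {-1..1} s" for s
    proof (cases "s \<in> {-1..1}")
      case True
      then have "x + s *\<^sub>R h \<in> U" using seg[OF x, of s] by (auto simp: U_def)
      then show ?thesis by (simp add: q_def)
    qed simp
    ultimately show ?thesis using le by (simp add: ennreal_leI)
  qed
  let ?B = "ball z \<rho>"
  have finB: "emeasure lborel ?B = ennreal (measure lborel ?B)"
    using emeasure_bounded_finite[OF bounded_ball[of z \<rho>]] by (intro emeasure_eq_ennreal_measure) (simp add: less_top)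
  define c where "c = \<gamma> / (2 * (norm h)\<^sup>2)"
  have c: "0 \<le> c" using pos by (simp add: c_def)
  have "ennreal (c * measure lborel ?B) = (\<integral>\<^sup>+x. ennreal c * indicator ?B x \<partial>lborel)"
    by (subst nn_integral_cmult_indicator) (simp_all add: finB ennreal_mult' c)
  also have "\<dots> \<le> (\<integral>\<^sup>+x. (\<integral>\<^sup>+s. ennreal (q (x + s *\<^sub>R h)) * indicator {-1..1} s \<partial>lborel) \<partial>lborel)"
  proof (rule nn_integral_mono)
    fix x
    show "ennreal c * indicator ?B x \<le> (\<integral>\<^sup>+s. ennreal (q (x + s *\<^sub>R h)) * indicator {-1..1} s \<partial>lborel)"
      by (cases "x \<in> ?B") (use pt[of x] in \<open>simp_all add: c_def\<close>)
  qed
  also have "\<dots> = (\<integral>\<^sup>+s. (\<integral>\<^sup>+x. ennreal (q (x + s *\<^sub>R h)) * indicator {-1..1} s \<partial>lborel) \<partial>lborel)"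
    by (rule lborel_pair.Fubini'[symmetric]) measurable
  also have "\<dots> = (\<integral>\<^sup>+s. (\<integral>\<^sup>+x. ennreal (q x) \<partial>lborel) * indicator {-1..1::real} s \<partial>lborel)"
  proof (rule nn_integral_cong)
    fix s :: real
    have "(\<integral>\<^sup>+x. ennreal (q (s *\<^sub>R h + x)) \<partial>lborel) = (\<integral>\<^sup>+x. ennreal (q x) \<partial>lborel)"
      using nn_integral_distr[of "(+) (s *\<^sub>R h)" lborel borel "\<lambda>x. ennreal (q x)"]
      by (simp add: lborel_distr_plus)
    moreover have "(\<integral>\<^sup>+x. ennreal (q (x + s *\<^sub>R h)) * indicator {-1..1} s \<partial>lborel)
      = (\<integral>\<^sup>+x. ennreal (q (x + s *\<^sub>R h)) \<partial>lborel) * indicator {-1..1} s"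
      by (rule nn_integral_multc) measurable
    ultimately show "(\<integral>\<^sup>+x. ennreal (q (x + s *\<^sub>R h)) * indicator {-1..1} s \<partial>lborel) = (\<integral>\<^sup>+x. ennreal (q x) \<partial>lborel) * indicator {-1..1} s"
      by (simp add: add.commute)
  qed
  also have "\<dots> = (\<integral>\<^sup>+x. ennreal (q x) \<partial>lborel) * ennreal 2"
    by (simp add: nn_integral_cmult_indicator)
  also have "(\<integral>\<^sup>+x. ennreal (q x) \<partial>lborel) = ennreal (\<integral>x. q x \<partial>lborel)"
    by (rule nn_integral_eq_integral[OF iq]) (use q0 in auto)
  also have "ennreal (\<integral>x. q x \<partial>lborel) * ennreal 2 = ennreal ((\<integral>x. q x \<partial>lborel) * 2)"
    using q0 by (simp add: ennreal_mult)
  finally have "c * measure lborel ?B \<le> (\<integral>x. q x \<partial>lborel) * 2"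
    using q0 by (subst (asm) ennreal_le_iff) auto
  moreover have "(\<integral>x. q x \<partial>lborel) = (LINT x:U|lborel. tr m' x)"
    by (simp add: q_def set_lebesgue_integral_def)
  ultimately show ?thesis by (simp add: U_def[symmetric] c_def field_simps)
qed

text \<open>On the set d \<le> r - \<theta> the weight (1 - W) / 2 in \<open>calibration\<close> is
  bounded below, and there div m has mass at least G for every small \<epsilon>. The gain \<theta> G
  / 2 therefore survives the limit.\<close>

lemma volume_less:
  assumes dim: "DIM('a) \<ge> 2" shows "measure lborel \<Omega> < inradius \<Omega> * perimeter \<Omega>"
proof -
  obtain z h \<rho> \<theta> \<gamma> where pos: "0 < \<rho>" "0 < \<theta>" "0 < \<gamma>" "h \<noteq> 0"
    and seg: "\<And>x s. x \<in> ball z \<rho> \<Longrightarrow> \<bar>s\<bar> \<le> 1 \<Longrightarrow> x + s *\<^sub>R h \<in> \<Omega> \<and> d (x + s *\<^sub>R h) \<le> inradius \<Omega> - \<theta>"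
    and dd: "\<And>x. x \<in> ball z \<rho> \<Longrightarrow> \<gamma> \<le> 2 * d x - d (x + h) - d (x - h)"
    using strictly_concave_segment[OF dim] by metis
  define r where "r = inradius \<Omega>"
  define G where "G = \<gamma> * measure lborel (ball z \<rho>) / (4 * (norm h)\<^sup>2)"
  have "G > 0"
  proof -
    \<comment> \<open>A ball is itself a convex domain, so its volume is positive by
      \<open>vol_pos\<close>.\<close>
    interpret B: convex_domain "ball z \<rho>" using pos by unfold_locales auto
    show ?thesis using pos B.vol_pos by (simp add: G_def)
  qed
  have r: "0 < r" using inradius_pos by (simp add: r_def)
  have "(1 - \<epsilon>) * measure lborel \<Omega> + \<theta> * G / 2 \<le> (r + 3 * \<epsilon>) * perimeter \<Omega>"
    if e: "0 < \<epsilon> \<and> \<epsilon> < min 1 (\<gamma> / 8)" for \<epsilon>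
  proof -
    define a where "a = (1 - \<epsilon>) / (r + 3 * \<epsilon>)"
    obtain D m m' where soft: "soft_distance \<Omega> \<epsilon> (2 * a / \<epsilon>) D m m'" using soft_distance_exists e by blast
    note sd = soft_distanceD[OF soft]
    have a0: "0 < a" using e r by (simp add: a_def)
    note cal = calibration[OF soft, of 0 a]
    define W where "W x = a * ramp \<epsilon> (D x - (0 - 2 * \<epsilon>))" for x
    have nn: "0 \<le> 1 - W x" for x
      using cal(2) e r by (simp add: a_def r_def W_def)
    have cal1: "a * measure lborel \<Omega> + (LINT x:\<Omega>|lborel. (1 - W x) / 2 * tr m' x) \<le> perimeter \<Omega>"
      using cal(1) e r by (simp add: a_def r_def W_def vol_above_0)
    define U where "U = {x\<in>\<Omega>. d x \<le> inradius \<Omega> - \<theta>}"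
    have U: "U \<in> sets borel" "U \<subseteq> \<Omega>" unfolding U_def by (auto intro: sets_level)
    have iU: "integrable lborel (\<lambda>x. indicator U x * tr m' x)"
      using set_integrable_subset[OF flux_integrable(1)[OF sd(2)], of U] U by (simp add: set_integrable_def)
    have cW: "continuous_on UNIV W"
    proof -
      have "continuous_on UNIV (ramp \<epsilon>)"
        using DERIV_ramp e by (meson DERIV_isCont continuous_at_imp_continuous_on)
      moreover have "continuous_on UNIV (\<lambda>x. D x - (0 - 2 * \<epsilon>))" by (intro continuous_intros sd(10))
      ultimately have "continuous_on UNIV (\<lambda>x. ramp \<epsilon> (D x - (0 - 2 * \<epsilon>)))"
        by (rule continuous_on_compose2) simp
      then show ?thesis unfolding W_def by (rule continuous_on_mult_left)
    qed
    have i\<Omega>: "set_integrable lborel \<Omega> (\<lambda>x. (1 - W x) / 2 * tr m' x)"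
      by (rule set_integrable_continuous_bounded[OF _ bounded sets_\<Omega>])
        (intro continuous_intros cW C1_fieldD(4)[OF sd(2)], simp)
    \<comment> \<open>Lower bound for (1 - W) / 2 where d \<le> r - \<theta>: there W is at most (r
      - \<theta> + 3 \<epsilon>) / (r + 3 \<epsilon>) = 1 - 2 q.\<close>
    define q where "q = \<theta> / (r + 3 * \<epsilon>) / 2"
    have "q * G \<le> q * (LINT x:U|lborel. tr m' x)"
      unfolding G_def U_def using e pos r
      by (intro mult_left_mono curvature_gain[OF soft _ _ _ _ seg dd]) (auto simp: q_def)
    also have "\<dots> = (\<integral>x. q * (indicator U x * tr m' x) \<partial>lborel)"
      by (simp add: set_lebesgue_integral_def)
    also have "\<dots> \<le> (\<integral>x. indicator \<Omega> x *\<^sub>R ((1 - W x) / 2 * tr m' x) \<partial>lborel)"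
    proof (rule integral_mono)
      show "integrable lborel (\<lambda>x. q * (indicator U x * tr m' x))" using iU by simp
      show "integrable lborel (\<lambda>x. indicator \<Omega> x *\<^sub>R ((1 - W x) / 2 * tr m' x))"
        using i\<Omega> by (simp add: set_integrable_def)
      fix x
      show "q * (indicator U x * tr m' x) \<le> indicator \<Omega> x *\<^sub>R ((1 - W x) / 2 * tr m' x)"
      proof (cases "x \<in> U")
        case False
        then show ?thesis using nn sd(9) by (simp add: indicator_def)
      next
        case True
        then have x: "x \<in> \<Omega>" "d x \<le> r - \<theta>" by (auto simp: U_def r_def)
        have "ramp \<epsilon> (D x - (0 - 2 * \<epsilon>)) \<le> r - \<theta> + 3 * \<epsilon>"
          using ramp_le(2)[of \<epsilon> "D x - (0 - 2 * \<epsilon>)"] e sd(7)[OF x(1)] x(2) d_pos[OF x(1)] by linarith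
        then have "W x \<le> a * (r - \<theta> + 3 * \<epsilon>)" using a0 by (simp add: W_def)
        also have "\<dots> \<le> 1 / (r + 3 * \<epsilon>) * (r - \<theta> + 3 * \<epsilon>)"
          unfolding a_def using e r x(2) d_pos[OF x(1)] by (intro mult_right_mono divide_right_mono) auto
        also have "\<dots> = 1 - 2 * q" using e r by (simp add: q_def field_simps)
        finally have "q \<le> (1 - W x) / 2" by simp
        from mult_right_mono[OF this sd(9)[of x]] show ?thesis using True x by simp
      qed
    qed
    also have "\<dots> = (LINT x:\<Omega>|lborel. (1 - W x) / 2 * tr m' x)" by (simp add: set_lebesgue_integral_def)
    finally have "a * measure lborel \<Omega> + q * G \<le> perimeter \<Omega>" using cal1 by linarith
    then have "(r + 3 * \<epsilon>) * (a * measure lborel \<Omega> + q * G) \<le> (r + 3 * \<epsilon>) * perimeter \<Omega>"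
      using e r by (intro mult_left_mono) auto
    moreover have "(r + 3 * \<epsilon>) * (a * measure lborel \<Omega> + q * G) = (1 - \<epsilon>) * measure lborel \<Omega> + \<theta> * G / 2"
    proof -
      have "r + 3 * \<epsilon> \<noteq> 0" using e r by auto
      then have 1: "(r + 3 * \<epsilon>) * a = 1 - \<epsilon>" by (simp add: a_def)
      have "c * (\<theta> / c / 2) = \<theta> / 2" if "c \<noteq> 0" for c using that by simp
      from this[OF \<open>r + 3 * \<epsilon> \<noteq> 0\<close>] have 2: "(r + 3 * \<epsilon>) * q = \<theta> / 2" by (simp only: q_def)
      show ?thesis unfolding distrib_left mult.assoc[symmetric] 1 2 by simp
    qed
    ultimately show ?thesis by simp
  qed
  then have ev: "eventually (\<lambda>\<epsilon>. (1 - \<epsilon>) * measure lborel \<Omega> + \<theta> * G / 2 \<le> (r + 3 * \<epsilon>) * perimeter \<Omega>) (at_right 0)"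
    using eventually_at_right_0_interval[of "min 1 (\<gamma> / 8)"] pos by (auto elim!: eventually_mono)
  have "((\<lambda>\<epsilon>. (1 - \<epsilon>) * measure lborel \<Omega> + \<theta> * G / 2) \<longlongrightarrow> (1 - 0) * measure lborel \<Omega> + \<theta> * G / 2) (at_right 0)"
    "((\<lambda>\<epsilon>. (r + 3 * \<epsilon>) * perimeter \<Omega>) \<longlongrightarrow> (r + 3 * 0) * perimeter \<Omega>) (at_right 0)"
    by (intro tendsto_intros)+
  from tendsto_le[OF _ this(2,1) ev] have "measure lborel \<Omega> + \<theta> * G / 2 \<le> r * perimeter \<Omega>" by simp
  moreover have "0 < \<theta> * G / 2" using pos \<open>G > 0\<close> by simp
  ultimately show ?thesis by (simp add: r_def)
qed

end

subsection \<open>Volumes of shells\<close>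

text \<open>A comparison of f with an antiderivative H through lower Riemann sums, asking no
  regularity of f. Each step of length \<tau> loses \<tau> (h s - h u); the losses telescope to
  \<tau> (h 0 - h t), which tends to 0.\<close>

lemma lower_sum_bound:
  fixes f H h :: "real \<Rightarrow> real"
  assumes t: "0 \<le> t" and H: "\<And>u. 0 \<le> u \<Longrightarrow> u \<le> t \<Longrightarrow> (H has_real_derivative h u) (at u)"
    and h: "\<And>s u. 0 \<le> s \<Longrightarrow> s \<le> u \<Longrightarrow> u \<le> t \<Longrightarrow> h u \<le> h s"
    and f: "\<And>s u. 0 \<le> s \<Longrightarrow> s < u \<Longrightarrow> u \<le> t \<Longrightarrow> (u - s) * h u \<le> f s - f u"
  shows "H t - H 0 \<le> f 0 - f t"
proof (cases "t = 0")
  case False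
  have bound: "H t - H 0 \<le> f 0 - f t + t / real n * (h 0 - h t)" if n: "n > 0" for n :: nat
  proof -
    define \<tau> where "\<tau> = t / real n"
    have \<tau>: "0 < \<tau>" using n t False by (simp add: \<tau>_def)
    have "real k * \<tau> \<le> t \<Longrightarrow> H (real k * \<tau>) - H 0 \<le> f 0 - f (real k * \<tau>) + \<tau> * (h 0 - h (real k * \<tau>))" for k
    proof (induction k)
      case (Suc k)
      define s u where "s = real k * \<tau>" and "u = real (Suc k) * \<tau>"
      have su: "0 \<le> s" "s < u" "u \<le> t" "u - s = \<tau>"
        using Suc.prems \<tau> by (auto simp: s_def u_def algebra_simps)
      have IH: "H s - H 0 \<le> f 0 - f s + \<tau> * (h 0 - h s)" using Suc.IH su unfolding s_def by auto
      have "\<exists>z>s. z < u \<and> H u - H s = (u - s) * h z"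
        by (rule MVT2) (use su H in auto)
      then obtain z where z: "s < z" "z < u" "H u - H s = \<tau> * h z" using su by auto
      have "\<tau> * h z \<le> \<tau> * h s" using h[of s z] su z \<tau> by (intro mult_left_mono) auto
      moreover have "\<tau> * h u \<le> f s - f u" using f[OF su(1,2,3)] su by simp
      ultimately have "H u - H 0 \<le> f 0 - f u + \<tau> * (h 0 - h u)"
        using IH z(3) by (simp add: algebra_simps)
      then show ?case by (simp only: u_def)
    qed simp
    from this[of n] show ?thesis using n by (simp add: \<tau>_def)
  qed
  have "(\<lambda>n. f 0 - f t + t / real n * (h 0 - h t)) \<longlonglongrightarrow> f 0 - f t + 0 * (h 0 - h t)"
    by (intro tendsto_intros lim_const_over_n)
  then have "H t - H 0 \<le> f 0 - f t + 0 * (h 0 - h t)"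
  proof (rule LIMSEQ_le_const)
    show "\<exists>N. \<forall>n\<ge>N. H t - H 0 \<le> f 0 - f t + t / real n * (h 0 - h t)"
      using bound by (meson less_le_trans zero_less_one)
  qed
  then show ?thesis by simp
qed simp

lemma integral_affine:
  fixes f :: "'a::euclidean_space \<Rightarrow> real"
  assumes "c > 0" and [measurable]: "f \<in> borel_measurable borel"
  shows "(\<integral>x. f x \<partial>lborel) = c ^ DIM('a) * (\<integral>y. f (a + c *\<^sub>R y) \<partial>lborel)"
proof -
  have "(\<integral>x. f x \<partial>lborel) = (\<integral>x. f x \<partial>density (distr lborel borel (\<lambda>x. a + c *\<^sub>R x)) (\<lambda>_. ennreal (c ^ DIM('a))))"
    using lborel_affine[of c a] assms by simp
  also have "\<dots> = (\<integral>x. c ^ DIM('a) *\<^sub>R f x \<partial>distr lborel borel (\<lambda>x. a + c *\<^sub>R x))"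
    using assms by (intro integral_density) auto
  also have "\<dots> = (\<integral>y. c ^ DIM('a) *\<^sub>R f (a + c *\<^sub>R y) \<partial>lborel)"
    by (intro integral_distr) auto
  finally show ?thesis by simp
qed

section \<open>Fluxes through inner parallel sets\<close>

context convex_domain begin

text \<open>Nonnegative divergence lets a smooth step replace the indicator of d > t, after which
  \<open>integral_step_le\<close> applies.\<close>

lemma flux_above_le:
  assumes \<phi>: "C1_field \<phi> \<phi>'" "\<And>x. norm (\<phi> x) \<le> 1" "\<And>x. 0 \<le> tr \<phi>' x" and st: "0 \<le> s" "s < t"
  shows "(t - s) * (LINT x:{x\<in>\<Omega>. t < d x}|lborel. tr \<phi>' x) \<le> vol_above s - vol_above t"
proof -
  let ?A = "{x\<in>\<Omega>. t < d x}"
  define I where "I = (LINT x:?A|lborel. tr \<phi>' x)"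
  have iA: "integrable lborel (\<lambda>x. indicator ?A x * tr \<phi>' x)"
    using set_integrable_subset[OF flux_integrable(1)[OF \<phi>(1)], of ?A] sets_level[of "\<lambda>y. t < y"]
    by (simp add: set_integrable_def)
  have "(t - s - 3 * \<epsilon>) * I \<le> vol_above s - vol_above t" if e: "0 < \<epsilon> \<and> \<epsilon> < (t - s) / 4" for \<epsilon>
  proof -
    obtain D m m' where soft: "soft_distance \<Omega> \<epsilon> 0 D m m'" using soft_distance_exists e by blast
    note sd = soft_distanceD[OF soft]
    \<comment> \<open>The levels are moved inwards so that, after the widening in
      \<open>integral_step_le\<close>, the shell is exactly s < d < t.\<close>
    have e': "0 < \<epsilon>" "\<epsilon> \<le> s + \<epsilon>" "s + \<epsilon> < t - 2 * \<epsilon>" using e st by auto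
    note L = integral_step_le[OF soft e' \<phi>(1,2)]
    have "I \<le> (\<integral>x. step \<epsilon> (s + \<epsilon>) (t - 2 * \<epsilon>) (D x) * tr \<phi>' x \<partial>lborel)"
      unfolding I_def set_lebesgue_integral_def real_scaleR_def
    proof (rule integral_mono[OF iA L(2)])
      fix x
      show "indicator ?A x * tr \<phi>' x \<le> step \<epsilon> (s + \<epsilon>) (t - 2 * \<epsilon>) (D x) * tr \<phi>' x"
      proof (rule mult_right_mono[OF _ \<phi>(3)])
        show "indicator ?A x \<le> step \<epsilon> (s + \<epsilon>) (t - 2 * \<epsilon>) (D x)"
        proof (cases "x \<in> ?A")
          case True
          then have "t - 2 * \<epsilon> + \<epsilon> \<le> D x" using sd(7)[of x] by auto
          then show ?thesis using step_eq(2)[OF e'(1,3)] by (simp add: indicator_def)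
        qed (use step_bounds[OF e'(1,3)] in auto)
      qed
    qed
    also have "\<dots> \<le> measure lborel {x\<in>\<Omega>. s + \<epsilon> - \<epsilon> < d x \<and> d x < t - 2 * \<epsilon> + 2 * \<epsilon>} / (t - 2 * \<epsilon> - (s + \<epsilon>))"
      by (rule L(1))
    also have "\<dots> \<le> (vol_above s - vol_above t) / (t - 2 * \<epsilon> - (s + \<epsilon>))"
    proof (rule divide_right_mono)
      have "{x\<in>\<Omega>. s < d x \<and> d x \<le> t} \<in> fmeasurable lborel" by (rule fmeasurable_level) measurable
      then show "measure lborel {x\<in>\<Omega>. s + \<epsilon> - \<epsilon> < d x \<and> d x < t - 2 * \<epsilon> + 2 * \<epsilon>} \<le> vol_above s - vol_above t"
        unfolding vol_above_diff[OF less_imp_le[OF st(2)]]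
        by (intro measure_mono_fmeasurable) (auto intro!: sets_level)
    qed (use e' in simp)
    finally have "I \<le> (vol_above s - vol_above t) / (t - s - 3 * \<epsilon>)" by (simp add: algebra_simps)
    then show ?thesis using e' by (simp add: field_simps)
  qed
  then have ev: "eventually (\<lambda>\<epsilon>. (t - s - 3 * \<epsilon>) * I \<le> vol_above s - vol_above t) (at_right 0)"
    using eventually_at_right_0_interval[of "(t - s) / 4"] st by (auto elim!: eventually_mono)
  have "((\<lambda>\<epsilon>. (t - s - 3 * \<epsilon>) * I) \<longlongrightarrow> (t - s - 3 * 0) * I) (at_right 0)" by (intro tendsto_intros)
  from tendsto_upperbound[OF this ev] show ?thesis by (simp add: I_def)
qed

text \<open>Some collar has volume more than (P - e/2) t. Integrating a step of D against div m by
  parts gives the mean of |m|^2 over nearly all of that collar, up to the factor 1/t, and a large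
  stiffness makes the defect 1 - |m|^2 small on average.\<close>

lemma near_optimal_field:
  assumes e: "0 < e"
  obtains m m' where "C1_field m m'" "\<And>x. norm (m x) \<le> 1" "\<And>x. 0 \<le> tr m' x"
    "perimeter \<Omega> - e \<le> (LINT x:\<Omega>|lborel. tr m' x)"
proof -
  define P where "P = perimeter \<Omega>"
  define r where "r = inradius \<Omega>"
  have r: "0 < r" using inradius_pos by (simp add: r_def)
  \<comment> \<open>Otherwise \<open>perimeter_le_of_collar\<close> would bound the perimeter by P -
    e/2.\<close>
  have "\<not> (\<forall>t. 0 < t \<longrightarrow> t < r \<longrightarrow> measure lborel \<Omega> - vol_above t \<le> (P - e / 2) * t)"
    using perimeter_le_of_collar[OF r, of "P - e / 2"] e by (auto simp: P_def)
  then obtain t where t: "0 < t" "t < r" "(P - e / 2) * t < measure lborel \<Omega> - vol_above t" by force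
  \<comment> \<open>With t fixed, \<open>vol_above (3 * \<epsilon>)\<close> is close to the full
    volume, since the contracted copy already is.\<close>
  have "((\<lambda>\<epsilon>. (1 - 3 * \<epsilon> / r) ^ DIM('a) * measure lborel \<Omega> - vol_above t) \<longlongrightarrow>
      (1 - 3 * 0 / r) ^ DIM('a) * measure lborel \<Omega> - vol_above t) (at_right 0)"
    using r by (intro tendsto_intros) auto
  then have "eventually (\<lambda>\<epsilon>. (P - e / 2) * t < (1 - 3 * \<epsilon> / r) ^ DIM('a) * measure lborel \<Omega> - vol_above t) (at_right 0)"
    using order_tendstoD(1) t(3) by fastforce
  moreover have "eventually (\<lambda>\<epsilon>. 0 < \<epsilon> \<and> \<epsilon> < min (t / 3) (r / 3)) (at_right 0)"
    using t r by (intro eventually_at_right_0_interval) auto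
  ultimately have "eventually (\<lambda>\<epsilon>. (P - e / 2) * t < (1 - 3 * \<epsilon> / r) ^ DIM('a) * measure lborel \<Omega> - vol_above t
    \<and> 0 < \<epsilon> \<and> \<epsilon> < min (t / 3) (r / 3)) (at_right 0)" by eventually_elim simp
  then obtain \<epsilon> where \<epsilon>: "(P - e / 2) * t < (1 - 3 * \<epsilon> / r) ^ DIM('a) * measure lborel \<Omega> - vol_above t"
    "0 < \<epsilon>" "\<epsilon> < t / 3" "\<epsilon> < r / 3"
    using eventually_happens[of _ "at_right (0::real)"] by (auto simp: trivial_limit_at_right_real)
  have V: "(P - e / 2) * t < vol_above (3 * \<epsilon>) - vol_above t"
    using \<epsilon> vol_above_homothety[of "3 * \<epsilon>"] by (simp add: r_def)
  have P: "0 < P" using perimeter_pos by (simp add: P_def)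
  \<comment> \<open>The total defect is at most I / (t K) \<le> P / (t K), and this K makes the last
    term e / 2.\<close>
  define K where "K = 2 * P / (e * t)"
  have K: "0 < K" using P e t by (simp add: K_def)
  obtain D m m' where soft: "soft_distance \<Omega> \<epsilon> K D m m'" using soft_distance_exists \<epsilon> by blast
  note sd = soft_distanceD[OF soft]
  define I where "I = (LINT x:\<Omega>|lborel. tr m' x)"
  have i\<Omega>: "integrable lborel (\<lambda>x. indicator \<Omega> x * tr m' x)"
    using flux_integrable(1)[OF sd(2)] by (simp add: set_integrable_def)
  have st: "\<epsilon> < t + \<epsilon>" using t by simp
  have z: "step \<epsilon> \<epsilon> (t + \<epsilon>) (D x) = 0" if "x \<notin> \<Omega>" for x
    using sd(8)[OF that] \<epsilon> st by (intro step_eq) auto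
  note J = integral_compose_divergence[OF sd(2) sd(1) C1_fieldD(3)[OF sd(2)]
      DERIV_step[OF \<epsilon>(2), of \<epsilon> "t + \<epsilon>"] continuous_step_slope bounded z]
  let ?A = "{x\<in>\<Omega>. 3 * \<epsilon> < d x \<and> d x \<le> t}"
  have A: "?A \<in> fmeasurable lborel" by (rule fmeasurable_level) measurable
  note iA = set_integral_indicator_mult[OF A, of "1 / t"]
  have "(vol_above (3 * \<epsilon>) - vol_above t) / t - I / (t * K)
     = (\<integral>x. indicator ?A x * (1 / t) - indicator \<Omega> x * tr m' x / (t * K) \<partial>lborel)"
    using iA i\<Omega> \<epsilon> by (simp add: vol_above_diff I_def set_lebesgue_integral_def)
  also have "\<dots> \<le> (\<integral>x. step_slope \<epsilon> \<epsilon> (t + \<epsilon>) (D x) * (m x \<bullet> m x) \<partial>lborel)"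
  proof (rule integral_mono[OF _ J(3)])
    show "integrable lborel (\<lambda>x. indicator ?A x * (1 / t) - indicator \<Omega> x * tr m' x / (t * K))"
      using iA i\<Omega> by auto
    fix x
    define w where "w = step_slope \<epsilon> \<epsilon> (t + \<epsilon>) (D x)"
    have w: "0 \<le> w" "w \<le> 1 / t" using step_slope_bounds[OF \<epsilon>(2) st, of "D x"] by (auto simp: w_def)
    show "indicator ?A x * (1 / t) - indicator \<Omega> x * tr m' x / (t * K) \<le> w * (m x \<bullet> m x)"
    proof (cases "x \<in> \<Omega>")
      case False
      then show ?thesis using w by simp
    next
      case True
      define q where "q = 1 - (norm (m x))\<^sup>2"
      have q: "0 \<le> q" using sd(3)[of x] by (simp add: q_def abs_square_le_1)
      have "w * q \<le> 1 / t * (tr m' x / K)"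
      proof (rule mult_mono)
        show "q \<le> tr m' x / K" using sd(6)[of x] K by (simp add: q_def field_simps)
      qed (use w q t in auto)
      moreover have "indicator ?A x * (1 / t) \<le> w"
      proof (cases "x \<in> ?A")
        case True
        \<comment> \<open>For 3 \<epsilon> < d \<le> t the lower ramp has slope 1 and the upper one
          slope 0, even with an error \<epsilon> in D.\<close>
        then have "\<epsilon> \<le> D x - \<epsilon>" "D x - (t + \<epsilon>) \<le> 0" using sd(7)[of x] by auto
        then have "w = 1 / t" using ramp_slope_eq[OF \<epsilon>(2)] by (simp add: w_def step_slope_def)
        then show ?thesis using True by simp
      qed (use w in simp)
      moreover have "w * (m x \<bullet> m x) = w - w * q" by (simp add: q_def power2_norm_eq_inner algebra_simps)
      ultimately show ?thesis using True by simp
    qed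
  qed
  also have "\<dots> = (\<integral>x. step \<epsilon> \<epsilon> (t + \<epsilon>) (D x) * tr m' x \<partial>lborel)" by (rule J(1)[symmetric])
  also have "\<dots> \<le> (\<integral>x. indicator \<Omega> x * tr m' x \<partial>lborel)"
  proof (rule integral_mono[OF J(2) i\<Omega>])
    show "step \<epsilon> \<epsilon> (t + \<epsilon>) (D x) * tr m' x \<le> indicator \<Omega> x * tr m' x" for x
      using z[of x] step_bounds[OF \<epsilon>(2) st, of "D x"]
      by (intro mult_right_mono sd(9)) (auto simp: indicator_def)
  qed
  also have "\<dots> = I" by (simp add: I_def set_lebesgue_integral_def)
  finally have 1: "(vol_above (3 * \<epsilon>) - vol_above t) / t - I / (t * K) \<le> I" .
  have "I / (t * K) \<le> P / (t * K)"
    using flux_le_perimeter[OF sd(2) sd(3)] t K by (intro divide_right_mono) (auto simp: I_def P_def)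
  also have "\<dots> = e / 2" using P t e by (simp add: K_def)
  finally have "P - e \<le> I"
  proof -
    assume "I / (t * K) \<le> e / 2"
    moreover have "P - e / 2 < (vol_above (3 * \<epsilon>) - vol_above t) / t" using V t by (simp add: field_simps)
    ultimately show ?thesis using 1 by linarith
  qed
  then show ?thesis using that[OF sd(2) sd(3) sd(9)] by (simp add: P_def I_def)
qed

text \<open>A nearly optimal field for \<Omega> is transplanted to the contracted copy C. Its
  divergence gains 1 / \<mu> and the volume element \<mu>^N, whence the power N - 1.\<close>

lemma shell_ge:
  assumes st: "0 \<le> s" "s < t" "t < inradius \<Omega>"
  shows "(t - s) * ((1 - t / inradius \<Omega>) ^ (DIM('a) - 1) * perimeter \<Omega>) \<le> vol_above s - vol_above t"
proof -
  define \<mu> where "\<mu> = 1 - t / inradius \<Omega>"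
  have \<mu>: "0 < \<mu>" using st inradius_pos by (simp add: \<mu>_def)
  obtain x0 where x0: "x0 \<in> \<Omega>" "d x0 = inradius \<Omega>" using inradius_attained by blast
  define a where "a = (t / inradius \<Omega>) *\<^sub>R x0"
  have above: "a + \<mu> *\<^sub>R y \<in> {x\<in>\<Omega>. t < d x}" if "y \<in> \<Omega>" for y
    using homothety_above[OF x0 _ st(3) that] st by (simp add: \<mu>_def a_def add.commute)
  have "(t - s) * (\<mu> ^ (DIM('a) - 1) * (perimeter \<Omega> - e)) \<le> vol_above s - vol_above t" if e: "0 < e" for e
  proof -
    obtain m m' where m: "C1_field m m'" "\<And>x. norm (m x) \<le> 1" "\<And>x. 0 \<le> tr m' x"
      "perimeter \<Omega> - e \<le> (LINT x:\<Omega>|lborel. tr m' x)"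
      using near_optimal_field[OF e] by metis
    define \<phi> where "\<phi> x = m ((1 / \<mu>) *\<^sub>R (x - a))" for x
    define \<phi>' where "\<phi>' x h = (1 / \<mu>) *\<^sub>R m' ((1 / \<mu>) *\<^sub>R (x - a)) h" for x h
    have \<phi>: "C1_field \<phi> \<phi>'"
      unfolding C1_field_def
    proof (intro conjI allI)
      fix x
      have "((\<lambda>x. (1 / \<mu>) *\<^sub>R (x - a)) has_derivative (\<lambda>h. (1 / \<mu>) *\<^sub>R h)) (at x)"
        by (auto intro!: derivative_eq_intros)
      from has_derivative_compose[OF this C1_fieldD(1)[OF m(1)]]
      have "(\<phi> has_derivative (\<lambda>h. m' ((1 / \<mu>) *\<^sub>R (x - a)) ((1 / \<mu>) *\<^sub>R h))) (at x)"
        by (simp add: \<phi>_def[abs_def])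
      moreover have "m' y (c *\<^sub>R h) = c *\<^sub>R m' y h" for y c h
        using has_derivative_linear[OF C1_fieldD(1)[OF m(1)], of y] by (simp add: linear_cmul)
      ultimately show "(\<phi> has_derivative \<phi>' x) (at x)" by (simp add: \<phi>'_def[abs_def])
    next
      fix h
      have "continuous_on UNIV (\<lambda>x. m' ((1 / \<mu>) *\<^sub>R (x - a)) h)"
        by (rule continuous_on_compose2[OF C1_fieldD(2)[OF m(1), of UNIV]]) (auto intro!: continuous_intros)
      then show "continuous_on UNIV (\<lambda>x. \<phi>' x h)" unfolding \<phi>'_def by (intro continuous_intros)
    qed
    have tr: "tr \<phi>' x = (1 / \<mu>) * tr m' ((1 / \<mu>) *\<^sub>R (x - a))" for x
      by (simp add: tr_def \<phi>'_def sum_distrib_left)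
    have tr0: "0 \<le> tr \<phi>' x" for x using m(3) \<mu> by (simp add: tr)
    have F: "(t - s) * (LINT x:{x\<in>\<Omega>. t < d x}|lborel. tr \<phi>' x) \<le> vol_above s - vol_above t"
      by (rule flux_above_le[OF \<phi> _ tr0 st(1,2)]) (simp add: \<phi>_def m(2))
    let ?A = "{x\<in>\<Omega>. t < d x}"
    have Ab: "?A \<in> sets borel" using open_above by auto
    define C where "C = (\<lambda>y. a + \<mu> *\<^sub>R y) ` \<Omega>"
    have C: "C \<subseteq> ?A" "open C" unfolding C_def using above open_affinity[OF "open"] \<mu> by auto
    have iA: "set_integrable lborel ?A (tr \<phi>')"
      by (rule set_integrable_subset[OF flux_integrable(1)[OF \<phi>]]) (use Ab in auto)
    have iC: "set_integrable lborel C (tr \<phi>')"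
      by (rule set_integrable_subset[OF iA]) (use C in auto)
    have inC: "a + \<mu> *\<^sub>R y \<in> C \<longleftrightarrow> y \<in> \<Omega>" for y using \<mu> by (auto simp: C_def)
    have meas: "(\<lambda>x. indicator C x * tr \<phi>' x) \<in> borel_measurable borel"
      by (intro borel_measurable_times borel_measurable_indicator borel_open C
          borel_measurable_continuous_onI[OF C1_fieldD(4)[OF \<phi>]])
    have "\<mu> ^ (DIM('a) - 1) * (perimeter \<Omega> - e) \<le> \<mu> ^ (DIM('a) - 1) * (LINT x:\<Omega>|lborel. tr m' x)"
      using m(4) \<mu> by (intro mult_left_mono) auto
    also have "\<dots> = \<mu> ^ DIM('a) * (\<integral>y. indicator C (a + \<mu> *\<^sub>R y) * tr \<phi>' (a + \<mu> *\<^sub>R y) \<partial>lborel)"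
    proof -
      have "indicator C (a + \<mu> *\<^sub>R y) * tr \<phi>' (a + \<mu> *\<^sub>R y) = (1 / \<mu>) * (indicator \<Omega> y * tr m' y)" for y
        using \<mu> inC[of y] by (simp add: tr indicator_def)
      moreover have "\<mu> ^ DIM('a) = \<mu> ^ (DIM('a) - 1) * \<mu>"
        using DIM_positive[where 'a='a] by (simp add: power_eq_if)
      ultimately show ?thesis using \<mu> by (simp add: set_lebesgue_integral_def)
    qed
    also have "\<dots> = (\<integral>x. indicator C x * tr \<phi>' x \<partial>lborel)"
      by (rule integral_affine[OF \<mu> meas, symmetric])
    also have "\<dots> \<le> (LINT x:?A|lborel. tr \<phi>' x)"
      unfolding set_lebesgue_integral_def
    proof (rule integral_mono)
      show "integrable lborel (\<lambda>x. indicator C x * tr \<phi>' x)" using iC by (simp add: set_integrable_def)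
      show "integrable lborel (\<lambda>x. indicator ?A x *\<^sub>R tr \<phi>' x)" using iA by (simp add: set_integrable_def)
      show "indicator C x * tr \<phi>' x \<le> indicator ?A x *\<^sub>R tr \<phi>' x" for x
        unfolding real_scaleR_def using C(1) by (intro mult_right_mono tr0) (auto simp: indicator_def)
    qed
    finally have "(t - s) * (\<mu> ^ (DIM('a) - 1) * (perimeter \<Omega> - e)) \<le> (t - s) * (LINT x:?A|lborel. tr \<phi>' x)"
      using st by (intro mult_left_mono) auto
    then show ?thesis using F by linarith
  qed
  then have ev: "eventually (\<lambda>e. (t - s) * (\<mu> ^ (DIM('a) - 1) * (perimeter \<Omega> - e)) \<le> vol_above s - vol_above t) (at_right 0)"
    using eventually_at_right_0_interval[of 1] by (auto elim!: eventually_mono)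
  have "((\<lambda>e. (t - s) * (\<mu> ^ (DIM('a) - 1) * (perimeter \<Omega> - e))) \<longlongrightarrow> (t - s) * (\<mu> ^ (DIM('a) - 1) * (perimeter \<Omega> - 0))) (at_right 0)"
    by (intro tendsto_intros)
  from tendsto_upperbound[OF this ev] show ?thesis by (simp add: \<mu>_def)
qed

text \<open>The assumed identity says N |\<Omega>| / r = P, so the rate in \<open>shell_ge\<close>
  is exactly the derivative of -(1 - u/r)^N |\<Omega>|. Summing over thin shells gives the reverse
  of \<open>vol_above_homothety\<close>.\<close>

lemma vol_above_le_of_equality:
  assumes t: "0 \<le> t" "t < inradius \<Omega>" and eq: "measure lborel \<Omega> = perimeter \<Omega> * inradius \<Omega> / DIM('a)"
  shows "vol_above t \<le> (1 - t / inradius \<Omega>) ^ DIM('a) * measure lborel \<Omega>"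
proof -
  define r where "r = inradius \<Omega>"
  have r: "0 < r" using inradius_pos by (simp add: r_def)
  define H where "H u = - ((1 - u / r) ^ DIM('a) * measure lborel \<Omega>)" for u
  have "H t - H 0 \<le> vol_above 0 - vol_above t"
  proof (rule lower_sum_bound[OF t(1), where h="\<lambda>u. (1 - u / r) ^ (DIM('a) - 1) * perimeter \<Omega>"])
    fix u
    have "(H has_real_derivative - (real DIM('a) * (1 - u / r) ^ (DIM('a) - 1) * (- (1 / r)) * measure lborel \<Omega>)) (at u)"
      unfolding H_def[abs_def] using r by (auto intro!: derivative_eq_intros)
    then show "(H has_real_derivative (1 - u / r) ^ (DIM('a) - 1) * perimeter \<Omega>) (at u)"
      by (rule DERIV_cong) (use r in \<open>simp add: eq r_def[symmetric] field_simps\<close>)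
  next
    fix s u assume "0 \<le> s" "s \<le> u" "u \<le> t"
    then show "(1 - u / r) ^ (DIM('a) - 1) * perimeter \<Omega> \<le> (1 - s / r) ^ (DIM('a) - 1) * perimeter \<Omega>"
      using r t perimeter_pos by (intro mult_right_mono power_mono) (auto simp: r_def[symmetric] field_simps)
  next
    fix s u assume "0 \<le> s" "s < u" "u \<le> t"
    then show "(u - s) * ((1 - u / r) ^ (DIM('a) - 1) * perimeter \<Omega>) \<le> vol_above s - vol_above u"
      unfolding r_def using t by (intro shell_ge) auto
  qed
  then show ?thesis by (simp add: H_def vol_above_0 r_def)
qed

end

subsection \<open>Moments of the distance function\<close>

lemma Beta_eq_binom_real:
  assumes "\<beta> > 0" shows "\<beta> * Beta \<beta> (real N + 1) = inverse (binom_real N \<beta>)"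
proof -
  have "\<beta> \<notin> \<int>\<^sub>\<le>\<^sub>0" using assms nonpos_Ints_nonpos by force
  then have "Gamma (\<beta> + 1) = \<beta> * Gamma \<beta>" by (rule Gamma_plus1)
  then show ?thesis by (simp add: Beta_def binom_real_def algebra_simps)
qed

lemma binom_real_0: "binom_real N 0 = 1"
proof -
  have "0 < Gamma (real N + 1)" by (intro Gamma_real_pos) simp
  then have "Gamma (real N + 1) \<noteq> 0" by (metis less_irrefl)
  then show ?thesis by (simp add: binom_real_def)
qed

lemma binom_real_pos: "0 \<le> \<beta> \<Longrightarrow> 0 < binom_real N \<beta>"
  unfolding binom_real_def by (intro divide_pos_pos mult_pos_pos Gamma_real_pos) auto

text \<open>The moment when the volume profile is (1 - s)^N c, the equality case of the lower bound;
  it is a Beta integral.\<close>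

lemma has_integral_cone:
  assumes \<beta>: "\<beta> > 0" and N: "N > 0"
  shows "((\<lambda>s. \<beta> * s powr (\<beta> - 1) * ((1 - s) ^ N * c)) has_integral inverse (binom_real N \<beta>) * c) {0..1}"
proof -
  have "((\<lambda>s. \<beta> * c * (s powr (\<beta> - 1) * (1 - s) powr (real N + 1 - 1))) has_integral \<beta> * c * Beta \<beta> (real N + 1)) {0..1}"
    using \<beta> by (intro has_integral_mult_right has_integral_Beta_real) auto
  also have "\<beta> * c * Beta \<beta> (real N + 1) = inverse (binom_real N \<beta>) * c"
    using Beta_eq_binom_real[OF \<beta>, of "N"] by simp
  finally show ?thesis
  proof (rule has_integral_eq[rotated])
    fix s :: real assume s: "s \<in> {0..1}"
    \<comment> \<open>At s = 1 both sides are 0 because N > 0.\<close>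
    have "(1 - s) powr (real N + 1 - 1) = (1 - s) ^ N"
      using s N by (cases "s = 1") (auto simp: powr_realpow)
    then show "\<beta> * c * (s powr (\<beta> - 1) * (1 - s) powr (real N + 1 - 1)) = \<beta> * s powr (\<beta> - 1) * ((1 - s) ^ N * c)"
      by simp
  qed
qed

text \<open>The moment for the linear profile (1 - s) c, which bounds every domain with c = r P and
  describes long slabs in the limit.\<close>

lemma has_integral_slab_profile:
  assumes \<beta>: "\<beta> > 0"
  shows "((\<lambda>s. \<beta> * s powr (\<beta> - 1) * ((1 - s) * c)) has_integral c / (\<beta> + 1)) {0..1::real}"
proof -
  have "((\<lambda>s. \<beta> * c * s powr (\<beta> - 1) - \<beta> * c * s powr \<beta>) has_integral
      (\<beta> * c * (1 powr (\<beta> - 1 + 1) / (\<beta> - 1 + 1)) - \<beta> * c * (1 powr (\<beta> + 1) / (\<beta> + 1)))) {0..1}"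
    using \<beta> by (intro has_integral_diff has_integral_mult_right has_integral_powr_from_0) auto
  also have "\<beta> * c * (1 powr (\<beta> - 1 + 1) / (\<beta> - 1 + 1)) - \<beta> * c * (1 powr (\<beta> + 1) / (\<beta> + 1)) = c / (\<beta> + 1)"
    using \<beta> by (simp add: field_simps)
  finally show ?thesis
  proof (rule has_integral_eq[rotated])
    fix s :: real assume s: "s \<in> {0..1}"
    have "s powr \<beta> = s powr (\<beta> - 1) * s"
      using s \<beta> powr_add[of s "\<beta> - 1" 1] by (cases "s = 0") auto
    then show "\<beta> * c * s powr (\<beta> - 1) - \<beta> * c * s powr \<beta> = \<beta> * s powr (\<beta> - 1) * ((1 - s) * c)"
      by (simp add: algebra_simps)
  qed
qed

section \<open>Layer-cake formula and bounds for moments\<close>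

context convex_domain begin

text \<open>Normalised so that the level runs over s = t / r in [0, 1] and \<open>ratio\<close> is
  the moment divided by r P.\<close>

definition moment :: "real \<Rightarrow> real" where
  "moment \<beta> = integral \<Omega> (\<lambda>x. d x powr \<beta>) / inradius \<Omega> powr \<beta>"

lemma moment_0: "moment 0 = measure lborel \<Omega>"
proof -
  have "integral \<Omega> (\<lambda>x. d x powr 0) = integral \<Omega> (\<lambda>x. 1::real)"
    using d_pos by (intro integral_cong) force
  also have "\<dots> = measure lebesgue \<Omega>"
    using lmeasure_integral[of \<Omega>] lmeasurable_open[OF bounded "open"] by simp
  finally show ?thesis using inradius_pos sets_\<Omega> by (simp add: moment_def measure_completion)
qed

lemma vol_above_measurable: "vol_above \<in> borel_measurable borel"
proof -
  have "mono (\<lambda>t. - vol_above t)" using vol_above_mono by (auto simp: mono_def)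
  then have "(\<lambda>t. - (- vol_above t)) \<in> borel_measurable borel"
    by (intro borel_measurable_uminus borel_measurable_mono)
  then show ?thesis by simp
qed

text \<open>Write (d x / r)^\<beta> as the integral of \<beta> s^(\<beta> - 1) over 0 < s < d x / r
  and exchange the integrals.\<close>

lemma layer_cake:
  assumes \<beta>: "\<beta> > 0"
  shows "((\<lambda>s. \<beta> * s powr (\<beta> - 1) * vol_above (inradius \<Omega> * s)) has_integral moment \<beta>) {0..1}"
proof -
  define r where "r = inradius \<Omega>"
  have r: "0 < r" using inradius_pos by (simp add: r_def)
  have cont: "continuous_on UNIV (\<lambda>x. d x powr \<beta>)"
    using \<beta> d_nonneg by (intro continuous_on_powr' continuous_d continuous_intros) auto
  have si: "set_integrable lborel \<Omega> (\<lambda>x. d x powr \<beta>)"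
    by (rule set_integrable_continuous_bounded[OF cont bounded sets_\<Omega>])
  have i: "integrable lborel (\<lambda>x. indicator \<Omega> x * (d x powr \<beta> / r powr \<beta>))"
    using si by (simp add: set_integrable_def)
  have M: "moment \<beta> = (\<integral>x. indicator \<Omega> x * (d x powr \<beta> / r powr \<beta>) \<partial>lborel)"
    using set_borel_integral_eq_integral(2)[OF si] by (simp add: moment_def set_lebesgue_integral_def r_def)
  have M0: "0 \<le> moment \<beta>" unfolding M by (intro Bochner_Integration.integral_nonneg) auto
  let ?k = "\<lambda>x s. ennreal (\<beta> * s powr (\<beta> - 1)) * indicator {(x, s). x \<in> \<Omega> \<and> 0 < s \<and> r * s < d x} (x, s)"
  \<comment> \<open>The cut at 0 is explicit, because \<open>vol_above\<close> is the full volume at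
    negative levels. Beyond s = 1 it vanishes by itself.\<close>
  define g where "g s = (if 0 < s then \<beta> * s powr (\<beta> - 1) * vol_above (r * s) else 0)" for s
  have [measurable]: "d \<in> borel_measurable borel" "\<Omega> \<in> sets borel" using d_measurable sets_\<Omega> by auto
  have "ennreal (moment \<beta>) = (\<integral>\<^sup>+x. ennreal (indicator \<Omega> x * (d x powr \<beta> / r powr \<beta>)) \<partial>lborel)"
    unfolding M by (rule nn_integral_eq_integral[OF i, symmetric]) auto
  also have "\<dots> = (\<integral>\<^sup>+x. (\<integral>\<^sup>+s. ?k x s \<partial>lborel) \<partial>lborel)"
  proof (rule nn_integral_cong)
    fix x
    show "ennreal (indicator \<Omega> x * (d x powr \<beta> / r powr \<beta>)) = (\<integral>\<^sup>+s. ?k x s \<partial>lborel)"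
    proof (cases "x \<in> \<Omega>")
      case True
      have "((\<lambda>s. \<beta> * s powr (\<beta> - 1)) has_integral \<beta> * ((d x / r) powr (\<beta> - 1 + 1) / (\<beta> - 1 + 1))) {0..d x / r}"
        using r d_nonneg \<beta> by (intro has_integral_mult_right has_integral_powr_from_0) auto
      then have "((\<lambda>s. \<beta> * s powr (\<beta> - 1)) has_integral d x powr \<beta> / r powr \<beta>) {0<..<d x / r}"
        using \<beta> r d_nonneg[of x] by (simp add: has_integral_Icc_iff_Ioo powr_divide)
      from nn_integral_has_integral_lebesgue'[OF _ this] \<beta>
      have "(\<integral>\<^sup>+s. ennreal (\<beta> * s powr (\<beta> - 1)) * indicator {0<..<d x / r} s \<partial>lborel) = ennreal (d x powr \<beta> / r powr \<beta>)"
        by simp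
      moreover have "indicator {0<..<d x / r} s = (indicator {(x, s). x \<in> \<Omega> \<and> 0 < s \<and> r * s < d x} (x, s) :: ennreal)" for s
        using True r by (auto simp: indicator_def field_simps)
      ultimately show ?thesis using True by simp
    qed simp
  qed
  also have "\<dots> = (\<integral>\<^sup>+s. (\<integral>\<^sup>+x. ?k x s \<partial>lborel) \<partial>lborel)"
    by (rule lborel_pair.Fubini'[symmetric]) measurable
  also have "\<dots> = (\<integral>\<^sup>+s. ennreal (g s) \<partial>lborel)"
  proof (rule nn_integral_cong)
    fix s
    show "(\<integral>\<^sup>+x. ?k x s \<partial>lborel) = ennreal (g s)"
    proof (cases "0 < s")
      case True
      have "(\<integral>\<^sup>+x. ?k x s \<partial>lborel) = (\<integral>\<^sup>+x. ennreal (\<beta> * s powr (\<beta> - 1)) * indicator {x\<in>\<Omega>. r * s < d x} x \<partial>lborel)"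
        using True by (intro nn_integral_cong) (auto simp: indicator_def)
      also have "\<dots> = ennreal (\<beta> * s powr (\<beta> - 1)) * emeasure lborel {x\<in>\<Omega>. r * s < d x}"
        by (rule nn_integral_cmult_indicator) (use sets_level[of "\<lambda>y. r * s < y"] in simp)
      also have "emeasure lborel {x\<in>\<Omega>. r * s < d x} = ennreal (vol_above (r * s))"
        unfolding vol_above_def using fmeasurable_level[of "\<lambda>y. r * s < y"]
        by (intro emeasure_eq_ennreal_measure) (simp add: fmeasurable_def less_top)
      finally show ?thesis using True \<beta> by (simp add: g_def ennreal_mult' vol_above_def)
    qed (simp add: g_def)
  qed
  finally have nn: "(\<integral>\<^sup>+s. ennreal (g s) \<partial>lborel) = ennreal (moment \<beta>)" ..
  have gm: "g \<in> borel_measurable borel"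
    unfolding g_def using vol_above_measurable by measurable
  have g0: "0 \<le> g s" for s using \<beta> by (simp add: g_def vol_above_def)
  have "(g has_integral moment \<beta>) UNIV" by (rule nn_integral_has_integral[OF gm g0 nn M0])
  also have "g = (\<lambda>s. if s \<in> {0..1} then \<beta> * s powr (\<beta> - 1) * vol_above (r * s) else 0)"
  proof
    fix s
    have "vol_above (r * s) = 0" if "1 < s" using that r by (intro vol_above_eq_0) (simp add: r_def[symmetric])
    then show "g s = (if s \<in> {0..1} then \<beta> * s powr (\<beta> - 1) * vol_above (r * s) else 0)"
      by (auto simp: g_def)
  qed
  finally show ?thesis unfolding has_integral_restrict_UNIV r_def .
qed

lemma scale_interval:
  assumes "s \<in> {0..1}" "s \<noteq> 1"
  shows "0 \<le> inradius \<Omega> * s" "inradius \<Omega> * s < inradius \<Omega>" "inradius \<Omega> * s / inradius \<Omega> = s"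
  using assms inradius_pos by (auto simp: mult_less_cancel_left1)

lemma moment_ge:
  assumes "\<beta> \<ge> 0" shows "inverse (binom_real DIM('a) \<beta>) * measure lborel \<Omega> \<le> moment \<beta>"
proof (cases "\<beta> = 0")
  case False
  then have \<beta>: "\<beta> > 0" using assms by simp
  show ?thesis
  proof (rule has_integral_le[OF has_integral_cone[OF \<beta> DIM_positive] layer_cake[OF \<beta>]])
    fix s :: real assume s: "s \<in> {0..1}"
    have "(1 - s) ^ DIM('a) * measure lborel \<Omega> \<le> vol_above (inradius \<Omega> * s)"
    proof (cases "s = 1")
      case False
      show ?thesis using vol_above_homothety[OF scale_interval(1,2)[OF s False]] scale_interval(3)[OF s False] by simp
    qed (simp add: vol_above_def power_0_left)
    then show "\<beta> * s powr (\<beta> - 1) * ((1 - s) ^ DIM('a) * measure lborel \<Omega>) \<le> \<beta> * s powr (\<beta> - 1) * vol_above (inradius \<Omega> * s)"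
      using \<beta> by (intro mult_left_mono) auto
  qed
qed (simp add: moment_0 binom_real_0)

lemma moment_le_of_equality:
  assumes "\<beta> \<ge> 0" and eq: "measure lborel \<Omega> = perimeter \<Omega> * inradius \<Omega> / DIM('a)"
  shows "moment \<beta> \<le> inverse (binom_real DIM('a) \<beta>) * measure lborel \<Omega>"
proof (cases "\<beta> = 0")
  case False
  then have \<beta>: "\<beta> > 0" using assms by simp
  show ?thesis
  proof (rule has_integral_le[OF layer_cake[OF \<beta>] has_integral_cone[OF \<beta> DIM_positive]])
    fix s :: real assume s: "s \<in> {0..1}"
    have "vol_above (inradius \<Omega> * s) \<le> (1 - s) ^ DIM('a) * measure lborel \<Omega>"
    proof (cases "s = 1")
      case False
      show ?thesis using vol_above_le_of_equality[OF scale_interval(1,2)[OF s False] eq] scale_interval(3)[OF s False] by simp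
    qed (simp add: vol_above_eq_0)
    then show "\<beta> * s powr (\<beta> - 1) * vol_above (inradius \<Omega> * s) \<le> \<beta> * s powr (\<beta> - 1) * ((1 - s) ^ DIM('a) * measure lborel \<Omega>)"
      using \<beta> by (intro mult_left_mono) auto
  qed
qed (simp add: moment_0 binom_real_0)

text \<open>The profile bound is weak for each s but has slack \<delta> at s = 0. Monotonicity of
  \<open>vol_above\<close> spreads slack \<delta> / 2 over an interval [0, s1], where the kernel has
  positive mass.\<close>

lemma moment_less:
  assumes dim: "DIM('a) \<ge> 2" and "\<beta> \<ge> 0"
  shows "moment \<beta> < inradius \<Omega> * perimeter \<Omega> / (\<beta> + 1)"
proof (cases "\<beta> = 0")
  case True
  then show ?thesis using volume_less[OF dim] by (simp add: moment_0)
next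
  case False
  then have \<beta>: "\<beta> > 0" using assms by simp
  define r where "r = inradius \<Omega>"
  define c where "c = r * perimeter \<Omega>"
  define \<delta> where "\<delta> = c - measure lborel \<Omega>"
  have c: "0 < c" using inradius_pos perimeter_pos by (simp add: c_def r_def)
  have \<delta>: "0 < \<delta>" "\<delta> < c" using volume_less[OF dim] vol_pos by (auto simp: \<delta>_def c_def r_def)
  \<comment> \<open>Chosen so that s1 c = \<delta> / 2: up to s1 the linear bound has dropped by at
    most half the slack.\<close>
  define s1 where "s1 = \<delta> / (2 * c)"
  have s1: "0 < s1" "s1 < 1" using \<delta> c by (auto simp: s1_def)
  have "((\<lambda>s. \<beta> * (\<delta> / 2) * s powr (\<beta> - 1)) has_integral \<beta> * (\<delta> / 2) * (s1 powr (\<beta> - 1 + 1) / (\<beta> - 1 + 1))) {0..s1}"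
    using \<beta> s1 by (intro has_integral_mult_right has_integral_powr_from_0) auto
  then have "((\<lambda>s. if s \<in> {0..s1} then \<beta> * (\<delta> / 2) * s powr (\<beta> - 1) else 0) has_integral \<delta> / 2 * s1 powr \<beta>) {0..1}"
    using s1 \<beta> by (subst has_integral_restrict) auto
  from has_integral_diff[OF has_integral_slab_profile[OF \<beta>, of c] this]
  have "moment \<beta> \<le> c / (\<beta> + 1) - \<delta> / 2 * s1 powr \<beta>"
  proof (rule has_integral_le[OF layer_cake[OF \<beta>]])
    fix s :: real assume s: "s \<in> {0..1}"
    have 1: "vol_above (r * s) \<le> (1 - s) * c"
    proof (cases "s = 1")
      case False
      show ?thesis using vol_above_le[OF scale_interval(2)[OF s False]]
        by (simp add: r_def c_def algebra_simps)
    qed (simp add: vol_above_eq_0 r_def)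
    have 2: "vol_above (r * s) \<le> (1 - s) * c - \<delta> / 2" if "s \<le> s1"
    proof -
      have "vol_above (r * s) \<le> vol_above 0" using s inradius_pos by (intro vol_above_mono) (auto simp: r_def)
      also have "\<dots> = c - \<delta>" by (simp add: vol_above_0 \<delta>_def)
      also have "\<dots> \<le> (1 - s) * c - \<delta> / 2"
        using that c by (simp add: s1_def field_simps)
      finally show ?thesis .
    qed
    define b where "b = \<beta> * s powr (\<beta> - 1)"
    have b: "0 \<le> b" using \<beta> by (simp add: b_def)
    have "b * vol_above (r * s) \<le> b * ((1 - s) * c - (if s \<in> {0..s1} then \<delta> / 2 else 0))"
      using 1 2 s b by (intro mult_left_mono) auto
    then show "\<beta> * s powr (\<beta> - 1) * vol_above (inradius \<Omega> * s) \<le>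
      \<beta> * s powr (\<beta> - 1) * ((1 - s) * c) - (if s \<in> {0..s1} then \<beta> * (\<delta> / 2) * s powr (\<beta> - 1) else 0)"
      using s by (cases "s \<le> s1") (simp_all add: b_def r_def algebra_simps)
  qed
  moreover have "0 < \<delta> / 2 * s1 powr \<beta>" using \<delta> s1 by simp
  ultimately show ?thesis by (simp add: c_def r_def)
qed

section \<open>From moments to the ratio\<close>

lemma ratio_eq: "ratio \<beta> \<Omega> = moment \<beta> / (inradius \<Omega> * perimeter \<Omega>)"
  using inradius_pos by (simp add: ratio_def moment_def powr_add field_simps)

text \<open>The lower bound is the chain B c/N \<le> B V \<le> moment. Equality at the ends forces V
  = c/N because B > 0; conversely V = c/N closes the second link by
  \<open>moment_le_of_equality\<close>.\<close>

lemma ratio_bounds: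
  assumes dim: "DIM('a) \<ge> 2" and \<beta>: "\<beta> \<ge> 0"
  shows "1 / real DIM('a) * inverse (binom_real DIM('a) \<beta>) \<le> ratio \<beta> \<Omega>"
    and "ratio \<beta> \<Omega> < 1 / (\<beta> + 1)"
    and "1 / real DIM('a) * inverse (binom_real DIM('a) \<beta>) = ratio \<beta> \<Omega> \<longleftrightarrow>
      measure lborel \<Omega> = perimeter \<Omega> * inradius \<Omega> / real DIM('a)"
proof -
  define c where "c = inradius \<Omega> * perimeter \<Omega>"
  define N where "N = real DIM('a)"
  define B where "B = inverse (binom_real DIM('a) \<beta>)"
  define V where "V = measure lborel \<Omega>"
  have c: "0 < c" using inradius_pos perimeter_pos by (simp add: c_def)
  have N: "0 < N" using dim by (simp add: N_def)
  have B: "0 < B" using binom_real_pos[OF \<beta>] by (simp add: B_def)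
  have cV: "c / N \<le> V"
    using perimeter_le_volume inradius_pos N by (simp add: c_def N_def V_def field_simps)
  have ge: "B * V \<le> moment \<beta>" using moment_ge[OF \<beta>] by (simp add: B_def V_def)
  have rat: "ratio \<beta> \<Omega> = moment \<beta> / c" by (simp add: ratio_eq c_def)
  have "B * (c / N) \<le> B * V" using cV B by (intro mult_left_mono) auto
  then have "B * (c / N) \<le> moment \<beta>" using ge by simp
  then show "1 / real DIM('a) * inverse (binom_real DIM('a) \<beta>) \<le> ratio \<beta> \<Omega>"
    unfolding rat B_def[symmetric] N_def[symmetric] using c N by (simp add: field_simps)
  show "ratio \<beta> \<Omega> < 1 / (\<beta> + 1)"
    using moment_less[OF dim \<beta>] c unfolding rat c_def[symmetric] by (simp add: field_simps)
  have "1 / N * B = ratio \<beta> \<Omega> \<longleftrightarrow> B * (c / N) = moment \<beta>"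
    unfolding rat using c N by (auto simp: field_simps)
  also have "\<dots> \<longleftrightarrow> V = c / N"
  proof
    assume "B * (c / N) = moment \<beta>"
    then have "B * V \<le> B * (c / N)" using ge by simp
    then have "V \<le> c / N" using B by (rule mult_left_le_imp_le)
    then show "V = c / N" using cV by simp
  next
    assume eq: "V = c / N"
    then have "moment \<beta> \<le> B * V"
      using moment_le_of_equality[OF \<beta>] by (simp add: B_def V_def c_def N_def mult.commute)
    then show "B * (c / N) = moment \<beta>" using ge eq by simp
  qed
  finally show "1 / real DIM('a) * inverse (binom_real DIM('a) \<beta>) = ratio \<beta> \<Omega> \<longleftrightarrow>
      measure lborel \<Omega> = perimeter \<Omega> * inradius \<Omega> / real DIM('a)"
    by (simp add: N_def B_def V_def c_def mult.commute)
qed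

end

subsection \<open>Slabs\<close>

text \<open>The slab with every face moved inwards by t, written as a \<open>box\<close> so that its
  volume is a product of side lengths.\<close>

definition inner_slab :: "'a::euclidean_space \<Rightarrow> real \<Rightarrow> real \<Rightarrow> 'a set" where
  "inner_slab e L t = box (\<Sum>b\<in>Basis. (if b = e then t else t - L / 2) *\<^sub>R b)
     (\<Sum>b\<in>Basis. (if b = e then 1 - t else L / 2 - t) *\<^sub>R b)"

lemma mem_inner_slab:
  assumes "e \<in> Basis"
  shows "x \<in> inner_slab e L t \<longleftrightarrow> t < x \<bullet> e \<and> x \<bullet> e < 1 - t \<and>
    (\<forall>b\<in>Basis - {e}. t - L / 2 < x \<bullet> b \<and> x \<bullet> b < L / 2 - t)"
  unfolding inner_slab_def mem_box using assms
  by (auto simp: inner_sum_left_Basis)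

lemma slab_eq_inner_slab: "e \<in> Basis \<Longrightarrow> slab e L = inner_slab e L 0"
  by (auto simp: mem_inner_slab slab_def)

lemma measure_inner_slab:
  fixes e :: "'a::euclidean_space"
  assumes e: "e \<in> Basis" and t: "t \<le> 1 / 2" "t \<le> L / 2"
  shows "measure lborel (inner_slab e L t) = (1 - 2 * t) * (L - 2 * t) ^ (DIM('a) - 1)"
proof -
  let ?l = "\<Sum>b\<in>Basis. (if b = e then t else t - L / 2) *\<^sub>R b"
  let ?u = "\<Sum>b\<in>Basis. (if b = e then 1 - t else L / 2 - t) *\<^sub>R b"
  have in_l: "?l \<bullet> b = (if b = e then t else t - L / 2)" and in_u: "?u \<bullet> b = (if b = e then 1 - t else L / 2 - t)"
    if "b \<in> Basis" for b
    using that by (simp_all only: inner_sum_left_Basis)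
  have "measure lborel (inner_slab e L t) = (\<Prod>b\<in>Basis. (?u - ?l) \<bullet> b)"
    unfolding inner_slab_def by (rule measure_lborel_box) (use t in_l in_u in auto)
  also have "\<dots> = (\<Prod>b\<in>Basis. if b = e then 1 - 2 * t else L - 2 * t)"
    by (rule prod.cong) (auto simp: inner_diff_left in_l in_u)
  also have "\<dots> = (1 - 2 * t) * (\<Prod>b\<in>Basis - {e}. if b = e then 1 - 2 * t else L - 2 * t)"
    using prod.remove[OF finite_Basis e, of "\<lambda>b. if b = e then 1 - 2 * t else L - 2 * t"] by simp
  also have "(\<Prod>b\<in>Basis - {e}. if b = e then 1 - 2 * t else L - 2 * t) = (\<Prod>b\<in>Basis - {e}. L - 2 * t)"
    by (rule prod.cong) auto
  finally show ?thesis using e by (simp add: card_Diff_singleton)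
qed

text \<open>With 1 \<le> L the direction e is a thinnest one, so the inradius is 1/2 whatever L
  is.\<close>

locale slab_domain =
  fixes e :: "'a::euclidean_space" and L :: real
  assumes e: "e \<in> Basis" and L: "1 \<le> L"

sublocale slab_domain \<subseteq> convex_domain "slab e L"
proof
  have "slab e L = inner_slab e L 0" by (rule slab_eq_inner_slab[OF e])
  then show "bounded (slab e L)" "convex (slab e L)" "open (slab e L)"
    by (simp_all add: inner_slab_def bounded_box convex_box open_box)
  have "(1 / 2) *\<^sub>R e \<in> slab e L" using e L by (auto simp: slab_def inner_Basis)
  then show "slab e L \<noteq> {}" by blast
qed

context slab_domain begin

text \<open>A nearest boundary point has some coordinate on or beyond a face, so that coordinate
  alone differs from the one of x by more than t.\<close>

lemma d_gt_of_inner: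
  assumes t: "0 \<le> t" and x: "x \<in> inner_slab e L t"
  shows "x \<in> slab e L" "t < d x"
proof -
  note m = mem_inner_slab[OF e]
  show "x \<in> slab e L" using x t by (force simp: slab_eq_inner_slab[OF e] m)
  obtain y where y: "y \<in> frontier (slab e L)" "d x = dist x y"
    unfolding dist_bdry_def using infdist_attains_inf[OF frontier_closed frontier_nonempty] by blast
  have le: "\<bar>y \<bullet> b - x \<bullet> b\<bar> \<le> d x" if "b \<in> Basis" for b
    using Basis_le_norm[OF that, of "y - x"] y(2) by (simp add: inner_diff_left dist_norm norm_minus_commute)
  have "y \<notin> slab e L" using frontier_notin[OF y(1)] .
  then consider "y \<bullet> e \<le> 0" | "1 \<le> y \<bullet> e" | b where "b \<in> Basis - {e}" "y \<bullet> b \<le> - L / 2 \<or> L / 2 \<le> y \<bullet> b"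
    by (auto simp: slab_def not_less)
  then show "t < d x"
  proof cases
    case 1 then show ?thesis using le[OF e] x by (auto simp: m)
  next
    case 2 then show ?thesis using le[OF e] x by (auto simp: m)
  next
    case 3
    then have "t - L / 2 < x \<bullet> b" "x \<bullet> b < L / 2 - t" using x by (auto simp: m)
    then show ?thesis using le[of b] 3 by auto
  qed
qed

lemma inradius_slab: "inradius (slab e L) = 1 / 2"
proof (rule antisym)
  obtain x0 where x0: "x0 \<in> slab e L" "d x0 = inradius (slab e L)" using inradius_attained by blast
  have "d x0 \<le> 1 / 2"
  proof (rule dense_le)
    fix \<rho> assume \<rho>: "\<rho> < d x0"
    show "\<rho> \<le> 1 / 2"
    proof (cases "0 \<le> \<rho>")
      case True
      then have "x0 + \<rho> *\<^sub>R e \<in> slab e L" "x0 - \<rho> *\<^sub>R e \<in> slab e L"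
        using \<rho> e by (auto intro!: subsetD[OF ball_d_subset[OF x0(1)]] simp: dist_norm)
      then have "x0 \<bullet> e + \<rho> < 1" "0 < x0 \<bullet> e - \<rho>"
        using e by (auto simp: slab_def inner_add_left inner_diff_left)
      then show ?thesis by linarith
    qed simp
  qed
  then show "inradius (slab e L) \<le> 1 / 2" using x0 by simp
  show "1 / 2 \<le> inradius (slab e L)"
  proof (rule dense_le)
    fix t :: real assume t: "t < 1 / 2"
    show "t \<le> inradius (slab e L)"
    proof (cases "0 \<le> t")
      case True
      have "(1 / 2) *\<^sub>R e \<in> inner_slab e L t"
        using e L t by (auto simp: mem_inner_slab inner_Basis)
      from d_gt_of_inner[OF True this] show ?thesis using d_le_inradius by fastforce
    qed (use inradius_pos in linarith)
  qed
qed

lemma vol_above_slab: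
  assumes t: "0 \<le> t" "t \<le> 1 / 2"
  shows "(1 - 2 * t) * (L - 2 * t) ^ (DIM('a) - 1) \<le> vol_above t"
proof -
  have "(1 - 2 * t) * (L - 2 * t) ^ (DIM('a) - 1) = measure lborel (inner_slab e L t)"
    using measure_inner_slab[OF e, of t L] t L by simp
  also have "\<dots> \<le> vol_above t"
    unfolding vol_above_def
  proof (rule measure_mono_fmeasurable)
    show "inner_slab e L t \<subseteq> {x\<in>slab e L. t < d x}" using d_gt_of_inner[OF t(1)] by blast
  qed (auto simp: inner_slab_def intro: fmeasurable_level)
  finally show ?thesis .
qed

lemma volume_slab: "measure lborel (slab e L) = L ^ (DIM('a) - 1)"
  using measure_inner_slab[OF e, of 0 L] L by (simp add: slab_eq_inner_slab[OF e])

text \<open>The right side is the total area of the faces: two of area L^(N-1) and 2 (N-1) of area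
  L^(N-2). It arises as the collar slope by expanding the volume of the inner box with Bernoulli's
  inequality.\<close>

lemma perimeter_slab_le:
  "perimeter (slab e L) \<le> L ^ (DIM('a) - 1) * (2 + 2 * real (DIM('a) - 1) / L)"
proof (rule perimeter_le_of_collar[of "1 / 2"])
  fix t :: real assume t: "0 < t" "t < 1 / 2"
  define n where "n = DIM('a) - 1"
  define A where "A = (1 - 2 * t / L) ^ n"
  have q: "0 \<le> 2 * t / L" "2 * t / L \<le> 1" using t L by (auto simp: field_simps)
  have "1 + real n * (- (2 * t / L)) \<le> (1 + - (2 * t / L)) ^ n"
    using q by (intro Bernoulli_inequality) simp
  then have A1: "1 - real n * (2 * t / L) \<le> A" by (simp add: A_def)
  have A2: "A \<le> 1" unfolding A_def using q by (intro power_le_one) auto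
  have "2 * t * A \<le> 2 * t * 1" using A2 t by (intro mult_left_mono) auto
  then have "1 - real n * (2 * t / L) - 2 * t \<le> (1 - 2 * t) * A"
    using A1 by (simp add: left_diff_distrib)
  then have "L ^ n * (1 - real n * (2 * t / L) - 2 * t) \<le> L ^ n * ((1 - 2 * t) * A)"
    using L by (intro mult_left_mono) auto
  also have "\<dots> = (1 - 2 * t) * (L * (1 - 2 * t / L)) ^ n"
    by (simp add: A_def power_mult_distrib)
  also have "L * (1 - 2 * t / L) = L - 2 * t" using L by (simp add: right_diff_distrib)
  also have "(1 - 2 * t) * (L - 2 * t) ^ n \<le> vol_above t"
    unfolding n_def using t by (intro vol_above_slab) auto
  finally have "L ^ n - vol_above t \<le> L ^ n * (2 + 2 * real n / L) * t"
    by (simp add: algebra_simps)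
  then show "measure lborel (slab e L) - vol_above t \<le> L ^ (DIM('a) - 1) * (2 + 2 * real (DIM('a) - 1) / L) * t"
    unfolding volume_slab n_def .
qed simp

text \<open>At level s/2 the inner box has volume (1 - s) (L - s)^(N-1), which dominates a linear
  profile with constant (L - 1)^(N-1).\<close>

lemma moment_slab_ge:
  assumes "\<beta> \<ge> 0" shows "(L - 1) ^ (DIM('a) - 1) / (\<beta> + 1) \<le> moment \<beta>"
proof (cases "\<beta> = 0")
  case True
  then show ?thesis using L by (simp add: moment_0 volume_slab power_mono)
next
  case False
  then have \<beta>: "\<beta> > 0" using assms by simp
  show ?thesis
  proof (rule has_integral_le[OF has_integral_slab_profile[OF \<beta>] layer_cake[OF \<beta>]])
    fix s :: real assume s: "s \<in> {0..1}"
    have "(1 - s) * (L - 1) ^ (DIM('a) - 1) \<le> (1 - s) * (L - s) ^ (DIM('a) - 1)"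
      using s L by (intro mult_left_mono power_mono) auto
    also have "\<dots> \<le> vol_above (inradius (slab e L) * s)"
      using vol_above_slab[of "s / 2"] s by (simp add: inradius_slab)
    finally show "\<beta> * s powr (\<beta> - 1) * ((1 - s) * (L - 1) ^ (DIM('a) - 1)) \<le>
        \<beta> * s powr (\<beta> - 1) * vol_above (inradius (slab e L) * s)"
      using \<beta> by (intro mult_left_mono) auto
  qed
qed

text \<open>The inradius 1/2 turns the denominator into P / 2, which cancels the factor 2 of the
  perimeter bound.\<close>

lemma ratio_slab_ge:
  assumes "\<beta> \<ge> 0"
  shows "(1 - 1 / L) ^ (DIM('a) - 1) / (1 + real (DIM('a) - 1) / L) / (\<beta> + 1) \<le> ratio \<beta> (slab e L)"
proof -
  define n where "n = DIM('a) - 1"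
  define P where "P = perimeter (slab e L)"
  have P: "0 < P" "P \<le> L ^ n * (2 + 2 * real n / L)"
    using perimeter_pos perimeter_slab_le by (auto simp: P_def n_def)
  have q: "0 < 1 + real n / L" using L by (simp add: add_pos_nonneg)
  have "(1 - 1 / L) ^ n / (1 + real n / L) / (\<beta> + 1) = (L * (1 - 1 / L)) ^ n / (\<beta> + 1) / (L ^ n * (1 + real n / L))"
    using L by (simp add: power_mult_distrib mult.commute)
  also have "L * (1 - 1 / L) = L - 1" using L by (simp add: right_diff_distrib)
  also have "(L - 1) ^ n / (\<beta> + 1) / (L ^ n * (1 + real n / L)) \<le> (L - 1) ^ n / (\<beta> + 1) / (P / 2)"
  proof (rule divide_left_mono)
    show "P / 2 \<le> L ^ n * (1 + real n / L)" using P(2) by (simp add: algebra_simps)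
    show "0 < L ^ n * (1 + real n / L) * (P / 2)" using P(1) q L by simp
  qed (use L assms in auto)
  also have "\<dots> \<le> moment \<beta> / (P / 2)"
    using moment_slab_ge[OF assms] P by (intro divide_right_mono) (auto simp: n_def)
  also have "\<dots> = ratio \<beta> (slab e L)" by (simp add: ratio_eq inradius_slab P_def)
  finally show ?thesis by (simp add: n_def)
qed

end

text \<open>The upper side of the sandwich is the general bound for convex domains; the explicit
  lower bound for slabs tends to the same value.\<close>

lemma ratio_slab_tendsto:
  fixes e :: "'a::euclidean_space"
  assumes dim: "DIM('a) \<ge> 2" and \<beta>: "\<beta> \<ge> 0" and e: "e \<in> Basis"
  shows "((\<lambda>L. ratio \<beta> (slab e L)) \<longlongrightarrow> 1 / (\<beta> + 1)) at_top"
proof (rule tendsto_sandwich)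
  let ?f = "\<lambda>L. (1 - 1 / L) ^ (DIM('a) - 1) / (1 + real (DIM('a) - 1) / L) / (\<beta> + 1)"
  have slab: "slab_domain e L" if "1 \<le> L" for L using e that by unfold_locales
  show "\<forall>\<^sub>F L in at_top. ?f L \<le> ratio \<beta> (slab e L)"
    using eventually_ge_at_top[of 1] by eventually_elim (rule slab_domain.ratio_slab_ge[OF slab \<beta>])
  show "\<forall>\<^sub>F L in at_top. ratio \<beta> (slab e L) \<le> 1 / (\<beta> + 1)"
    using eventually_ge_at_top[of 1]
  proof eventually_elim
    case (elim L)
    interpret slab_domain e L by (rule slab[OF elim])
    show ?case using ratio_bounds(2)[OF dim \<beta>] by simp
  qed
  have z: "((\<lambda>L::real. c / L) \<longlongrightarrow> 0) at_top" for c
    by (rule tendsto_divide_0[OF tendsto_const]) (simp add: filterlim_at_top_imp_at_infinity filterlim_ident)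
  have "(?f \<longlongrightarrow> (1 - 0) ^ (DIM('a) - 1) / (1 + 0) / (\<beta> + 1)) at_top"
    using \<beta> by (intro tendsto_intros z) auto
  then show "(?f \<longlongrightarrow> 1 / (\<beta> + 1)) at_top" by simp
qed simp

theorem theorem2p1:
  fixes \<Omega> :: "'a::euclidean_space set" and \<beta> :: real
  assumes "DIM('a) \<ge> 2"
    and "bounded \<Omega>" and "convex \<Omega>" and "open \<Omega>" and "\<Omega> \<noteq> {}"
    and "\<beta> \<ge> 0"
  shows "1 / real DIM('a) * inverse (binom_real DIM('a) \<beta>) \<le> ratio \<beta> \<Omega>
    \<and> ratio \<beta> \<Omega> < 1 / (\<beta> + 1)
    \<and> ((1 / real DIM('a) * inverse (binom_real DIM('a) \<beta>) = ratio \<beta> \<Omega>) \<longleftrightarrow>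
           measure lebesgue \<Omega> = perimeter \<Omega> * inradius \<Omega> / real DIM('a))
    \<and> (\<forall>e\<in>(Basis :: 'a set). ((\<lambda>L. ratio \<beta> (slab e L)) \<longlongrightarrow> 1 / (\<beta> + 1)) at_top)"
proof -
  interpret convex_domain \<Omega> by unfold_locales (use assms in auto)
  have "measure lebesgue \<Omega> = measure lborel \<Omega>" using sets_\<Omega> by (simp add: measure_completion)
  then show ?thesis
    using ratio_bounds[OF assms(1,6)] ratio_slab_tendsto[OF assms(1,6)] by simp
qed

end
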